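(* Let $H:\Omega_\mu\to\{0,\ldots,n\}$ be a nonnegative Hamiltonian on a finite set $\Omega_\mu$, with Gibbs distributions $\mu_\beta(x):=e^{-\beta H(x)}/\mathcal Z(\beta)$, $\mathcal Z(\beta):=\sum_{x\in\Omega_\mu}e^{-\beta H(x)}$. There exists a cooling schedule $\beta_0=0<\cdots<\beta_\ell$ of length $\ell=\mathcal O(\sqrt{\ln|\Omega_\mu|\,\ln n})$ with overlaps $|\langle\mu_{\beta_i}|\mu_{\beta_{i+1}}\rangle|^2\ge\frac1{15}$. For this schedule, assume that for each inverse temperature $\beta_i$ there is a reversible ergodic Markov chain $\mathcal P_{\beta_i}$ on $\Omega_\mu$ with stationary distribution $\mu_{\beta_i}$ and spectral gap $\delta(\mathcal P_{\beta_i})$. Define $\delta_{\min}:=\min_{0\le i\le\ell}\delta(\mathcal P_{\beta_i})$ and the associated minimum phase gap $\Delta_{\min}:=\min_{0\le i\le\ell}\Delta_{\mathcal W_{\beta_i}}$, where $\mathcal W_{\beta_i}$ is the qubitized Szegedy walk of $\mathcal P_{\beta_i}$. Then for any $\varepsilon\in(0,1)$, given access to the oracles $O_{\mathcal P_{\beta_i}}$, there exists a quantum algorithm that outputs a joint state $|\widetilde\Psi_{\beta_\ell}\rangle$ satisfying $$D_{\mathrm{tr}}\bigl(|\widetilde\Psi_{\beta_\ell}\rangle,\ \mathcal J|\mu_{\beta_\ell}\rangle\bigr)\le\varepsilon$$ with query complexity $$\widetilde{\mathcal O}\!\left(\frac{\sqrt{\ln|\Omega_\mu|\,\ln n}}{\Delta_{\min}}\right),$$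 and uses one additional qubit in the working register (i.e. one qubit besides the two registers $A$, $B$ that encode $\Omega_\mu$).
   Context: For a probability distribution $\mu$ on a finite set $\Omega$, $|\mu\rangle:=\sum_{x\in\Omega}\sqrt{\mu(x)}\,|x\rangle$. For a reversible ergodic Markov chain $\mathcal P$ on $\Omega$ with transition matrix $P$, the spectral gap is $\delta(\mathcal P):=1-\lambda_2(P)$, with $\lambda_2(P)$ the second-largest eigenvalue. Registers $A,B$ (each of $\lceil\log_2|\Omega|\rceil$ qubits) have state spaces $\mathcal H_A,\mathcal H_B$ with basis indexed by $\Omega$, $|0\rangle_B$ is the all-zeros reference basis state of $B$, and $\mathcal H_s\cong\mathbb C^2$ is a signal qubit. The step isometry $\mathcal T:\mathcal H_A\to\mathcal H_A\otimes\mathcal H_B$ is $\mathcal T|x\rangle:=|x\rangle\sum_y\sqrt{P(x,y)}|y\rangle$, the swap is $S|x\rangle|y\rangle:=|y\rangle|x\rangle$, and the qubitized Szegedy walk of $\mathcal P$ is $\mathcal W:=(2\mathcal T\mathcal T^\dagger-\mathbb I)S$. Its phase gap is $\Delta_{\mathcal W}:=\min\{|\theta|:\theta\neq0,\ e^{i\theta}\in\mathrm{spec}(\mathcal W),\ \theta\in(-\pi,\pi]\}$. The oracle $O_{\mathcal P}$ is a unitary on $\mathcal H_A\otimes\mathcal H_B$ with $O_{\mathcal P}|x\rangle|0\rangle=\sum_y\sqrt{P(x,y)}|x\rangle|y\rangle$ for all $x\in\Omega$; a query is a use of $O_{\mathcal P}$ or $O_{\mathcal P}^\dagger$, and query complexity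 counts the total number of queries to the oracles $O_{\mathcal P_{\beta_i}}$ and their adjoints. The embedding $\mathcal J:\mathcal H_A\to\mathcal H_s\otimes\mathcal H_A\otimes\mathcal H_B$ is $\mathcal J|v\rangle:=|0\rangle_s|v\rangle_A|0\rangle_B$. For normalized pure states, $D_{\mathrm{tr}}(|\alpha\rangle,|\beta\rangle):=\sqrt{1-|\langle\alpha|\beta\rangle|^2}$ is the trace distance. $\widetilde{\mathcal O}$ suppresses factors polylogarithmic in $\sqrt{\ln|\Omega_\mu|\,\ln n}$ and $1/\varepsilon$. The existence of the cooling schedule is a known result of Arunachalam et al. *)

theory Defs
  imports
    Complex_Main
    "Jordan_Normal_Form.Schur_Decomposition"
    "Jordan_Normal_Form.Spectral_Radius"
begin

text \<open>The finite set \<open>\<Omega>\<close> is \<open>{..<d}\<close> throughout. The basis vector \<open>|x\<rangle>|y\<rangle>\<close> of a tensor product has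
  index \<open>x * (dimension of the second factor) + y\<close>.\<close>

definition kron_mat :: "complex mat \<Rightarrow> complex mat \<Rightarrow> complex mat" where
  "kron_mat A B = mat (dim_row A * dim_row B) (dim_col A * dim_col B)
     (\<lambda>(r, c). A $$ (r div dim_row B, c div dim_col B) * B $$ (r mod dim_row B, c mod dim_col B))"

definition kron_vec :: "complex vec \<Rightarrow> complex vec \<Rightarrow> complex vec" where
  "kron_vec u v = vec (dim_vec u * dim_vec v) (\<lambda>r. u $ (r div dim_vec v) * v $ (r mod dim_vec v))"

definition unitary_mat :: "nat \<Rightarrow> complex mat \<Rightarrow> bool" where
  "unitary_mat N U \<longleftrightarrow> U \<in> carrier_mat N N \<and> mat_adjoint U * U = 1\<^sub>m N \<and> U * mat_adjoint U = 1\<^sub>m N"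

definition trace_distance :: "complex vec \<Rightarrow> complex vec \<Rightarrow> real" where
  "trace_distance u v = sqrt (1 - (cmod (u \<bullet>c v))\<^sup>2)"


section \<open>Gibbs distributions and cooling schedules\<close>

definition partition_fun :: "nat \<Rightarrow> (nat \<Rightarrow> nat) \<Rightarrow> real \<Rightarrow> real" where
  "partition_fun d H \<beta> = (\<Sum>x<d. exp (- \<beta> * real (H x)))"

definition gibbs :: "nat \<Rightarrow> (nat \<Rightarrow> nat) \<Rightarrow> real \<Rightarrow> nat \<Rightarrow> real" where
  "gibbs d H \<beta> x = exp (- \<beta> * real (H x)) / partition_fun d H \<beta>"

definition qsample :: "nat \<Rightarrow> (nat \<Rightarrow> real) \<Rightarrow> complex vec" where
  "qsample d \<mu> = vec d (\<lambda>x. complex_of_real (sqrt (\<mu> x)))"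

definition schedule_scale :: "nat \<Rightarrow> nat \<Rightarrow> real" where
  "schedule_scale d n = sqrt (ln (real d) * ln (real n))"

text \<open>\<open>C\<close> is the constant of the bound \<open>\<ell> = O(sqrt (ln |\<Omega>| * ln n))\<close>.\<close>

definition cooling_schedule ::
    "real \<Rightarrow> nat \<Rightarrow> nat \<Rightarrow> (nat \<Rightarrow> nat) \<Rightarrow> nat \<Rightarrow> (nat \<Rightarrow> real) \<Rightarrow> bool" where
  "cooling_schedule C d n H l \<beta> \<longleftrightarrow>
     \<beta> 0 = 0 \<and> (\<forall>i<l. \<beta> i < \<beta> (Suc i)) \<and>
     real l \<le> C * schedule_scale d n \<and>
     (\<forall>i<l. (cmod (qsample d (gibbs d H (\<beta> i)) \<bullet>c qsample d (gibbs d H (\<beta> (Suc i)))))\<^sup>2 \<ge> 1 / 15)"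


section \<open>Markov chains and their Szegedy walks\<close>

definition stochastic :: "nat \<Rightarrow> real mat \<Rightarrow> bool" where
  "stochastic d P \<longleftrightarrow> P \<in> carrier_mat d d \<and> (\<forall>x<d. \<forall>y<d. 0 \<le> P $$ (x, y)) \<and>
     (\<forall>x<d. (\<Sum>y<d. P $$ (x, y)) = 1)"

definition stationary :: "nat \<Rightarrow> (nat \<Rightarrow> real) \<Rightarrow> real mat \<Rightarrow> bool" where
  "stationary d \<pi> P \<longleftrightarrow> (\<forall>y<d. (\<Sum>x<d. \<pi> x * P $$ (x, y)) = \<pi> y)"

definition reversible :: "nat \<Rightarrow> (nat \<Rightarrow> real) \<Rightarrow> real mat \<Rightarrow> bool" where
  "reversible d \<pi> P \<longleftrightarrow> (\<forall>x<d. \<forall>y<d. \<pi> x * P $$ (x, y) = \<pi> y * P $$ (y, x))"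

definition irreducible_chain :: "nat \<Rightarrow> real mat \<Rightarrow> bool" where
  "irreducible_chain d P \<longleftrightarrow> (\<forall>x<d. \<forall>y<d. \<exists>k. 0 < (P ^\<^sub>m k) $$ (x, y))"

definition aperiodic_chain :: "nat \<Rightarrow> real mat \<Rightarrow> bool" where
  "aperiodic_chain d P \<longleftrightarrow> (\<forall>x<d. Gcd {k. 0 < k \<and> 0 < (P ^\<^sub>m k) $$ (x, x)} = 1)"

definition reversible_ergodic_chain :: "nat \<Rightarrow> (nat \<Rightarrow> real) \<Rightarrow> real mat \<Rightarrow> bool" where
  "reversible_ergodic_chain d \<pi> P \<longleftrightarrow> stochastic d P \<and> stationary d \<pi> P \<and> reversible d \<pi> P \<and>
     irreducible_chain d P \<and> aperiodic_chain d P"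

text \<open>Eigenvalues in decreasing order, with multiplicity; for a reversible chain all \<open>d\<close> of them are
  real, so no root of the characteristic polynomial is missed.\<close>

definition eigenvalues_desc :: "real mat \<Rightarrow> real list" where
  "eigenvalues_desc P = rev (sorted_list_of_multiset (proots (char_poly P)))"

definition spectral_gap :: "real mat \<Rightarrow> real" where
  "spectral_gap P = 1 - eigenvalues_desc P ! 1"

definition step_isometry :: "nat \<Rightarrow> real mat \<Rightarrow> complex mat" where
  "step_isometry d P = mat (d * d) d
     (\<lambda>(r, x). if r div d = x then complex_of_real (sqrt (P $$ (x, r mod d))) else 0)"

definition swap_mat :: "nat \<Rightarrow> complex mat" where
  "swap_mat d = mat (d * d) (d * d) (\<lambda>(r, c). if r div d = c mod d \<and> r mod d = c div d then 1 else 0)"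

definition szegedy_walk :: "nat \<Rightarrow> real mat \<Rightarrow> complex mat" where
  "szegedy_walk d P =
     (2 \<cdot>\<^sub>m (step_isometry d P * mat_adjoint (step_isometry d P)) - 1\<^sub>m (d * d)) * swap_mat d"

definition phase_gap :: "complex mat \<Rightarrow> real" where
  "phase_gap W = Min {\<bar>\<theta>\<bar> | \<theta>. \<theta> \<noteq> 0 \<and> cis \<theta> \<in> spectrum W \<and> \<theta> \<in> {-pi<..pi}}"


section \<open>Registers, oracles and algorithms\<close>

definition reg_qubits :: "nat \<Rightarrow> nat" where
  "reg_qubits d = nat \<lceil>log 2 (real d)\<rceil>"

text \<open>\<open>enc x\<close> is the computational basis state (bit string, read as a number) that represents
  \<open>x \<in> \<Omega>\<close> in a register. The all-zeros string \<open>0\<close> need not represent an element of \<open>\<Omega>\<close>.\<close>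

definition encoding :: "nat \<Rightarrow> (nat \<Rightarrow> nat) \<Rightarrow> bool" where
  "encoding d enc \<longleftrightarrow> inj_on enc {..<d} \<and> enc ` {..<d} \<subseteq> {..<2 ^ reg_qubits d}"

definition enc_isometry :: "nat \<Rightarrow> (nat \<Rightarrow> nat) \<Rightarrow> complex mat" where
  "enc_isometry d enc = mat (2 ^ reg_qubits d) d (\<lambda>(r, x). if r = enc x then 1 else 0)"

definition chain_oracle :: "nat \<Rightarrow> (nat \<Rightarrow> nat) \<Rightarrow> real mat \<Rightarrow> complex mat \<Rightarrow> bool" where
  "chain_oracle d enc P Q \<longleftrightarrow>
     (let M = 2 ^ reg_qubits d; E = enc_isometry d enc in
       unitary_mat (M * M) Q \<and>
       (\<forall>x<d. Q *\<^sub>v kron_vec (unit_vec M (enc x)) (unit_vec M 0)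
            = kron_mat E E *\<^sub>v (step_isometry d P *\<^sub>v unit_vec d x)))"

definition J_embed :: "nat \<Rightarrow> (nat \<Rightarrow> nat) \<Rightarrow> complex vec \<Rightarrow> complex vec" where
  "J_embed d enc v =
     kron_vec (unit_vec 2 0) (kron_vec (enc_isometry d enc *\<^sub>v v) (unit_vec (2 ^ reg_qubits d) 0))"

text \<open>Query algorithms are circuits on \<open>w\<close> working qubits followed by the registers \<open>A\<close> and \<open>B\<close>.
  A circuit is syntax: its fixed gates cannot depend on the oracles, which enter only through the
  \<open>Query\<close> and \<open>Query_Adj\<close> gates, labelled by the position in the schedule.\<close>

datatype gate = Fixed "complex mat" | Query nat | Query_Adj nat

type_synonym circuit = "gate list"

primrec gate_ok :: "nat \<Rightarrow> nat \<Rightarrow> nat \<Rightarrow> gate \<Rightarrow> bool" where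
  "gate_ok w d l (Fixed U) = unitary_mat (2 ^ w * (2 ^ reg_qubits d * 2 ^ reg_qubits d)) U"
| "gate_ok w d l (Query i) = (i \<le> l)"
| "gate_ok w d l (Query_Adj i) = (i \<le> l)"

definition circuit_ok :: "nat \<Rightarrow> nat \<Rightarrow> nat \<Rightarrow> circuit \<Rightarrow> bool" where
  "circuit_ok w d l c \<longleftrightarrow> (\<forall>g \<in> set c. gate_ok w d l g)"

primrec gate_mat :: "nat \<Rightarrow> (nat \<Rightarrow> complex mat) \<Rightarrow> gate \<Rightarrow> complex mat" where
  "gate_mat w Q (Fixed U) = U"
| "gate_mat w Q (Query i) = kron_mat (1\<^sub>m (2 ^ w)) (Q i)"
| "gate_mat w Q (Query_Adj i) = kron_mat (1\<^sub>m (2 ^ w)) (mat_adjoint (Q i))"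

definition run_circuit :: "nat \<Rightarrow> nat \<Rightarrow> (nat \<Rightarrow> complex mat) \<Rightarrow> circuit \<Rightarrow> complex vec" where
  "run_circuit w d Q c = fold (\<lambda>g v. gate_mat w Q g *\<^sub>v v) c
     (unit_vec (2 ^ w * (2 ^ reg_qubits d * 2 ^ reg_qubits d)) 0)"

definition query_count :: "circuit \<Rightarrow> nat" where
  "query_count c = length (filter (\<lambda>g. \<forall>U. g \<noteq> Fixed U) c)"

end

theory Submission
  imports Defs "HOL-Analysis.L2_Norm"
begin

text \<open>The oracle conjugates the projector onto the vectors fixed by the register swap into a projector whose
  compression to the embedded space is \<open>(1 + D) / 2\<close>, where \<open>D\<close> is the discriminant of the chain. The
  Gibbs state is its only vector with singular value 1; the other singular values are at most
  \<open>cos (\<Delta> / 2)\<close>, since an eigenvalue \<open>cos \<theta> < 1\<close> of \<open>D\<close> gives the walk phase \<open>\<theta>\<close>. Nesting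
  \<open>U G U\<^sup>* H U\<close> with suitable phases \<open>G\<close>, \<open>H\<close> applies Chebyshev polynomials of degree \<open>3\<^sup>m\<close> to the singular
  values; with \<open>3\<^sup>m\<close> of order \<open>ln (1 / \<eta>) / \<Delta>\<close> this implements, up to \<open>\<eta>\<close>, phases about a Gibbs state.
  The same nesting with all phases equal to \<open>\<pi> / 3\<close> (fixed-point amplification) then moves one Gibbs state of
  the schedule to the next, because their overlap is bounded below. No step uses the working qubit.

  The schedule is greedy: each step has \<open>f a + f b - 2 f ((a + b) / 2) = 1\<close> for \<open>f = ln Z\<close>, which forces
  the product of the decrease of \<open>f\<close> and the decrease of \<open>ln (- f')\<close> to be at least 1; by Cauchy-Schwarz there are
  at most about \<open>sqrt (ln |\<Omega>| ln (2 n))\<close> steps before the mean energy is below \<open>1 / 2\<close>, and then one step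
  reaches any lower temperature.\<close>


section \<open>Inner products and norms\<close>

text \<open>Two unknowns shape the circuit. Overlaps of consecutive Gibbs states are only bounded
  below, so plain amplitude amplification could overshoot; phases pi / 3 cube the distance to the
  target whatever the overlap is, and a constant lower bound makes logarithmically many reflections
  enough. Of the spectrum of \<open>D\<close> only a gap below 1 is known, and the cost must grow
  like 1 / Delta rather than 1 / Delta^2; this is what the growth of Chebyshev polynomials just
  outside [-1, 1] provides. Degrees that are powers of 3 come from nesting alone. The walk is never
  run: it enters only through its phase gap, which bounds the eigenvalues of \<open>D\<close>.
  Singular values are sqrt ((1 + l) / 2), so eigenvalues l near -1 do no harm and the chain need not
  be made lazy. The approximate phases are controlled only on the range of \<open>J\<close>, where
  the oracle is specified. The ideal phases keep that range invariant, and unitarity of all later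
  gates makes the errors merely add up.\<close>

definition vnorm :: "complex vec \<Rightarrow> real" where
  "vnorm v = L2_set (\<lambda>i. cmod (v $ i)) {..<dim_vec v}"

lemma cinner_alt: "dim_vec v = n \<Longrightarrow> dim_vec w = n \<Longrightarrow> v \<bullet>c w = (\<Sum>i<n. v $ i * cnj (w $ i))"
  by (auto simp: scalar_prod_def atLeast0LessThan intro!: sum.cong)

lemma cinner_self: "v \<bullet>c v = complex_of_real ((vnorm v)\<^sup>2)"
  by (simp add: cinner_alt[OF refl refl] vnorm_def L2_set_def sum_nonneg
      flip: complex_norm_square)

lemma vnorm_nonneg [simp]: "0 \<le> vnorm v"
  by (simp add: vnorm_def L2_set_nonneg)

lemma cinner_carrier:
  assumes "v \<in> carrier_vec n" "w \<in> carrier_vec n"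
  shows "v \<bullet>c w = (\<Sum>i<n. v $ i * cnj (w $ i))"
  using assms by (intro cinner_alt) auto

lemma cinner_add_left [simp]:
  "u \<in> carrier_vec n \<Longrightarrow> v \<in> carrier_vec n \<Longrightarrow> w \<in> carrier_vec n \<Longrightarrow>
    (u + v) \<bullet>c w = u \<bullet>c w + v \<bullet>c (w :: complex vec)"
  by (simp add: cinner_carrier[of _ n] distrib_right sum.distrib)

lemma cinner_diff_left [simp]:
  "u \<in> carrier_vec n \<Longrightarrow> v \<in> carrier_vec n \<Longrightarrow> w \<in> carrier_vec n \<Longrightarrow>
    (u - v) \<bullet>c w = u \<bullet>c w - v \<bullet>c (w :: complex vec)"
  by (simp add: cinner_carrier[of _ n] left_diff_distrib sum_subtractf)

lemma cinner_smult_left [simp]: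
  "u \<in> carrier_vec n \<Longrightarrow> w \<in> carrier_vec n \<Longrightarrow> (c \<cdot>\<^sub>v u) \<bullet>c w = c * (u \<bullet>c (w :: complex vec))"
  by (simp add: cinner_carrier[of _ n] sum_distrib_left mult.assoc)

lemma cinner_add_right [simp]:
  "u \<in> carrier_vec n \<Longrightarrow> v \<in> carrier_vec n \<Longrightarrow> w \<in> carrier_vec n \<Longrightarrow>
    w \<bullet>c (u + v) = w \<bullet>c u + (w :: complex vec) \<bullet>c v"
  by (simp add: cinner_carrier[of _ n] distrib_left sum.distrib)

lemma cinner_diff_right [simp]:
  "u \<in> carrier_vec n \<Longrightarrow> v \<in> carrier_vec n \<Longrightarrow> w \<in> carrier_vec n \<Longrightarrow>
    w \<bullet>c (u - v) = w \<bullet>c u - (w :: complex vec) \<bullet>c v"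
  by (simp add: cinner_carrier[of _ n] right_diff_distrib sum_subtractf)

lemma cinner_smult_right [simp]:
  "u \<in> carrier_vec n \<Longrightarrow> w \<in> carrier_vec n \<Longrightarrow> w \<bullet>c (c \<cdot>\<^sub>v u) = cnj c * ((w :: complex vec) \<bullet>c u)"
  by (simp add: cinner_carrier[of _ n] sum_distrib_left mult.left_commute)

lemma cinner_commute:
  "u \<in> carrier_vec n \<Longrightarrow> w \<in> carrier_vec n \<Longrightarrow> w \<bullet>c u = cnj (u \<bullet>c (w :: complex vec))"
  by (simp add: cinner_carrier[of _ n] mult.commute)

lemma vnorm_eq_0: "v \<in> carrier_vec n \<Longrightarrow> vnorm v = 0 \<longleftrightarrow> v = 0\<^sub>v n"
  by (auto simp: vnorm_def L2_set_eq_0_iff)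

lemma vnorm_triangle:
  assumes "u \<in> carrier_vec n" "v \<in> carrier_vec n"
  shows "vnorm (u + v) \<le> vnorm u + vnorm v"
proof -
  have "vnorm (u + v) = L2_set (\<lambda>i. cmod (u $ i + v $ i)) {..<n}"
    using assms unfolding vnorm_def by (intro L2_set_cong) auto
  also have "\<dots> \<le> L2_set (\<lambda>i. cmod (u $ i) + cmod (v $ i)) {..<n}"
    by (intro L2_set_mono) (auto simp: norm_triangle_ineq)
  also have "\<dots> \<le> vnorm u + vnorm v"
    using L2_set_triangle_ineq[of "\<lambda>i. cmod (u $ i)" "\<lambda>i. cmod (v $ i)" "{..<n}"] assms
    by (simp add: vnorm_def)
  finally show ?thesis .
qed

lemma vnorm_triangle_diff:
  assumes "u \<in> carrier_vec n" "v \<in> carrier_vec n" "w \<in> carrier_vec n"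
  shows "vnorm (u - w) \<le> vnorm (u - v) + vnorm (v - w)"
proof -
  have "u - w = (u - v) + (v - w)" using assms by (intro eq_vecI) auto
  then show ?thesis using assms by (metis minus_carrier_vec vnorm_triangle)
qed

lemma vnorm_smult: "vnorm (c \<cdot>\<^sub>v v) = cmod c * vnorm v"
proof -
  have "vnorm (c \<cdot>\<^sub>v v) = L2_set (\<lambda>i. cmod c * cmod (v $ i)) {..<dim_vec v}"
    unfolding vnorm_def by (intro L2_set_cong) (auto simp: norm_mult)
  then show ?thesis by (simp add: vnorm_def L2_set_right_distrib)
qed

lemma vnorm_eqI: "u \<bullet>c u = v \<bullet>c v \<Longrightarrow> vnorm u = vnorm v"
  unfolding cinner_self of_real_eq_iff by (simp add: power2_eq_iff_nonneg)

text \<open>With b the inner product of u and v, the squared distance from u to c v is 1 - |b|^2 +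
  |b - c|^2, so the trace distance is the distance from u to the complex line through v. The free c
  absorbs global phases and lost amplitude.\<close>

lemma trace_distance_le:
  assumes u: "u \<in> carrier_vec n" "vnorm u = 1" and v: "v \<in> carrier_vec n" "vnorm v = 1"
    and e: "vnorm (u - c \<cdot>\<^sub>v v) \<le> e"
  shows "trace_distance u v \<le> e"
proof -
  define b where "b = u \<bullet>c v"
  have b': "v \<bullet>c u = cnj b" unfolding b_def using u v by (simp add: cinner_commute[of u n v])
  have "u \<bullet>c u = 1" "v \<bullet>c v = 1" using u v by (simp_all add: cinner_self)
  then have "complex_of_real ((vnorm (u - c \<cdot>\<^sub>v v))\<^sup>2) = 1 - c * cnj b - cnj c * b + c * cnj c"
    using u v unfolding cinner_self[symmetric] by (simp add: b' b_def[symmetric] algebra_simps)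
  also have "\<dots> = complex_of_real (1 - (cmod b)\<^sup>2 + (cmod (b - c))\<^sup>2)"
    unfolding of_real_add of_real_diff complex_norm_square by (simp add: algebra_simps)
  finally have "(vnorm (u - c \<cdot>\<^sub>v v))\<^sup>2 = 1 - (cmod b)\<^sup>2 + (cmod (b - c))\<^sup>2"
    using of_real_eq_iff by blast
  then have "1 - (cmod b)\<^sup>2 \<le> (vnorm (u - c \<cdot>\<^sub>v v))\<^sup>2" by simp
  also have "\<dots> \<le> e\<^sup>2" using e by (intro power_mono) auto
  finally show ?thesis unfolding trace_distance_def b_def[symmetric]
    using order_trans[OF vnorm_nonneg e] by (intro real_le_lsqrt) auto
qed

section \<open>Linear operators on coordinate spaces\<close>

definition linop :: "nat \<Rightarrow> (complex vec \<Rightarrow> complex vec) \<Rightarrow> bool" where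
  "linop n f \<longleftrightarrow> (\<forall>v\<in>carrier_vec n. f v \<in> carrier_vec n) \<and>
     (\<forall>v\<in>carrier_vec n. \<forall>w\<in>carrier_vec n. f (v + w) = f v + f w) \<and>
     (\<forall>v\<in>carrier_vec n. \<forall>c. f (c \<cdot>\<^sub>v v) = c \<cdot>\<^sub>v f v)"

text \<open>A unitary together with its inverse, which is also its adjoint. With functions, gate
  sequences are plain compositions; \<open>opmat\<close> returns to matrices for the fixed gates of
  a circuit.\<close>

definition unipair :: "nat \<Rightarrow> (complex vec \<Rightarrow> complex vec) \<Rightarrow> (complex vec \<Rightarrow> complex vec) \<Rightarrow> bool" where
  "unipair n f g \<longleftrightarrow> linop n f \<and> linop n g \<and>
     (\<forall>v\<in>carrier_vec n. g (f v) = v) \<and> (\<forall>v\<in>carrier_vec n. f (g v) = v) \<and>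
     (\<forall>v\<in>carrier_vec n. \<forall>w\<in>carrier_vec n. f v \<bullet>c w = v \<bullet>c g w)"

definition orthproj :: "nat \<Rightarrow> (complex vec \<Rightarrow> complex vec) \<Rightarrow> bool" where
  "orthproj n P \<longleftrightarrow> linop n P \<and> (\<forall>v\<in>carrier_vec n. P (P v) = P v) \<and>
     (\<forall>v\<in>carrier_vec n. \<forall>w\<in>carrier_vec n. P v \<bullet>c w = v \<bullet>c P w)"

text \<open>For a projector P this is exp (i phi P): factor \<open>cis \<phi>\<close> on the range
  of P, identity on its kernel. At phi = pi it is the reflection 1 - 2 P.\<close>

definition phase :: "(complex vec \<Rightarrow> complex vec) \<Rightarrow> real \<Rightarrow> complex vec \<Rightarrow> complex vec" where
  "phase P \<phi> v = v - (1 - cis \<phi>) \<cdot>\<^sub>v P v"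

lemma linop_carrier: "linop n f \<Longrightarrow> v \<in> carrier_vec n \<Longrightarrow> f v \<in> carrier_vec n"
  and linop_add: "linop n f \<Longrightarrow> v \<in> carrier_vec n \<Longrightarrow> w \<in> carrier_vec n \<Longrightarrow> f (v + w) = f v + f w"
  and linop_smult: "linop n f \<Longrightarrow> v \<in> carrier_vec n \<Longrightarrow> f (c \<cdot>\<^sub>v v) = c \<cdot>\<^sub>v f v"
  by (auto simp: linop_def)

lemma linop_diff:
  assumes "linop n f" "v \<in> carrier_vec n" "w \<in> carrier_vec n"
  shows "f (v - w) = f v - f w"
proof -
  have "v - w = v + (-1) \<cdot>\<^sub>v w" using assms by (intro eq_vecI) auto
  then have "f (v - w) = f v + (-1) \<cdot>\<^sub>v f w" using assms by (simp add: linop_add linop_smult)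
  also have "\<dots> = f v - f w" using assms linop_carrier[OF assms(1)] by (intro eq_vecI) auto
  finally show ?thesis .
qed

lemma linop_compose: "linop n f \<Longrightarrow> linop n g \<Longrightarrow> linop n (\<lambda>v. f (g v))"
  by (simp add: linop_def)

lemma linop_mat: "A \<in> carrier_mat n n \<Longrightarrow> linop n (\<lambda>v. A *\<^sub>v v)"
  unfolding linop_def by (auto simp: mult_add_distrib_mat_vec mult_mat_vec)

lemma unipairD:
  assumes "unipair n f g"
  shows "linop n f" "linop n g" "v \<in> carrier_vec n \<Longrightarrow> g (f v) = v"
    "v \<in> carrier_vec n \<Longrightarrow> f (g v) = v"
    "v \<in> carrier_vec n \<Longrightarrow> w \<in> carrier_vec n \<Longrightarrow> f v \<bullet>c w = v \<bullet>c g w"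
  using assms by (auto simp: unipair_def)

lemma unipair_id: "unipair n (\<lambda>v. v) (\<lambda>v. v)"
  by (auto simp: unipair_def linop_def)

lemma unipair_sym: 
  assumes "unipair n f g"
  shows "unipair n g f"
proof -
  have "g v \<bullet>c w = v \<bullet>c f w" if "v \<in> carrier_vec n" "w \<in> carrier_vec n" for v w
    using unipairD(5)[OF assms that(2,1)] cinner_commute[OF that(2) linop_carrier[OF unipairD(2)[OF assms] that(1)]]
      cinner_commute[OF linop_carrier[OF unipairD(1)[OF assms] that(2)] that(1)] by simp
  then show ?thesis using assms by (auto simp: unipair_def)
qed

lemma unipair_compose:
  assumes "unipair n f f'" "unipair n g g'"
  shows "unipair n (\<lambda>v. g (f v)) (\<lambda>v. f' (g' v))"
  using assms unfolding unipair_def by (auto simp: linop_compose linop_carrier)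

lemma unipair_cinner:
  assumes "unipair n f g" "v \<in> carrier_vec n" "w \<in> carrier_vec n"
  shows "f v \<bullet>c f w = v \<bullet>c w"
  using assms by (metis linop_carrier unipairD(1,3,5))

lemma unipair_vnorm: "unipair n f g \<Longrightarrow> v \<in> carrier_vec n \<Longrightarrow> vnorm (f v) = vnorm v"
  by (intro vnorm_eqI unipair_cinner)

lemma orthprojD:
  assumes "orthproj n P"
  shows "linop n P" "v \<in> carrier_vec n \<Longrightarrow> P (P v) = P v"
    "v \<in> carrier_vec n \<Longrightarrow> w \<in> carrier_vec n \<Longrightarrow> P v \<bullet>c w = v \<bullet>c P w"
  using assms by (auto simp: orthproj_def)

lemma linop_phase:
  assumes "linop n P" shows "linop n (phase P \<phi>)"
  unfolding linop_def
proof (intro conjI ballI allI)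
  fix v w :: "complex vec" and c assume v: "v \<in> carrier_vec n" and w: "w \<in> carrier_vec n"
  note P = v w linop_carrier[OF assms v] linop_carrier[OF assms w]
  show "phase P \<phi> v \<in> carrier_vec n" using P by (simp add: phase_def)
  show "phase P \<phi> (v + w) = phase P \<phi> v + phase P \<phi> w"
    using P unfolding phase_def linop_add[OF assms v w] by (intro eq_vecI) (auto simp: algebra_simps)
  show "phase P \<phi> (c \<cdot>\<^sub>v v) = c \<cdot>\<^sub>v phase P \<phi> v"
    using P unfolding phase_def linop_smult[OF assms v] by (intro eq_vecI) (auto simp: algebra_simps)
qed

lemma phase_phase:
  assumes P: "orthproj n P" and v: "v \<in> carrier_vec n"
  shows "phase P \<phi> (phase P (- \<phi>) v) = v"
proof -
  have Pv: "P v \<in> carrier_vec n" using linop_carrier[OF orthprojD(1)[OF P] v] .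
  have "P (phase P (- \<phi>) v) = P v - (1 - cis (- \<phi>)) \<cdot>\<^sub>v P v"
    using orthprojD[OF P] v Pv unfolding phase_def
    by (simp add: linop_diff[of n] linop_smult[of n])
  moreover have "cis \<phi> * cis (- \<phi>) = 1" by (simp add: cis_mult)
  ultimately show ?thesis unfolding phase_def using v Pv
    by (intro eq_vecI) (auto simp: algebra_simps)
qed

lemma unipair_phase:
  assumes P: "orthproj n P"
  shows "unipair n (phase P \<phi>) (phase P (- \<phi>))"
  unfolding unipair_def
proof (intro conjI ballI)
  show "linop n (phase P \<phi>)" "linop n (phase P (- \<phi>))"
    using P by (auto intro: linop_phase orthprojD)
  fix v :: "complex vec" assume v: "v \<in> carrier_vec n"
  show "phase P (- \<phi>) (phase P \<phi> v) = v" "phase P \<phi> (phase P (- \<phi>) v) = v"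
    using phase_phase[OF P v, of "- \<phi>"] phase_phase[OF P v] by auto
  fix w :: "complex vec" assume w: "w \<in> carrier_vec n"
  have "P v \<in> carrier_vec n" "P w \<in> carrier_vec n"
    using orthprojD(1)[OF P] v w by (auto simp: linop_carrier)
  then show "phase P \<phi> v \<bullet>c w = v \<bullet>c phase P (- \<phi>) w"
    unfolding phase_def using v w orthprojD(3)[OF P v w] by (simp add: cis_cnj)
qed

lemma orthproj_conjugate:
  assumes P: "orthproj n P" and U: "unipair n f g"
  shows "orthproj n (\<lambda>v. g (P (f v)))"
proof -
  have L: "linop n P" "linop n f" "linop n g" using orthprojD(1)[OF P] unipairD(1,2)[OF U] by auto
  note c = linop_carrier[OF L(1)] linop_carrier[OF L(2)] linop_carrier[OF L(3)]
  show ?thesis unfolding orthproj_def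
  proof (intro conjI ballI)
    show "linop n (\<lambda>v. g (P (f v)))" by (rule linop_compose[OF L(3) linop_compose[OF L(1,2)]])
    fix v w :: "complex vec" assume v: "v \<in> carrier_vec n" and w: "w \<in> carrier_vec n"
    show "g (P (f (g (P (f v))))) = g (P (f v))"
      using unipairD(4)[OF U c(1)[OF c(2)[OF v]]] orthprojD(2)[OF P c(2)[OF v]] by simp
    show "g (P (f v)) \<bullet>c w = v \<bullet>c g (P (f w))"
    proof -
      have "g (P (f v)) \<bullet>c w = P (f v) \<bullet>c f w"
        using v w by (intro unipairD(5)[OF unipair_sym[OF U]] c)
      also have "\<dots> = f v \<bullet>c P (f w)" using v w by (intro orthprojD(3)[OF P] c)
      also have "\<dots> = v \<bullet>c g (P (f w))" using v w by (intro unipairD(5)[OF U] c)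
      finally show ?thesis .
    qed
  qed
qed

text \<open>With an oracle for f, a phase about the conjugated projector costs one query and one
  adjoint query.\<close>

lemma phase_conjugate:
  assumes P: "linop n P" and U: "unipair n f g" and v: "v \<in> carrier_vec n"
  shows "g (phase P \<phi> (f v)) = phase (\<lambda>v. g (P (f v))) \<phi> v"
  using assms unfolding phase_def
  by (simp add: linop_diff[of n] linop_smult[of n] unipairD linop_carrier)

lemma orthproj_compl:
  assumes P: "orthproj n P"
  shows "orthproj n (\<lambda>v. v - P v)"
proof -
  have L: "linop n P" using P by (rule orthprojD)
  show ?thesis unfolding orthproj_def linop_def
  proof (intro conjI ballI allI)
    fix v w :: "complex vec" and c assume v: "v \<in> carrier_vec n" and w: "w \<in> carrier_vec n"
    note P' = v w linop_carrier[OF L v] linop_carrier[OF L w]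
    show "v - P v \<in> carrier_vec n" using P' by simp
    show "v + w - P (v + w) = v - P v + (w - P w)"
      using P' unfolding linop_add[OF L v w] by (intro eq_vecI) auto
    show "c \<cdot>\<^sub>v v - P (c \<cdot>\<^sub>v v) = c \<cdot>\<^sub>v (v - P v)"
      using P' unfolding linop_smult[OF L v] by (intro eq_vecI) (auto simp: algebra_simps)
    show "v - P v - P (v - P v) = v - P v"
      using P' by (simp add: linop_diff[OF L] orthprojD[OF P])
    show "(v - P v) \<bullet>c w = v \<bullet>c (w - P w)"
      using P' by (simp add: orthprojD[OF P])
  qed
qed

lemma orthproj_pythagoras:
  assumes P: "orthproj n P" and v: "v \<in> carrier_vec n"
  shows "(vnorm v)\<^sup>2 = (vnorm (P v))\<^sup>2 + (vnorm (v - P v))\<^sup>2"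
proof -
  have Pv: "P v \<in> carrier_vec n" using linop_carrier[OF orthprojD(1)[OF P] v] .
  have *: "P v \<bullet>c P v = v \<bullet>c P v" "P v \<bullet>c v = v \<bullet>c P v"
    using orthprojD(3)[OF P Pv v] orthprojD(3)[OF P v Pv] orthprojD(3)[OF P v v]
      orthprojD(2)[OF P v] by simp_all
  have "v \<bullet>c v = P v \<bullet>c P v + (v - P v) \<bullet>c (v - P v)" using v Pv by (simp add: *)
  then show ?thesis by (simp only: cinner_self of_real_add[symmetric] of_real_eq_iff)
qed

lemma vnorm_orthproj_le:
  assumes "orthproj n P" "v \<in> carrier_vec n"
  shows "vnorm (P v) \<le> vnorm v"
  using orthproj_pythagoras[OF assms] by (metis le_add_same_cancel1 power2_le_imp_le vnorm_nonneg zero_le_power2)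

lemma orthproj_rank_one:
  assumes t: "t \<in> carrier_vec n" "vnorm t = 1"
  shows "orthproj n (\<lambda>v. (v \<bullet>c t) \<cdot>\<^sub>v t)"
proof -
  have "t \<bullet>c t = 1" using t by (simp add: cinner_self)
  then show ?thesis unfolding orthproj_def linop_def
  proof (intro conjI ballI allI)
    fix v w :: "complex vec" and c assume v: "v \<in> carrier_vec n" and w: "w \<in> carrier_vec n"
    show "((v \<bullet>c t) \<cdot>\<^sub>v t) \<bullet>c w = v \<bullet>c ((w \<bullet>c t) \<cdot>\<^sub>v t)"
      using t v w cinner_commute[OF t(1) w] by simp
  qed (use t in \<open>auto simp: add_smult_distrib_vec smult_smult_assoc\<close>)
qed

subsection \<open>Matrices of operators\<close>

lemma mat_adjoint_carrier: "A \<in> carrier_mat m n \<Longrightarrow> mat_adjoint A \<in> carrier_mat n m"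
  by (auto simp: mat_adjoint_def mat_of_rows_def)

lemma mat_adjoint_index:
  "A \<in> carrier_mat m n \<Longrightarrow> i < n \<Longrightarrow> j < m \<Longrightarrow> mat_adjoint A $$ (i, j) = cnj (A $$ (j, i))"
  by (auto simp: mat_adjoint_def mat_of_rows_def)

lemma mat_vec_index:
  assumes "A \<in> carrier_mat m n" "v \<in> carrier_vec n" "i < m"
  shows "(A *\<^sub>v v) $ i = (\<Sum>j<n. A $$ (i, j) * v $ j)"
  using assms by (auto simp: scalar_prod_def atLeast0LessThan intro!: sum.cong)

lemma mat_adjoint_cinner:
  assumes A: "A \<in> carrier_mat m n" and v: "v \<in> carrier_vec n" and w: "w \<in> carrier_vec m"
  shows "(A *\<^sub>v v) \<bullet>c w = (v :: complex vec) \<bullet>c (mat_adjoint A *\<^sub>v w)"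
proof -
  have "(A *\<^sub>v v) \<bullet>c w = (\<Sum>i<m. \<Sum>j<n. A $$ (i, j) * v $ j * cnj (w $ i))"
    using assms by (simp add: cinner_carrier[of _ m] mat_vec_index[OF A] sum_distrib_right
        mult_mat_vec_carrier del: index_mult_mat_vec)
  also have "\<dots> = (\<Sum>j<n. \<Sum>i<m. A $$ (i, j) * v $ j * cnj (w $ i))" by (rule sum.swap)
  also have "\<dots> = (\<Sum>j<n. v $ j * cnj ((mat_adjoint A *\<^sub>v w) $ j))"
  proof (rule sum.cong[OF refl])
    fix j assume "j \<in> {..<n}"
    then have "(mat_adjoint A *\<^sub>v w) $ j = (\<Sum>i<m. cnj (A $$ (i, j)) * w $ i)"
      using mat_vec_index[OF mat_adjoint_carrier[OF A] w, of j] by (simp add: mat_adjoint_index[OF A])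
    then show "(\<Sum>i<m. A $$ (i, j) * v $ j * cnj (w $ i)) = v $ j * cnj ((mat_adjoint A *\<^sub>v w) $ j)"
      by (simp add: sum_distrib_left mult_ac)
  qed
  also have "\<dots> = v \<bullet>c (mat_adjoint A *\<^sub>v w)"
    using v mult_mat_vec_carrier[OF mat_adjoint_carrier[OF A] w] by (simp add: cinner_carrier[of _ n])
  finally show ?thesis .
qed

lemma unipair_unitary_mat:
  assumes "unitary_mat n U"
  shows "unipair n (\<lambda>v. U *\<^sub>v v) (\<lambda>v. mat_adjoint U *\<^sub>v v)"
proof -
  have U: "U \<in> carrier_mat n n" "mat_adjoint U * U = 1\<^sub>m n" "U * mat_adjoint U = 1\<^sub>m n"
    using assms by (auto simp: unitary_mat_def)
  note U' = mat_adjoint_carrier[OF U(1)]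
  show ?thesis unfolding unipair_def
    using U U' assoc_mult_mat_vec[OF U' U(1)] assoc_mult_mat_vec[OF U(1) U'] mat_adjoint_cinner[OF U(1)]
    by (auto simp: linop_mat simp flip: assoc_mult_mat_vec)
qed

definition opmat :: "nat \<Rightarrow> (complex vec \<Rightarrow> complex vec) \<Rightarrow> complex mat" where
  "opmat n f = mat n n (\<lambda>(i, j). f (unit_vec n j) $ i)"

lemma opmat_carrier: "opmat n f \<in> carrier_mat n n"
  by (simp add: opmat_def)

lemma mat_eqI_unit:
  assumes "A \<in> carrier_mat m n" "B \<in> carrier_mat m n"
    "\<And>j. j < n \<Longrightarrow> A *\<^sub>v unit_vec n j = B *\<^sub>v unit_vec n j"
  shows "A = (B :: complex mat)"
proof (rule eq_matI)
  fix i j assume "i < dim_row B" "j < dim_col B"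
  moreover from this have "(A *\<^sub>v unit_vec n j) $ i = (B *\<^sub>v unit_vec n j) $ i"
    using assms by auto
  ultimately show "A $$ (i, j) = B $$ (i, j)" using assms(1,2) by auto
qed (use assms in auto)

lemma opmat_unit: "linop n f \<Longrightarrow> j < n \<Longrightarrow> opmat n f *\<^sub>v unit_vec n j = f (unit_vec n j)"
  using linop_carrier[of n f "unit_vec n j"] by (intro eq_vecI) (auto simp: opmat_def)

lemma opmat_vec:
  assumes f: "linop n f" and v: "v \<in> carrier_vec n"
  shows "opmat n f *\<^sub>v v = f v"
proof -
  \<comment> \<open>Truncations of v: passing from m to Suc m adds one multiple of a unit vector,
    and \<open>w n\<close> is v.\<close>
  define w where "w m = vec n (\<lambda>i. if i < m then v $ i else 0)" for m
  have w: "w m \<in> carrier_vec n" for m by (simp add: w_def)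
  note M = linop_mat[OF opmat_carrier[of n f]]
  have "m \<le> n \<Longrightarrow> opmat n f *\<^sub>v w m = f (w m)" for m
  proof (induction m)
    case 0
    \<comment> \<open>\<open>linop\<close> has no clause for the zero vector; writing it as 0 times
      itself reduces the case to homogeneity.\<close>
    have "w 0 = 0 \<cdot>\<^sub>v w 0" by (auto simp: w_def)
    then have "opmat n f *\<^sub>v w 0 = 0 \<cdot>\<^sub>v (opmat n f *\<^sub>v w 0)" "f (w 0) = 0 \<cdot>\<^sub>v f (w 0)"
      using linop_smult[OF M w] linop_smult[OF f w] by metis+
    moreover have "0 \<cdot>\<^sub>v u = 0 \<cdot>\<^sub>v v" if "u \<in> carrier_vec n" "v \<in> carrier_vec n" for u v :: "complex vec"
      using that by (intro eq_vecI) auto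
    note this[OF linop_carrier[OF M w[of 0]] linop_carrier[OF f w[of 0]]]
    ultimately show ?case by simp
  next
    case (Suc m)
    have eq: "w (Suc m) = w m + v $ m \<cdot>\<^sub>v unit_vec n m"
      using Suc.prems by (intro eq_vecI) (auto simp: w_def less_Suc_eq)
    have u: "(unit_vec n m :: complex vec) \<in> carrier_vec n" by simp
    have lin: "g (w m + v $ m \<cdot>\<^sub>v unit_vec n m) = g (w m) + v $ m \<cdot>\<^sub>v g (unit_vec n m)"
      if "linop n g" for g
      using linop_add[OF that w, of "v $ m \<cdot>\<^sub>v unit_vec n m"] linop_smult[OF that u] u by simp
    show ?case unfolding eq lin[OF M] lin[OF f] using Suc opmat_unit[OF f, of m] by simp
  qed
  moreover have "w n = v" using v by (intro eq_vecI) (auto simp: w_def)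
  ultimately show ?thesis using order_refl by metis
qed

lemma unitary_opmat:
  assumes U: "unipair n f g"
  shows "unitary_mat n (opmat n f)"
proof -
  note L = unipairD(1,2)[OF U]
  have adj: "mat_adjoint (opmat n f) = opmat n g"
  proof (rule eq_matI)
    fix i j assume "i < dim_row (opmat n g)" "j < dim_col (opmat n g)"
    then have ij: "i < n" "j < n" by (auto simp: opmat_def)
    have "f (unit_vec n i) \<bullet>c unit_vec n j = unit_vec n i \<bullet>c g (unit_vec n j)"
      using ij by (intro unipairD(5)[OF U]) auto
    moreover have "f (unit_vec n i) \<bullet>c unit_vec n j = f (unit_vec n i) $ j"
      using ij linop_carrier[OF L(1), of "unit_vec n i"]
      by (simp add: cinner_carrier[of _ n] if_distrib unit_vec_def cong: if_cong)
    moreover have "unit_vec n i \<bullet>c g (unit_vec n j) = cnj (g (unit_vec n j) $ i)"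
      using ij linop_carrier[OF L(2), of "unit_vec n j"]
      by (simp add: cinner_carrier[of _ n] if_distrib[of "\<lambda>x. x * _"] unit_vec_def cong: if_cong)
    ultimately show "mat_adjoint (opmat n f) $$ (i, j) = opmat n g $$ (i, j)"
      using ij by (simp add: mat_adjoint_index[OF opmat_carrier]) (simp add: opmat_def)
  qed (use mat_adjoint_carrier[OF opmat_carrier[of n f]] in \<open>auto simp: opmat_def\<close>)
  have "opmat n f * opmat n g = 1\<^sub>m n" "opmat n g * opmat n f = 1\<^sub>m n"
    using opmat_carrier[of n f] opmat_carrier[of n g] linop_carrier[OF L(1)] linop_carrier[OF L(2)]
    by (auto intro!: mat_eqI_unit[of _ n n] mult_carrier_mat
        simp: assoc_mult_mat_vec[of _ n n _ n] opmat_vec[OF L(1)] opmat_vec[OF L(2)] unipairD[OF U])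
  then show ?thesis unfolding unitary_mat_def adj using opmat_carrier by auto
qed

section \<open>Orthonormal families and the spectral theorem\<close>

definition lincomb :: "nat \<Rightarrow> nat \<Rightarrow> (nat \<Rightarrow> complex) \<Rightarrow> (nat \<Rightarrow> complex vec) \<Rightarrow> complex vec" where
  "lincomb n k c t = vec n (\<lambda>i. \<Sum>j<k. c j * t j $ i)"

definition orthonormal :: "nat \<Rightarrow> nat \<Rightarrow> (nat \<Rightarrow> complex vec) \<Rightarrow> bool" where
  "orthonormal n k t \<longleftrightarrow> (\<forall>j<k. t j \<in> carrier_vec n) \<and>
     (\<forall>i<k. \<forall>j<k. t i \<bullet>c t j = (if i = j then 1 else 0))"

lemma lincomb_carrier [simp]: "lincomb n k c t \<in> carrier_vec n"
  by (simp add: lincomb_def)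

lemma lincomb_Suc: "t k \<in> carrier_vec n \<Longrightarrow> lincomb n (Suc k) c t = lincomb n k c t + c k \<cdot>\<^sub>v t k"
  by (intro eq_vecI) (auto simp: lincomb_def)

lemma lincomb_cong:
  "(\<And>j. j < k \<Longrightarrow> c j = c' j) \<Longrightarrow> (\<And>j. j < k \<Longrightarrow> t j = t' j) \<Longrightarrow> lincomb n k c t = lincomb n k c' t'"
  unfolding lincomb_def by (intro arg_cong[where f = "vec n"] ext sum.cong) auto

lemma cinner_lincomb_left:
  assumes "\<And>j. j < k \<Longrightarrow> t j \<in> carrier_vec n" "w \<in> carrier_vec n"
  shows "lincomb n k c t \<bullet>c w = (\<Sum>j<k. c j * (t j \<bullet>c w))"
  using assms
proof (induction k)
  case 0
  then show ?case by (simp add: cinner_carrier[of _ n]) (simp add: lincomb_def)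
next
  case (Suc k)
  then have tk: "t k \<in> carrier_vec n" by simp
  have "(lincomb n k c t + c k \<cdot>\<^sub>v t k) \<bullet>c w = lincomb n k c t \<bullet>c w + c k * (t k \<bullet>c w)"
    using tk Suc.prems(2) by (subst cinner_add_left[OF lincomb_carrier]) auto
  then show ?case using Suc tk by (simp add: lincomb_Suc)
qed

lemma linop_lincomb:
  assumes f: "linop n f" and t: "\<And>j. j < k \<Longrightarrow> t j \<in> carrier_vec n"
  shows "f (lincomb n k c t) = lincomb n k c (\<lambda>j. f (t j))"
  using t
proof (induction k)
  case 0
  have "f (lincomb n 0 c t) = f (0 \<cdot>\<^sub>v lincomb n 0 c t)"
    by (rule arg_cong[where f = f]) (auto simp: lincomb_def)
  also have "\<dots> = 0 \<cdot>\<^sub>v f (lincomb n 0 c t)" using linop_smult[OF f lincomb_carrier] .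
  also have "\<dots> = lincomb n 0 c (\<lambda>j. f (t j))"
    using linop_carrier[OF f lincomb_carrier[of n 0 c t]] by (intro eq_vecI) (auto simp: lincomb_def)
  finally show ?case .
next
  case (Suc k)
  then have tk: "t k \<in> carrier_vec n" by simp
  have "f (lincomb n (Suc k) c t) = f (lincomb n k c t) + c k \<cdot>\<^sub>v f (t k)"
    unfolding lincomb_Suc[where t = t, OF tk] using tk linop_add[OF f] linop_smult[OF f tk] by simp
  also have "\<dots> = lincomb n (Suc k) c (\<lambda>j. f (t j))"
    using Suc linop_carrier[OF f tk] by (simp add: lincomb_Suc[of "\<lambda>j. f (t j)"])
  finally show ?case .
qed

text \<open>Pythagoras with squared lengths a j that may be 0: it is applied to residual vectors,
  some of which can vanish.\<close>

lemma vnorm_lincomb_orthogonal: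
  assumes t: "\<And>j. j < k \<Longrightarrow> t j \<in> carrier_vec n"
    and orth: "\<And>i j. i < k \<Longrightarrow> j < k \<Longrightarrow> t i \<bullet>c t j = (if i = j then complex_of_real (a j) else 0)"
  shows "(vnorm (lincomb n k c t))\<^sup>2 = (\<Sum>j<k. (cmod (c j))\<^sup>2 * a j)"
proof -
  let ?s = "lincomb n k c t"
  have inner: "t j \<bullet>c ?s = cnj (c j) * a j" if j: "j < k" for j
  proof -
    have "?s \<bullet>c t j = (\<Sum>i<k. c i * (if i = j then complex_of_real (a j) else 0))"
      using j orth by (subst cinner_lincomb_left[of k t n]) (auto simp: t intro!: sum.cong)
    also have "\<dots> = c j * a j" using j by (simp add: if_distrib cong: if_cong)
    finally show ?thesis using cinner_commute[OF lincomb_carrier t[OF j], of k c t] by simp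
  qed
  have "?s \<bullet>c ?s = (\<Sum>j<k. c j * (cnj (c j) * a j))"
    using cinner_lincomb_left[where t = t, OF t lincomb_carrier] inner by simp
  also have "\<dots> = complex_of_real (\<Sum>j<k. (cmod (c j))\<^sup>2 * a j)"
    unfolding of_real_sum of_real_mult complex_norm_square by (simp add: mult.assoc)
  finally show ?thesis unfolding cinner_self of_real_eq_iff .
qed

lemma orthonormalD:
  assumes "orthonormal n k t"
  shows "j < k \<Longrightarrow> t j \<in> carrier_vec n"
    "i < k \<Longrightarrow> j < k \<Longrightarrow> t i \<bullet>c t j = (if i = j then 1 else 0)"
    "j < k \<Longrightarrow> vnorm (t j) = 1"
proof -
  show "j < k \<Longrightarrow> t j \<in> carrier_vec n"
    "i < k \<Longrightarrow> j < k \<Longrightarrow> t i \<bullet>c t j = (if i = j then 1 else 0)"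
    using assms by (auto simp: orthonormal_def)
  assume "j < k"
  then have "complex_of_real ((vnorm (t j))\<^sup>2) = complex_of_real 1"
    using assms unfolding cinner_self[symmetric] by (auto simp: orthonormal_def)
  then have "(vnorm (t j))\<^sup>2 = 1" unfolding of_real_eq_iff .
  then show "vnorm (t j) = 1" using vnorm_nonneg[of "t j"] by (simp add: power2_eq_1_iff)
qed

lemma exists_orthogonal_vec:
  fixes t :: "nat \<Rightarrow> complex vec"
  assumes k: "k < n" and t: "\<And>j. j < k \<Longrightarrow> t j \<in> carrier_vec n"
  shows "\<exists>v\<in>carrier_vec n. v \<noteq> 0\<^sub>v n \<and> (\<forall>j<k. v \<bullet>c t j = 0)"
proof -
  \<comment> \<open>The k conjugated vectors are padded with zero rows to a square matrix. Its
    transpose kills unit vector k, so it is singular and has a kernel vector.\<close>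
  define A where "A = mat n n (\<lambda>(i, j). if i < k then cnj (t i $ j) else 0)"
  have A: "A \<in> carrier_mat n n" by (simp add: A_def)
  have "transpose_mat A *\<^sub>v unit_vec n k = 0\<^sub>v n"
    using k by (intro eq_vecI) (auto simp: A_def)
  moreover have "unit_vec n k \<noteq> (0\<^sub>v n :: complex vec)"
    using k by (metis index_unit_vec(1) index_zero_vec(1) zero_neq_one)
  ultimately have "det (transpose_mat A) = 0"
    using A by (subst det_0_iff_vec_prod_zero_field[of _ n]) (auto intro!: exI[of _ "unit_vec n k"])
  then have "det A = 0" using det_transpose[OF A] by simp
  then obtain v where v: "v \<in> carrier_vec n" "v \<noteq> 0\<^sub>v n" "A *\<^sub>v v = 0\<^sub>v n"
    using det_0_iff_vec_prod_zero_field[OF A] by auto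
  have "v \<bullet>c t j = 0" if "j < k" for j
  proof -
    have "v \<bullet>c t j = (A *\<^sub>v v) $ j"
      using that k v t mat_vec_index[OF A v(1), of j] by (simp add: cinner_carrier[of _ n] A_def mult.commute)
    then show ?thesis using v(3) that k by simp
  qed
  then show ?thesis using v by blast
qed

lemma orthonormal_complete:
  assumes t: "orthonormal n n t" and v: "v \<in> carrier_vec n" and orth: "\<And>j. j < n \<Longrightarrow> v \<bullet>c t j = 0"
  shows "v = 0\<^sub>v n"
proof (rule ccontr)
  assume nz: "v \<noteq> 0\<^sub>v n"
  define A where "A = mat n n (\<lambda>(i, j). cnj (t i $ j))"
  define B where "B = mat n n (\<lambda>(i, j). t j $ i)"
  have A: "A \<in> carrier_mat n n" and B: "B \<in> carrier_mat n n" by (simp_all add: A_def B_def)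
  have "A *\<^sub>v v = 0\<^sub>v n"
  proof (rule eq_vecI)
    fix j assume "j < dim_vec (0\<^sub>v n :: complex vec)"
    then have j: "j < n" by simp
    have "(A *\<^sub>v v) $ j = v \<bullet>c t j"
      using j v orthonormalD(1)[OF t j] mat_vec_index[OF A v j]
      by (simp add: cinner_carrier[of _ n] A_def mult.commute)
    then show "(A *\<^sub>v v) $ j = 0\<^sub>v n $ j" using orth j by simp
  qed (use A in auto)
  then have "det A = 0" using det_0_iff_vec_prod_zero_field[OF A] v nz by auto
  \<comment> \<open>This product is the Gram matrix of the family, so A is invertible and cannot
    kill v.\<close>
  moreover have "A * B = 1\<^sub>m n"
  proof (rule eq_matI)
    fix i j assume "i < dim_row (1\<^sub>m n :: complex mat)" "j < dim_col (1\<^sub>m n :: complex mat)"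
    then have ij: "i < n" "j < n" by auto
    have "(A * B) $$ (i, j) = (\<Sum>k<n. cnj (t i $ k) * t j $ k)"
      using ij by (auto simp: A_def B_def scalar_prod_def atLeast0LessThan intro!: sum.cong)
    also have "\<dots> = t j \<bullet>c t i"
      using orthonormalD(1)[OF t] ij by (simp add: cinner_carrier[of _ n] mult.commute)
    finally show "(A * B) $$ (i, j) = 1\<^sub>m n $$ (i, j)" using orthonormalD(2)[OF t] ij by simp
  qed (auto simp: A_def B_def)
  ultimately show False using det_mult[OF A B] by simp
qed

lemma orthonormal_append:
  assumes t: "orthonormal n k t" and v: "v \<in> carrier_vec n" "v \<noteq> 0\<^sub>v n" "\<And>j. j < k \<Longrightarrow> v \<bullet>c t j = 0"
  shows "orthonormal n (Suc k) (t(k := (1 / vnorm v) \<cdot>\<^sub>v v))"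
proof -
  have nz: "vnorm v \<noteq> 0" using v vnorm_eq_0 by blast
  have o: "t j \<bullet>c v = 0" if "j < k" for j
    using cinner_commute[OF v(1) orthonormalD(1)[OF t that]] v(3)[OF that] by simp
  have "v \<bullet>c v = (vnorm v)\<^sup>2" by (rule cinner_self)
  then show ?thesis using t v nz o
    by (auto simp: orthonormal_def less_Suc_eq power2_eq_square)
qed

lemma orthonormal_extend:
  assumes "orthonormal n k t" "k \<le> n"
  shows "\<exists>t'. orthonormal n n t' \<and> (\<forall>j<k. t' j = t j)"
  using assms
proof (induction "n - k" arbitrary: k t)
  case 0
  then show ?case by auto
next
  case (Suc m)
  then have k: "k < n" by simp
  obtain v where v: "v \<in> carrier_vec n" "v \<noteq> 0\<^sub>v n" "\<forall>j<k. v \<bullet>c t j = 0"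
    using exists_orthogonal_vec[OF k, of t] orthonormalD(1)[OF Suc.prems(1)] by blast
  have "m = n - Suc k" "Suc k \<le> n" using Suc by auto
  from Suc.hyps(1)[OF this(1) orthonormal_append[OF Suc.prems(1) v(1,2)] this(2)] v(3)
  obtain t' where "orthonormal n n t'" "\<forall>j<Suc k. t' j = (t(k := (1 / vnorm v) \<cdot>\<^sub>v v)) j" by blast
  then show ?case by (intro exI[of _ t']) auto
qed

text \<open>Induction step of the spectral theorem. A hermitian operator maps the orthogonal
  complement of known eigenvectors into itself, so an eigenvector of its compression B to that
  complement is an eigenvector of the operator; hermiticity makes the eigenvalue real.\<close>

lemma exists_eigenvector_orthogonal:
  assumes A: "linop n A" and herm: "\<And>v w. v \<in> carrier_vec n \<Longrightarrow> w \<in> carrier_vec n \<Longrightarrow> A v \<bullet>c w = v \<bullet>c A w"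
    and t: "orthonormal n k t" and k: "k < n"
    and eig: "\<And>j. j < k \<Longrightarrow> A (t j) = complex_of_real (l j) \<cdot>\<^sub>v t j"
  shows "\<exists>s\<in>carrier_vec n. \<exists>e. s \<noteq> 0\<^sub>v n \<and> (\<forall>j<k. s \<bullet>c t j = 0) \<and> A s = complex_of_real e \<cdot>\<^sub>v s"
proof -
  obtain u where u: "orthonormal n n u" "\<forall>j<k. u j = t j"
    using orthonormal_extend[OF t] k by auto
  define m where "m = n - k"
  define B where "B = mat m m (\<lambda>(i, j). A (u (k + j)) \<bullet>c u (k + i))"
  have B: "B \<in> carrier_mat m m" by (simp add: B_def)
  obtain e where "eigenvalue B e"
    using spectrum_non_empty[OF B] k by (auto simp: m_def spectrum_def)
  then obtain c where c: "c \<in> carrier_vec m" "c \<noteq> 0\<^sub>v m" "B *\<^sub>v c = e \<cdot>\<^sub>v c"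
    using B by (auto simp: eigenvalue_def eigenvector_def)
  define s where "s = lincomb n m (($) c) (\<lambda>j. u (k + j))"
  have uc: "u (k + j) \<in> carrier_vec n" if "j < m" for j
    using that orthonormalD(1)[OF u(1)] by (simp add: m_def)
  have Auc: "A (u (k + j)) \<in> carrier_vec n" if "j < m" for j
    using linop_carrier[OF A uc[OF that]] .
  have s: "s \<in> carrier_vec n" by (simp add: s_def)
  note As = linop_carrier[OF A s]
  have su: "s \<bullet>c u (k + i) = c $ i" if i: "i < m" for i
  proof -
    have "s \<bullet>c u (k + i) = (\<Sum>j<m. c $ j * (u (k + j) \<bullet>c u (k + i)))"
      unfolding s_def by (rule cinner_lincomb_left[where t = "\<lambda>j. u (k + j)", OF uc uc[OF i]])
    also have "\<dots> = (\<Sum>j<m. c $ j * (if j = i then 1 else 0))"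
      using i orthonormalD(2)[OF u(1)] by (intro sum.cong) (auto simp: m_def)
    also have "\<dots> = c $ i" using i by (simp add: if_distrib cong: if_cong)
    finally show ?thesis .
  qed
  have Asu: "A s \<bullet>c u (k + i) = e * c $ i" if i: "i < m" for i
  proof -
    have "A s \<bullet>c u (k + i) = (\<Sum>j<m. c $ j * (A (u (k + j)) \<bullet>c u (k + i)))"
      unfolding s_def using i Auc uc
      by (subst linop_lincomb[OF A], simp, subst cinner_lincomb_left[of m _ n]) auto
    also have "\<dots> = (B *\<^sub>v c) $ i"
      using mat_vec_index[OF B c(1) i] i by (simp add: B_def mult.commute)
    finally show ?thesis using c i by simp
  qed
  have st: "s \<bullet>c t i = 0" if i: "i < k" for i
  proof -
    have "s \<bullet>c t i = (\<Sum>j<m. c $ j * (u (k + j) \<bullet>c t i))"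
      unfolding s_def using orthonormalD(1)[OF t i]
      by (intro cinner_lincomb_left[where t = "\<lambda>j. u (k + j)"] uc)
    also have "\<dots> = (\<Sum>j<m. 0)"
      using i u(2) orthonormalD(2)[OF u(1), of _ i] k by (intro sum.cong) (auto simp: m_def)
    finally show ?thesis by simp
  qed
  have Ast: "A s \<bullet>c t i = 0" if i: "i < k" for i
    using herm[OF s orthonormalD(1)[OF t i]] st[OF i] eig[OF i] s orthonormalD(1)[OF t i] by simp
  \<comment> \<open>Both vectors have the same coefficients in the basis u: zero below k by
    hermiticity, equal from k on by the choice of c.\<close>
  have "A s - e \<cdot>\<^sub>v s = 0\<^sub>v n"
  proof (rule orthonormal_complete[OF u(1)])
    fix j assume j: "j < n"
    have uj: "u j \<in> carrier_vec n" using orthonormalD(1)[OF u(1) j] .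
    show "(A s - e \<cdot>\<^sub>v s) \<bullet>c u j = 0"
    proof (cases "j < k")
      case True
      then show ?thesis using st Ast s As uj u(2) by simp
    next
      case False
      then have "k + (j - k) = j" "j - k < m" using j by (auto simp: m_def)
      then show ?thesis using su[of "j - k"] Asu[of "j - k"] s As uj by simp
    qed
  qed (use s As in auto)
  then have eq: "A s = e \<cdot>\<^sub>v s" using s As
    by (intro eq_vecI) (auto simp: vec_eq_iff)
  have nz: "s \<noteq> 0\<^sub>v n"
  proof
    assume "s = 0\<^sub>v n"
    then have "c $ i = 0" if "i < m" for i
      using su[OF that] uc[OF that] by simp
    then show False using c(1,2) by (auto simp: vec_eq_iff)
  qed
  have "e * (s \<bullet>c s) = cnj e * (s \<bullet>c s)"
    using herm[OF s s] s unfolding eq by simp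
  moreover have "s \<bullet>c s \<noteq> 0" using nz s by simp
  ultimately have "e = cnj e" by simp
  then have "e = complex_of_real (Re e)" by (simp add: complex_eq_iff)
  then show ?thesis using s nz st eq by metis
qed

text \<open>The induction starts from given eigenvectors so that the Gibbs state can be kept as the
  first basis vector.\<close>

lemma orthonormal_eigenbasis:
  assumes A: "linop n A" and herm: "\<And>v w. v \<in> carrier_vec n \<Longrightarrow> w \<in> carrier_vec n \<Longrightarrow> A v \<bullet>c w = v \<bullet>c A w"
    and "orthonormal n k t" "k \<le> n" "\<And>j. j < k \<Longrightarrow> A (t j) = complex_of_real (l j) \<cdot>\<^sub>v t j"
  shows "\<exists>t' l'. orthonormal n n t' \<and> (\<forall>j<n. A (t' j) = complex_of_real (l' j) \<cdot>\<^sub>v t' j) \<and> (\<forall>j<k. t' j = t j)"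
  using assms(3-5)
proof (induction "n - k" arbitrary: k t l)
  case 0
  then show ?case by auto
next
  case (Suc m)
  then have k: "k < n" by simp
  obtain s e where s: "s \<in> carrier_vec n" "s \<noteq> 0\<^sub>v n" "\<forall>j<k. s \<bullet>c t j = 0"
      "A s = complex_of_real e \<cdot>\<^sub>v s"
    using exists_eigenvector_orthogonal[OF A herm Suc.prems(1) k Suc.prems(3)] by blast
  let ?t = "t(k := (1 / vnorm s) \<cdot>\<^sub>v s)" and ?l = "l(k := e)"
  have "A (?t j) = complex_of_real (?l j) \<cdot>\<^sub>v ?t j" if "j < Suc k" for j
    using that Suc.prems(3)[of j] s linop_smult[OF A s(1)]
    by (auto simp: less_Suc_eq smult_smult_assoc mult.commute)
  moreover have "m = n - Suc k" "Suc k \<le> n" using Suc by auto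
  ultimately obtain t' l' where "orthonormal n n t'" "\<forall>j<n. A (t' j) = complex_of_real (l' j) \<cdot>\<^sub>v t' j"
      "\<forall>j<Suc k. t' j = ?t j"
    using Suc.hyps(1)[of "Suc k" ?t ?l] orthonormal_append[OF Suc.prems(1) s(1,2)] s(3) by blast
  then show ?case by (intro exI[of _ t'] exI[of _ l']) auto
qed

lemma orthonormal_single: "u \<in> carrier_vec n \<Longrightarrow> vnorm u = 1 \<Longrightarrow> orthonormal n 1 (\<lambda>_. u)"
  by (simp add: orthonormal_def cinner_self)

text \<open>Supplies the gate that prepares the initial state from the all-zeros basis
  state.\<close>

lemma exists_unitary_first_column:
  assumes u: "u \<in> carrier_vec n" "vnorm u = 1" and n: "0 < n"
  shows "\<exists>U. unitary_mat n U \<and> U *\<^sub>v unit_vec n 0 = u"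
proof -
  obtain t where t: "orthonormal n n t" "t 0 = u"
    using orthonormal_extend[OF orthonormal_single[OF u]] n by auto
  define U where "U = mat n n (\<lambda>(i, j). t j $ i)"
  have U: "U \<in> carrier_mat n n" by (simp add: U_def)
  have "mat_adjoint U * U = 1\<^sub>m n"
  proof (rule eq_matI)
    fix i j assume "i < dim_row (1\<^sub>m n :: complex mat)" "j < dim_col (1\<^sub>m n :: complex mat)"
    then have ij: "i < n" "j < n" by auto
    have "(mat_adjoint U * U) $$ (i, j) = (\<Sum>k<n. mat_adjoint U $$ (i, k) * U $$ (k, j))"
      using ij mat_adjoint_carrier[OF U] U
      by (auto simp: scalar_prod_def atLeast0LessThan intro!: sum.cong)
    also have "\<dots> = (\<Sum>k<n. cnj (t i $ k) * t j $ k)"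
      using ij mat_adjoint_index[OF U] by (intro sum.cong) (auto simp: U_def)
    also have "\<dots> = t j \<bullet>c t i"
      using orthonormalD(1)[OF t(1)] ij by (simp add: cinner_carrier[of _ n] mult.commute)
    finally show "(mat_adjoint U * U) $$ (i, j) = 1\<^sub>m n $$ (i, j)"
      using orthonormalD(2)[OF t(1)] ij by simp
  qed (use U mat_adjoint_carrier[OF U] in auto)
  then have "unitary_mat n U"
    using mat_mult_left_right_inverse[OF mat_adjoint_carrier[OF U] U] U by (simp add: unitary_mat_def)
  moreover have "U *\<^sub>v unit_vec n 0 = u"
    using n t(2) u by (intro eq_vecI) (auto simp: U_def)
  ultimately show ?thesis by blast
qed

section \<open>Nested amplitude amplification\<close>

text \<open>A word lists phases in the order of application. The letter \<open>(b, \<phi>)\<close> stands for the phase \<open>\<phi>\<close> about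
  the projector \<open>P b\<close>: \<open>P False\<close> projects onto the start space, and the component orthogonal to
  \<open>P True\<close> is the one whose amplitude is to shrink.\<close>

definition inv_word :: "(bool \<times> real) list \<Rightarrow> (bool \<times> real) list" where
  "inv_word W = rev (map (\<lambda>(b, \<phi>). (b, - \<phi>)) W)"

primrec ampl_word :: "real list \<Rightarrow> (bool \<times> real) list" where
  "ampl_word [] = []"
| "ampl_word (\<phi> # \<phi>s) =
     ampl_word \<phi>s @ (True, \<phi>) # inv_word (ampl_word \<phi>s) @ (False, \<phi>) # ampl_word \<phi>s"

definition run_word :: "(bool \<Rightarrow> complex vec \<Rightarrow> complex vec) \<Rightarrow> (bool \<times> real) list \<Rightarrow> complex vec \<Rightarrow> complex vec" where
  "run_word P W = fold (\<lambda>s. phase (P (fst s)) (snd s)) W"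

text \<open>If the amplitude to be shrunk is initially x, the word leaves amplitude
  \<open>ampl_factor \<phi>s x * x\<close>, up to the phase \<open>ampl_phase\<close>. Here a = |1 -
  cis phi|^2, and the head of the list is the outermost layer of the nesting.\<close>

primrec ampl_factor :: "real list \<Rightarrow> real \<Rightarrow> real" where
  "ampl_factor [] x = 1"
| "ampl_factor (\<phi> # \<phi>s) x = (let a = 2 - 2 * cos \<phi>; r = ampl_factor \<phi>s x in r * (1 - a + a * (r * x)\<^sup>2))"

primrec ampl_phase :: "real list \<Rightarrow> complex" where
  "ampl_phase [] = 1"
| "ampl_phase (\<phi> # \<phi>s) = cis \<phi> * ampl_phase \<phi>s"

lemma cmod_ampl_phase: "cmod (ampl_phase \<phi>s) = 1"
  by (induction \<phi>s) (auto simp: norm_mult)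

lemma length_inv_word: "length (inv_word W) = length W"
  by (simp add: inv_word_def)

lemma filter_inv_word: "length (filter fst (inv_word W)) = length (filter fst W)"
  by (induction W) (auto simp: inv_word_def)

lemma length_ampl_word: "length (ampl_word \<phi>s) + 1 = 3 ^ length \<phi>s"
  by (induction \<phi>s) (auto simp: length_inv_word)

text \<open>Only letters \<open>True\<close> will cost queries, two each; this is the count behind
  \<open>query_count_reflection\<close>.\<close>

lemma filter_ampl_word: "2 * length (filter fst (ampl_word \<phi>s)) + 1 = 3 ^ length \<phi>s"
  by (induction \<phi>s) (auto simp: filter_inv_word)

lemma run_word_Nil: "run_word P [] v = v"
  and run_word_Cons: "run_word P (s # W) v = run_word P W (phase (P (fst s)) (snd s) v)"
  and run_word_append: "run_word P (W @ W') v = run_word P W' (run_word P W v)"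
  by (simp_all add: run_word_def)

lemma unipair_run_word:
  assumes "\<And>b. orthproj n (P b)"
  shows "unipair n (run_word P W) (run_word P (inv_word W))"
proof (induction W)
  case Nil
  then show ?case using unipair_id by (simp add: inv_word_def run_word_def id_def)
next
  case (Cons s W)
  have eq: "inv_word (s # W) = inv_word W @ [(fst s, - snd s)]"
    by (simp add: inv_word_def case_prod_beta)
  show ?case unfolding run_word_Cons[abs_def] eq run_word_append[abs_def] run_word_Nil[abs_def] fst_conv snd_conv
    by (rule unipair_compose[OF unipair_phase[OF assms] Cons])
qed

lemma vec_diff_eq_0:
  fixes v :: "complex vec"
  assumes "v \<in> carrier_vec n" "w \<in> carrier_vec n" "v - w = 0\<^sub>v n"
  shows "v = w"
  using assms by (auto simp: vec_eq_iff)

text \<open>Here \<open>1 - w + w\<^sup>2 = w * (1 - a)\<close> and \<open>(1 - w)\<^sup>2 = - w * a\<close> for \<open>w = cis \<phi>\<close> and \<open>a = 2 - 2 * cos \<phi>\<close>.\<close>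

lemma ampl_step:
  assumes U: "unipair n U U'" and P: "linop n P" and Q: "orthproj n Q"
    and t: "t \<in> carrier_vec n" "P t = t"
    and f: "f = U t - Q (U t)" and c: "P (U' f) = c \<cdot>\<^sub>v t"
    and z: "z = U (phase P \<phi> (U' (phase Q \<phi> (U t))))"
  shows "z - Q z = (cis \<phi> * (1 - of_real (2 - 2 * cos \<phi>) + of_real (2 - 2 * cos \<phi>) * c)) \<cdot>\<^sub>v f"
proof -
  define w where "w = cis \<phi>"
  note LU = unipairD(1)[OF U] and LU' = unipairD(2)[OF U] and LQ = orthprojD(1)[OF Q]
  define y where "y = U t"
  have y: "y \<in> carrier_vec n" unfolding y_def by (rule linop_carrier[OF LU t(1)])
  note Qy = linop_carrier[OF LQ y]
  have fc: "f \<in> carrier_vec n" using y Qy by (simp add: f y_def)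
  have Qf: "Q f = 0\<^sub>v n" unfolding f y_def[symmetric]
    using linop_diff[OF LQ y Qy] orthprojD(2)[OF Q y] Qy by simp
  define g where "g = U' f"
  have gc: "g \<in> carrier_vec n" unfolding g_def by (rule linop_carrier[OF LU' fc])
  have Pg: "P g = c \<cdot>\<^sub>v t" using c by (simp add: g_def)
  have lin: "L (\<alpha> \<cdot>\<^sub>v u + \<beta> \<cdot>\<^sub>v v) = \<alpha> \<cdot>\<^sub>v L u + \<beta> \<cdot>\<^sub>v L v"
    if "linop n L" "u \<in> carrier_vec n" "v \<in> carrier_vec n" for L \<alpha> \<beta> u v
    using linop_add[OF that(1), of "\<alpha> \<cdot>\<^sub>v u" "\<beta> \<cdot>\<^sub>v v"] linop_smult[OF that(1)] that by simp
  \<comment> \<open>Written in y = U t and its residue f alone, because \<open>U'\<close> sends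
    these to t and g, and P is known on both.\<close>
  have "phase Q \<phi> y = w \<cdot>\<^sub>v y + (1 - w) \<cdot>\<^sub>v f"
    unfolding f y_def[symmetric] phase_def w_def using y Qy
    by (intro eq_vecI) (auto simp: algebra_simps)
  then have "U' (phase Q \<phi> y) = w \<cdot>\<^sub>v t + (1 - w) \<cdot>\<^sub>v g"
    using lin[OF LU' y fc, of w "1 - w"] unipairD(3)[OF U t(1)] by (simp add: y_def g_def)
  moreover have "phase P \<phi> (w \<cdot>\<^sub>v t + (1 - w) \<cdot>\<^sub>v g) = (w - (1 - w) * (w + (1 - w) * c)) \<cdot>\<^sub>v t + (1 - w) \<cdot>\<^sub>v g"
    unfolding phase_def lin[OF P t(1) gc] t(2) Pg w_def[symmetric] using t gc
    by (intro eq_vecI) (auto simp: algebra_simps)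
  ultimately have z': "z = (w - (1 - w) * (w + (1 - w) * c)) \<cdot>\<^sub>v y + (1 - w) \<cdot>\<^sub>v f"
    unfolding z y_def[symmetric] using lin[OF LU t(1) gc] unipairD(4)[OF U fc] by (simp add: y_def g_def)
  have "Q z = (w - (1 - w) * (w + (1 - w) * c)) \<cdot>\<^sub>v (y - f)"
  proof -
    have "y - f = Q y" unfolding f y_def[symmetric] using y Qy by (intro eq_vecI) auto
    then show ?thesis unfolding z' lin[OF LQ y fc] Qf using Qy by (intro eq_vecI) auto
  qed
  then have "z - Q z = (1 - (1 - w) * (w + (1 - w) * c)) \<cdot>\<^sub>v f"
    unfolding z' using y fc by (intro eq_vecI) (auto simp: algebra_simps)
  moreover have "1 - (1 - w) * (w + (1 - w) * c) = w * (1 - of_real (2 - 2 * cos \<phi>) + of_real (2 - 2 * cos \<phi>) * c)"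
  proof -
    have w: "w * cnj w = 1" by (simp add: w_def cis_cnj cis_mult)
    have a: "complex_of_real (2 - 2 * cos \<phi>) = 2 - (w + cnj w)"
      by (simp add: w_def complex_eq_iff)
    have "w * (1 - (2 - (w + cnj w)) + (2 - (w + cnj w)) * c)
        = w * w - w + w * cnj w + (2 * w - w * w - w * cnj w) * c"
      by (simp add: algebra_simps)
    then show ?thesis unfolding a by (simp add: w algebra_simps)
  qed
  ultimately show ?thesis by (simp add: w_def)
qed

text \<open>The t j are an orthonormal basis of the range of \<open>P False\<close> that
  diagonalises the compression of 1 - \<open>P True\<close> to it. So they are singular vectors of 1
  - \<open>P True\<close> restricted to the start space, with singular values |x j|.\<close>

locale nested_amplification =
  fixes n k :: nat and P :: "bool \<Rightarrow> complex vec \<Rightarrow> complex vec" and t :: "nat \<Rightarrow> complex vec"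
    and x :: "nat \<Rightarrow> real"
  assumes proj: "orthproj n (P b)"
    and orthonormal: "orthonormal n k t"
    and fixed: "\<And>j. j < k \<Longrightarrow> P False (t j) = t j"
    and kernel: "\<And>v. v \<in> carrier_vec n \<Longrightarrow> (\<And>j. j < k \<Longrightarrow> v \<bullet>c t j = 0) \<Longrightarrow> P False v = 0\<^sub>v n"
    and gram: "\<And>i j. i < k \<Longrightarrow> j < k \<Longrightarrow>
      (t i - P True (t i)) \<bullet>c t j = (if i = j then complex_of_real ((x i)\<^sup>2) else 0)"
begin

abbreviation F :: "complex vec \<Rightarrow> complex vec" where
  "F v \<equiv> v - P True v"

lemma t_carrier: "j < k \<Longrightarrow> t j \<in> carrier_vec n"
  using orthonormalD(1)[OF orthonormal] .

lemma F_proj: "orthproj n F"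
  by (rule orthproj_compl[OF proj])

lemma F_carrier: "v \<in> carrier_vec n \<Longrightarrow> F v \<in> carrier_vec n"
  by (rule linop_carrier[OF orthprojD(1)[OF F_proj]])

lemma gram_F:
  assumes "i < k" "j < k"
  shows "F (t i) \<bullet>c F (t j) = (if i = j then complex_of_real ((x i)\<^sup>2) else 0)"
proof -
  have "F (t i) \<bullet>c F (t j) = F (F (t i)) \<bullet>c t j"
    using orthprojD(3)[OF F_proj F_carrier[OF t_carrier] t_carrier] assms by simp
  also have "F (F (t i)) = F (t i)" using orthprojD(2)[OF F_proj t_carrier[OF assms(1)]] .
  finally show ?thesis using gram[OF assms] by simp
qed

text \<open>The difference of v and its expansion is orthogonal to every t j, hence killed by
  \<open>P False\<close>, but it is also fixed by \<open>P False\<close>.\<close>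

lemma fixed_expand:
  assumes v: "v \<in> carrier_vec n" "P False v = v"
  shows "v = lincomb n k (\<lambda>j. v \<bullet>c t j) t"
proof -
  let ?l = "lincomb n k (\<lambda>j. v \<bullet>c t j) t"
  have "?l \<bullet>c t i = v \<bullet>c t i" if i: "i < k" for i
  proof -
    have "?l \<bullet>c t i = (\<Sum>j<k. (v \<bullet>c t j) * (t j \<bullet>c t i))"
      by (intro cinner_lincomb_left t_carrier i)
    also have "\<dots> = (\<Sum>j<k. (v \<bullet>c t j) * (if j = i then 1 else 0))"
      using i orthonormalD(2)[OF orthonormal] by (intro sum.cong) auto
    also have "\<dots> = v \<bullet>c t i" using i by (simp add: if_distrib cong: if_cong)
    finally show ?thesis .
  qed
  then have "P False (v - ?l) = 0\<^sub>v n"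
    using v t_carrier by (intro kernel) auto
  moreover have "P False ?l = lincomb n k (\<lambda>j. v \<bullet>c t j) (\<lambda>j. P False (t j))"
    by (rule linop_lincomb[OF orthprojD(1)[OF proj] t_carrier])
  then have "P False ?l = ?l" by (simp add: fixed cong: lincomb_cong)
  ultimately have "v - ?l = 0\<^sub>v n"
    using linop_diff[OF orthprojD(1)[OF proj] v(1) lincomb_carrier] v(2) by metis
  then show ?thesis by (rule vec_diff_eq_0[OF v(1) lincomb_carrier])
qed

text \<open>The residues of different t j stay orthogonal through every layer, so
  \<open>P False\<close> maps the pulled-back residue of t j to a multiple of t j. Each t j
  therefore evolves on its own and the layer reduces to \<open>ampl_step\<close>.\<close>

lemma ampl_word_eigen:
  "j < k \<Longrightarrow> F (run_word P (ampl_word \<phi>s) (t j)) =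
     (ampl_phase \<phi>s * of_real (ampl_factor \<phi>s (x j))) \<cdot>\<^sub>v F (t j)"
proof (induction \<phi>s arbitrary: j)
  case Nil
  then show ?case by (simp add: run_word_Nil)
next
  case (Cons \<phi> \<phi>s)
  let ?U = "run_word P (ampl_word \<phi>s)" and ?U' = "run_word P (inv_word (ampl_word \<phi>s))"
  let ?r = "\<lambda>j. ampl_factor \<phi>s (x j)" and ?\<omega> = "ampl_phase \<phi>s"
  have U: "unipair n ?U ?U'" using proj by (rule unipair_run_word)
  note Uc = linop_carrier[OF unipairD(1)[OF U]] and Uc' = linop_carrier[OF unipairD(2)[OF U]]
  note j = Cons.prems
  define f where "f = F (?U (t j))"
  have fc: "f \<in> carrier_vec n" unfolding f_def by (intro F_carrier Uc t_carrier j)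
  define c where "c = complex_of_real ((?r j * x j)\<^sup>2)"
  \<comment> \<open>Moving U and F across the inner product reduces everything to
    \<open>gram_F\<close>; the phase cancels against its conjugate.\<close>
  have orth: "(?U' f - c \<cdot>\<^sub>v t j) \<bullet>c t i = 0" if i: "i < k" for i
  proof -
    have "?U' f \<bullet>c t i = f \<bullet>c ?U (t i)"
      by (rule unipairD(5)[OF unipair_sym[OF U] fc t_carrier[OF i]])
    also have "\<dots> = F f \<bullet>c ?U (t i)"
      unfolding f_def using orthprojD(2)[OF F_proj Uc[OF t_carrier[OF j]]] by simp
    also have "\<dots> = f \<bullet>c F (?U (t i))"
      by (rule orthprojD(3)[OF F_proj fc Uc[OF t_carrier[OF i]]])
    also have "\<dots> = (?\<omega> * of_real (?r j)) * (cnj (?\<omega> * of_real (?r i)) * (F (t j) \<bullet>c F (t i)))"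
      unfolding f_def Cons.IH[OF j] Cons.IH[OF i]
      by (subst cinner_smult_left[of _ n], (auto simp: F_carrier t_carrier i j)[2],
          subst cinner_smult_right[of _ n]) (auto simp: F_carrier t_carrier i j)
    also have "\<dots> = (if i = j then c else 0)"
    proof -
      have "?\<omega> * cnj ?\<omega> = 1" using cmod_ampl_phase[of \<phi>s] complex_norm_square[of ?\<omega>] by simp
      then show ?thesis unfolding gram_F[OF j i] c_def by (auto simp: power2_eq_square algebra_simps)
    qed
    finally show ?thesis
      using orthonormalD(2)[OF orthonormal j i] t_carrier[OF i] t_carrier[OF j] Uc'[OF fc] by auto
  qed
  have "P False (?U' f - c \<cdot>\<^sub>v t j) = 0\<^sub>v n"
    using t_carrier[OF j] Uc'[OF fc] by (intro kernel orth) auto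
  then have "P False (?U' f) - c \<cdot>\<^sub>v t j = 0\<^sub>v n"
    using linop_diff[OF orthprojD(1)[OF proj[of False]] Uc'[OF fc], of "c \<cdot>\<^sub>v t j"]
      linop_smult[OF orthprojD(1)[OF proj[of False]] t_carrier[OF j]] t_carrier[OF j] fixed[OF j] by simp
  then have Pf: "P False (?U' f) = c \<cdot>\<^sub>v t j"
    using t_carrier[OF j] linop_carrier[OF orthprojD(1)[OF proj] Uc'[OF fc], of False]
    by (intro eq_vecI) (auto simp: vec_eq_iff)
  have "F (run_word P (ampl_word (\<phi> # \<phi>s)) (t j))
      = (cis \<phi> * (1 - of_real (2 - 2 * cos \<phi>) + of_real (2 - 2 * cos \<phi>) * c)) \<cdot>\<^sub>v f"
    by (rule ampl_step[OF U orthprojD(1)[OF proj] proj t_carrier[OF j] fixed[OF j] _ Pf])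
      (simp_all add: f_def run_word_append run_word_Cons)
  also have "\<dots> = (ampl_phase (\<phi> # \<phi>s) * of_real (ampl_factor (\<phi> # \<phi>s) (x j))) \<cdot>\<^sub>v F (t j)"
    unfolding f_def Cons.IH[OF j] smult_smult_assoc c_def by (simp add: Let_def algebra_simps)
  finally show ?case .
qed

lemma vnorm_ampl_word:
  assumes v: "v \<in> carrier_vec n" "P False v = v"
  shows "(vnorm (F (run_word P (ampl_word \<phi>s) v)))\<^sup>2
       = (\<Sum>j<k. (cmod (v \<bullet>c t j))\<^sup>2 * (ampl_factor \<phi>s (x j) * x j)\<^sup>2)"
proof -
  let ?U = "run_word P (ampl_word \<phi>s)"
  let ?A = "\<lambda>v. F (?U v)"
  have U: "unipair n ?U (run_word P (inv_word (ampl_word \<phi>s)))" using proj by (rule unipair_run_word)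
  have A: "linop n ?A" by (rule linop_compose[OF orthprojD(1)[OF F_proj] unipairD(1)[OF U]])
  have "?A v = ?A (lincomb n k (\<lambda>j. v \<bullet>c t j) t)" using fixed_expand[OF v] by simp
  also have "\<dots> = lincomb n k (\<lambda>j. v \<bullet>c t j) (\<lambda>j. ?A (t j))"
    by (rule linop_lincomb[OF A t_carrier])
  finally have eq: "?A v = lincomb n k (\<lambda>j. v \<bullet>c t j) (\<lambda>j. ?A (t j))" .
  show ?thesis unfolding eq
  proof (rule vnorm_lincomb_orthogonal)
    fix i j assume ij: "i < k" "j < k"
    let ?c = "\<lambda>j. ampl_phase \<phi>s * complex_of_real (ampl_factor \<phi>s (x j))"
    have "?A (t i) \<bullet>c ?A (t j) = ?c i * (cnj (?c j) * (F (t i) \<bullet>c F (t j)))"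
      unfolding ampl_word_eigen[OF ij(1)] ampl_word_eigen[OF ij(2)]
      by (subst cinner_smult_left[of _ n], (auto simp: F_carrier t_carrier ij)[2],
          subst cinner_smult_right[of _ n]) (auto simp: F_carrier t_carrier ij)
    also have "\<dots> = (if i = j then complex_of_real ((ampl_factor \<phi>s (x j) * x j)\<^sup>2) else 0)"
    proof -
      have "ampl_phase \<phi>s * cnj (ampl_phase \<phi>s) = 1"
        using cmod_ampl_phase[of \<phi>s] complex_norm_square[of "ampl_phase \<phi>s"] by simp
      then show ?thesis unfolding gram_F[OF ij] by (auto simp: power2_eq_square algebra_simps)
    qed
    finally show "?A (t i) \<bullet>c ?A (t j) = (if i = j then complex_of_real ((ampl_factor \<phi>s (x j) * x j)\<^sup>2) else 0)" .
  qed (rule linop_carrier[OF A t_carrier])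
qed

text \<open>Conjugating F by the word gives a projector A that fixes t j0 exactly and shrinks
  everything else in the start space by \<delta>. Phases about A and about t j0 then differ by |1 -
  cis phi| \<le> 2 times \<delta>.\<close>

lemma approximate_reflection:
  fixes \<phi>s :: "real list"
  assumes j0: "j0 < k" "x j0 = 1" "ampl_factor \<phi>s 1 = 1"
    and \<delta>: "0 \<le> \<delta>" "\<And>j. j < k \<Longrightarrow> j \<noteq> j0 \<Longrightarrow> \<bar>ampl_factor \<phi>s (x j) * x j\<bar> \<le> \<delta>"
    and v: "v \<in> carrier_vec n" "P False v = v"
  defines "W \<equiv> ampl_word \<phi>s"
  shows "vnorm (run_word P (inv_word W) (phase F \<phi> (run_word P W v))
      - phase (\<lambda>v. (v \<bullet>c t j0) \<cdot>\<^sub>v t j0) \<phi> v) \<le> 2 * \<delta> * vnorm v"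
proof -
  let ?U = "run_word P W" and ?U' = "run_word P (inv_word W)" and ?\<tau> = "t j0"
  let ?R = "\<lambda>v. (v \<bullet>c t j0) \<cdot>\<^sub>v t j0"
  have U: "unipair n ?U ?U'" using proj by (rule unipair_run_word)
  define A where "A v = ?U' (F (?U v))" for v
  have A: "orthproj n A" unfolding A_def by (rule orthproj_conjugate[OF F_proj U])
  note LA = orthprojD(1)[OF A]
  have \<tau>: "?\<tau> \<in> carrier_vec n" "vnorm ?\<tau> = 1"
    using orthonormalD[OF orthonormal] j0 by auto
  have R: "orthproj n ?R" by (rule orthproj_rank_one[OF \<tau>])
  note Uc = linop_carrier[OF unipairD(1)[OF U]]
  have A_eq: "vnorm (A u) = vnorm (F (?U u))" if "u \<in> carrier_vec n" for u
    unfolding A_def by (rule unipair_vnorm[OF unipair_sym[OF U] F_carrier[OF Uc[OF that]]])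
  have "(vnorm (A ?\<tau>))\<^sup>2 = (\<Sum>j<k. if j = j0 then 1 else 0)"
    unfolding A_eq[OF \<tau>(1)] W_def vnorm_ampl_word[OF \<tau>(1) fixed[OF j0(1)]]
    using orthonormalD(2)[OF orthonormal j0(1)] j0 by (intro sum.cong) auto
  then have "(vnorm (A ?\<tau>))\<^sup>2 = 1" using j0 by simp
  \<comment> \<open>A projector that preserves the norm of a vector fixes it.\<close>
  then have "vnorm (?\<tau> - A ?\<tau>) = 0" using orthproj_pythagoras[OF A \<tau>(1)] \<tau>(2) by simp
  then have "?\<tau> - A ?\<tau> = 0\<^sub>v n"
    using vnorm_eq_0[of "?\<tau> - A ?\<tau>" n] \<tau> linop_carrier[OF LA \<tau>(1)] by simp
  then have A\<tau>: "A ?\<tau> = ?\<tau>"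
    using \<tau> linop_carrier[OF LA \<tau>(1)] by (intro eq_vecI) (auto simp: vec_eq_iff)
  define v' where "v' = v - ?R v"
  have v': "v' \<in> carrier_vec n" using v \<tau> by (simp add: v'_def)
  have Pv': "P False v' = v'" unfolding v'_def
    using linop_diff[OF orthprojD(1)[OF proj[of False]] v(1), of "?R v"] v(2) \<tau>(1) fixed[OF j0(1)]
      linop_smult[OF orthprojD(1)[OF proj[of False]] \<tau>(1)] by simp
  have "?\<tau> \<bullet>c ?\<tau> = 1" using orthonormalD(2)[OF orthonormal j0(1) j0(1)] by simp
  then have v'0: "v' \<bullet>c ?\<tau> = 0" using v \<tau> by (simp add: v'_def)
  have Av': "A v' = A v - ?R v" unfolding v'_def
    using linop_diff[OF LA v(1), of "?R v"] linop_smult[OF LA \<tau>(1)] A\<tau> \<tau>(1) by simp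
  have n1: "(vnorm v')\<^sup>2 = (\<Sum>j<k. (cmod (v' \<bullet>c t j))\<^sup>2)"
  proof -
    have "(vnorm v')\<^sup>2 = (vnorm (lincomb n k (\<lambda>j. v' \<bullet>c t j) t))\<^sup>2" using fixed_expand[OF v' Pv'] by simp
    also have "\<dots> = (\<Sum>j<k. (cmod (v' \<bullet>c t j))\<^sup>2 * 1)"
      by (rule vnorm_lincomb_orthogonal) (auto simp: t_carrier orthonormalD(2)[OF orthonormal])
    finally show ?thesis by simp
  qed
  have "(vnorm (A v'))\<^sup>2 = (\<Sum>j<k. (cmod (v' \<bullet>c t j))\<^sup>2 * (ampl_factor \<phi>s (x j) * x j)\<^sup>2)"
    unfolding A_eq[OF v'] W_def by (rule vnorm_ampl_word[OF v' Pv'])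
  also have "\<dots> \<le> (\<Sum>j<k. (cmod (v' \<bullet>c t j))\<^sup>2 * \<delta>\<^sup>2)"
  proof (rule sum_mono)
    fix j assume "j \<in> {..<k}"
    then have "(ampl_factor \<phi>s (x j) * x j)\<^sup>2 \<le> \<delta>\<^sup>2" if "j \<noteq> j0"
      using \<delta>(2)[of j] that by (simp add: abs_le_square_iff[symmetric] \<delta>(1))
    then show "(cmod (v' \<bullet>c t j))\<^sup>2 * (ampl_factor \<phi>s (x j) * x j)\<^sup>2 \<le> (cmod (v' \<bullet>c t j))\<^sup>2 * \<delta>\<^sup>2"
      using v'0 by (cases "j = j0") (auto intro: mult_left_mono)
  qed
  also have "\<dots> = (\<delta> * vnorm v')\<^sup>2" by (simp add: n1 power_mult_distrib sum_distrib_left mult.commute)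
  finally have "vnorm (A v') \<le> \<delta> * vnorm v'"
    by (rule power2_le_imp_le) (simp add: \<delta>(1))
  also have "\<dots> \<le> \<delta> * vnorm v"
    using vnorm_orthproj_le[OF orthproj_compl[OF R] v(1)] \<delta>(1) by (simp add: v'_def mult_left_mono)
  finally have Av'_le: "vnorm (A v') \<le> \<delta> * vnorm v" .
  have "?U' (phase F \<phi> (?U v)) = phase A \<phi> v"
    unfolding A_def by (rule phase_conjugate[OF orthprojD(1)[OF F_proj] U v(1)])
  then have "?U' (phase F \<phi> (?U v)) - phase ?R \<phi> v = (- (1 - cis \<phi>)) \<cdot>\<^sub>v A v'"
    unfolding phase_def Av' using v \<tau> linop_carrier[OF LA v(1)]
    by (intro eq_vecI) (auto simp: algebra_simps)
  then have "vnorm (?U' (phase F \<phi> (?U v)) - phase ?R \<phi> v) = cmod (1 - cis \<phi>) * vnorm (A v')"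
    by (simp add: vnorm_smult norm_minus_commute)
  also have "\<dots> \<le> 2 * (\<delta> * vnorm v)"
    using Av'_le norm_triangle_ineq4[of 1 "cis \<phi>"] by (intro mult_mono) auto
  finally show ?thesis by (simp add: mult.assoc)
qed

end

text \<open>The case of a single singular value: both projectors have rank one, about the start s
  and the target t. The left side is the distance of the output from the line through t.\<close>

lemma fixed_point_amplification:
  fixes \<phi>s :: "real list"
  assumes s: "s \<in> carrier_vec n" "vnorm s = 1" and t: "t \<in> carrier_vec n" "vnorm t = 1"
    and P: "P = (\<lambda>b v. if b then (v \<bullet>c t) \<cdot>\<^sub>v t else (v \<bullet>c s) \<cdot>\<^sub>v s)"
    and x: "0 \<le> x" "1 - (cmod (s \<bullet>c t))\<^sup>2 = x\<^sup>2"
  defines "u \<equiv> run_word P (ampl_word \<phi>s) s"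
  shows "vnorm (u - (u \<bullet>c t) \<cdot>\<^sub>v t) = \<bar>ampl_factor \<phi>s x * x\<bar>"
proof -
  have st: "s \<bullet>c s = 1" "t \<bullet>c s = cnj (s \<bullet>c t)"
    using s t cinner_commute[of s n t] by (simp_all add: cinner_self)
  have x2: "complex_of_real (x\<^sup>2) = 1 - (s \<bullet>c t) * cnj (s \<bullet>c t)"
    unfolding x(2)[symmetric] of_real_diff complex_norm_square by simp
  interpret nested_amplification n 1 P "\<lambda>_. s" "\<lambda>_. x"
  proof
    show "orthproj n (P b)" for b
      unfolding P using orthproj_rank_one[OF s] orthproj_rank_one[OF t] by (cases b) simp_all
    show "(s - P True s) \<bullet>c s = (if i = j then complex_of_real (x\<^sup>2) else 0)" if "i < 1" "j < 1" for i j :: nat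
      using that s t st unfolding x2 by (simp add: P)
  qed (use s st in \<open>auto simp: P orthonormal_single[simplified]\<close>)
  have "F u = (ampl_phase \<phi>s * of_real (ampl_factor \<phi>s x)) \<cdot>\<^sub>v F s"
    unfolding u_def using ampl_word_eigen[of 0] by simp
  then have "vnorm (F u) = \<bar>ampl_factor \<phi>s x\<bar> * vnorm (F s)"
    by (simp add: vnorm_smult norm_mult cmod_ampl_phase)
  moreover have "vnorm (F s) = x"
  proof -
    have "complex_of_real ((vnorm (F s))\<^sup>2) = complex_of_real (x\<^sup>2)"
      unfolding cinner_self[symmetric] using gram_F[of 0 0] by simp
    then have "(vnorm (F s))\<^sup>2 = x\<^sup>2" unfolding of_real_eq_iff .
    then show ?thesis using x(1) by (simp add: power2_eq_iff_nonneg)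
  qed
  ultimately show ?thesis using x(1) by (simp add: P abs_mult)
qed

subsection \<open>Angles\<close>

text \<open>The Chebyshev polynomial of degree \<open>3 ^ m\<close>, by composing T_3 (y) = 4 y^3 -
  3 y with itself.\<close>

primrec chebyshev3 :: "nat \<Rightarrow> real \<Rightarrow> real" where
  "chebyshev3 0 y = y"
| "chebyshev3 (Suc m) y = 4 * chebyshev3 m y ^ 3 - 3 * chebyshev3 m y"

text \<open>The angle is the solution of \<open>2 - 2 * cos \<phi> = 4 * g\<^sup>2 / (4 * g\<^sup>2 - 3)\<close>, which turns the amplitude
  recursion into the tripling recursion of Chebyshev polynomials.\<close>

primrec chebyshev_angles :: "real \<Rightarrow> nat \<Rightarrow> real list" where
  "chebyshev_angles g 0 = []"
| "chebyshev_angles g (Suc m) =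
     (let h = chebyshev3 m g in arccos (1 - 2 * h\<^sup>2 / (4 * h\<^sup>2 - 3)) # chebyshev_angles g m)"

lemma length_chebyshev_angles: "length (chebyshev_angles g m) = m"
  by (induction m) (auto simp: Let_def)

lemma chebyshev3_ge_1: "1 \<le> g \<Longrightarrow> 1 \<le> chebyshev3 m g"
proof (induction m)
  case (Suc m)
  define h where "h = chebyshev3 m g"
  have h: "1 \<le> h" using Suc by (simp add: h_def)
  \<comment> \<open>T_3 - 1 has a simple root at 1 and a double root at -1/2.\<close>
  have "4 * h ^ 3 - 3 * h - 1 = (h - 1) * (2 * h + 1)\<^sup>2" by (simp add: power2_eq_square power3_eq_cube algebra_simps)
  moreover have "0 \<le> (h - 1) * (2 * h + 1)\<^sup>2" using h by simp
  ultimately show ?case by (simp add: h_def)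
qed simp

lemma chebyshev3_le_1: "\<bar>y\<bar> \<le> 1 \<Longrightarrow> \<bar>chebyshev3 m y\<bar> \<le> 1"
proof (induction m)
  case (Suc m)
  define h where "h = chebyshev3 m y"
  have h: "\<bar>h\<bar> \<le> 1" using Suc by (simp add: h_def)
  \<comment> \<open>By oddness, T_3 + 1 has its simple root at -1 and its double root at
    1/2.\<close>
  have "1 - (4 * h ^ 3 - 3 * h) = (1 - h) * (2 * h + 1)\<^sup>2" "1 + (4 * h ^ 3 - 3 * h) = (1 + h) * (2 * h - 1)\<^sup>2"
    by (simp_all add: power2_eq_square power3_eq_cube algebra_simps)
  moreover have "0 \<le> (1 - h) * (2 * h + 1)\<^sup>2" "0 \<le> (1 + h) * (2 * h - 1)\<^sup>2" using h by auto
  ultimately show ?case unfolding chebyshev3.simps h_def[symmetric] by linarith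
qed simp

text \<open>Exponential growth outside [-1, 1]: with u of order Delta, \<open>3 ^ m\<close> of order
  1 / Delta times a logarithm makes the error 1 / T (cosh u) small.\<close>

lemma chebyshev3_cosh: "chebyshev3 m (cosh u) = cosh (3 ^ m * u)"
proof (induction m)
  case (Suc m)
  have triple: "cosh (3 * z) = 4 * cosh z ^ 3 - 3 * cosh z" for z :: real
  proof -
    have "cosh (3 * z) = cosh (2 * z + z)" by simp
    also have "\<dots> = cosh (2 * z) * cosh z + sinh (2 * z) * sinh z" by (rule cosh_add)
    also have "\<dots> = ((cosh z)\<^sup>2 + (sinh z)\<^sup>2) * cosh z + 2 * (sinh z)\<^sup>2 * cosh z"
      by (simp add: cosh_double sinh_double power2_eq_square)
    also have "(sinh z)\<^sup>2 = (cosh z)\<^sup>2 - 1" by (simp add: cosh_square_eq)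
    finally show ?thesis by (simp add: power2_eq_square power3_eq_cube algebra_simps)
  qed
  show ?case using triple[of "3 ^ m * u"] Suc by (simp add: mult.assoc)
qed simp

text \<open>The remaining amplitude is T (g x) / T (g): equal to 1 at x = 1, and at most 1 / T (g)
  in modulus once |g x| \<le> 1. The angles are chosen so that one layer turns h s into T_3 (h s),
  where h = T (g).\<close>

lemma ampl_factor_chebyshev:
  assumes g: "1 \<le> g"
  shows "chebyshev3 m g * (ampl_factor (chebyshev_angles g m) x * x) = chebyshev3 m (g * x)"
proof (induction m)
  case (Suc m)
  define h where "h = chebyshev3 m g"
  define s where "s = ampl_factor (chebyshev_angles g m) x * x"
  have h: "1 \<le> h" using chebyshev3_ge_1[OF g] by (simp add: h_def)
  then have h2: "1 \<le> h\<^sup>2" by (simp add: one_le_power)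
  define a where "a = 4 * h\<^sup>2 / (4 * h\<^sup>2 - 3)"
  have a: "2 - 2 * cos (arccos (1 - 2 * h\<^sup>2 / (4 * h\<^sup>2 - 3))) = a"
  proof -
    \<comment> \<open>The argument of \<open>arccos\<close> lies in [-1, 1] because h \<ge> 1; the
      upper bound 2 is attained at h = 1.\<close>
    have "2 * h\<^sup>2 / (4 * h\<^sup>2 - 3) \<le> 2" "0 \<le> 2 * h\<^sup>2 / (4 * h\<^sup>2 - 3)" using h2 by (simp_all add: divide_simps)
    then show ?thesis by (subst cos_arccos) (auto simp: a_def)
  qed
  have "ampl_factor (chebyshev_angles g (Suc m)) x * x = s * (1 - a + a * s\<^sup>2)"
    unfolding chebyshev_angles.simps ampl_factor.simps Let_def h_def[symmetric] a by (simp add: s_def)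
  moreover have "chebyshev3 m (g * x) = h * s" using Suc by (simp add: h_def s_def)
  moreover have "(4 * h ^ 3 - 3 * h) * (s * (1 - a + a * s\<^sup>2)) = 4 * (h * s) ^ 3 - 3 * (h * s)"
  proof -
    define q where "q = 4 * h\<^sup>2 - 3"
    have q: "q * a = 4 * h\<^sup>2" using h2 by (simp add: a_def q_def)
    have "(4 * h ^ 3 - 3 * h) * (s * (1 - a + a * s\<^sup>2)) = h * s * (q - q * a + q * a * s\<^sup>2)"
      by (simp add: q_def power2_eq_square power3_eq_cube algebra_simps)
    also have "\<dots> = 4 * (h * s) ^ 3 - 3 * (h * s)"
      unfolding q by (simp add: q_def power2_eq_square power3_eq_cube algebra_simps)
    finally show ?thesis .
  qed
  ultimately show ?case by (simp add: h_def)
qed simp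

lemma ampl_factor_chebyshev_1:
  assumes g: "1 \<le> g" shows "ampl_factor (chebyshev_angles g m) 1 = 1"
  using ampl_factor_chebyshev[OF g, of m 1] chebyshev3_ge_1[OF g, of m] by simp

lemma ampl_factor_chebyshev_le:
  assumes g: "1 \<le> g" and x: "\<bar>g * x\<bar> \<le> 1"
  shows "\<bar>ampl_factor (chebyshev_angles g m) x * x\<bar> \<le> 1 / chebyshev3 m g"
proof -
  have "chebyshev3 m g * \<bar>ampl_factor (chebyshev_angles g m) x * x\<bar> \<le> 1"
    using chebyshev3_le_1[OF x, of m] chebyshev3_ge_1[OF g, of m]
    unfolding ampl_factor_chebyshev[OF g, symmetric] by (simp add: abs_mult)
  then show ?thesis using chebyshev3_ge_1[OF g, of m] by (simp add: field_simps)
qed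

text \<open>At pi / 3 one has a = 1, so the linear term of the recursion disappears and each layer
  cubes the amplitude.\<close>

lemma ampl_factor_third:
  "ampl_factor (replicate m (pi / 3)) x * x = x ^ (3 ^ m)"
proof (induction m)
  case (Suc m)
  define r where "r = ampl_factor (replicate m (pi / 3)) x"
  have "ampl_factor (replicate (Suc m) (pi / 3)) x * x = r * (r * x)\<^sup>2 * x"
    unfolding replicate_Suc ampl_factor.simps Let_def cos_60 r_def[symmetric] by simp
  also have "\<dots> = (r * x) ^ 3" by (simp add: power2_eq_square power3_eq_cube)
  also have "\<dots> = (x ^ (3 ^ m)) ^ 3" using Suc by (simp add: r_def)
  also have "\<dots> = x ^ (3 ^ Suc m)" by (simp only: power_mult[symmetric] power_Suc mult.commute)
  finally show ?case .
qed simp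

section \<open>The discriminant and the Szegedy walk\<close>

lemma sum_mult_split:
  fixes f :: "nat \<Rightarrow> 'a :: comm_monoid_add"
  shows "(\<Sum>r<m * n. f r) = (\<Sum>i<m. \<Sum>j<n. f (i * n + j))"
proof -
  have "(\<Sum>r<m * n. f r) = (\<Sum>i<m. \<Sum>r=i * n..<i * n + n. f r)"
    by (rule sum.nat_group[symmetric])
  also have "\<dots> = (\<Sum>i<m. \<Sum>j<n. f (i * n + j))"
  proof (rule sum.cong[OF refl])
    fix i
    show "(\<Sum>r=i * n..<i * n + n. f r) = (\<Sum>j<n. f (i * n + j))"
      using sum.shift_bounds_nat_ivl[of f 0 "i * n" n] by (simp add: atLeast0LessThan add.commute)
  qed
  finally show ?thesis .
qed

lemma pair_index_less: "i < m \<Longrightarrow> j < n \<Longrightarrow> i * n + j < m * (n :: nat)"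
proof -
  assume "i < m" "j < n"
  then have "i * n + j < Suc i * n" "Suc i * n \<le> m * n" by (simp, intro mult_le_mono1, simp)
  then show ?thesis by linarith
qed

text \<open>The operator T' S T for the step isometry T with adjoint T' and the swap S. By detailed
  balance it is similar to P, through the diagonal matrix of square roots of the stationary
  weights.\<close>

definition discriminant :: "nat \<Rightarrow> real mat \<Rightarrow> complex vec \<Rightarrow> complex vec" where
  "discriminant d P v =
     vec d (\<lambda>x. \<Sum>y<d. complex_of_real (sqrt (P $$ (x, y)) * sqrt (P $$ (y, x))) * v $ y)"

lemma linop_discriminant: "linop d (discriminant d P)"
  unfolding linop_def
proof (intro conjI ballI allI)
  fix v w :: "complex vec" and c :: complex
  assume v: "v \<in> carrier_vec d" "w \<in> carrier_vec d"
  show "discriminant d P v \<in> carrier_vec d" by (simp add: discriminant_def)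
  show "discriminant d P (v + w) = discriminant d P v + discriminant d P w"
    using v by (intro eq_vecI) (auto simp: discriminant_def sum.distrib distrib_left)
  show "discriminant d P (c \<cdot>\<^sub>v v) = c \<cdot>\<^sub>v discriminant d P v"
    using v by (intro eq_vecI) (auto simp: discriminant_def sum_distrib_left intro!: sum.cong)
qed

lemma cinner_discriminant:
  assumes "v \<in> carrier_vec d" "w \<in> carrier_vec d"
  shows "discriminant d P v \<bullet>c w = (\<Sum>x<d. \<Sum>y<d.
    (complex_of_real (sqrt (P $$ (y, x))) * v $ y) * cnj (complex_of_real (sqrt (P $$ (x, y))) * w $ x))"
  using assms linop_carrier[OF linop_discriminant assms(1), of P]
  by (simp add: cinner_carrier[of _ d]) (simp add: discriminant_def sum_distrib_left mult_ac)

lemma discriminant_hermitian: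
  assumes "v \<in> carrier_vec d" "w \<in> carrier_vec d"
  shows "discriminant d P v \<bullet>c w = v \<bullet>c discriminant d P w"
proof -
  have "v \<bullet>c discriminant d P w = cnj (discriminant d P w \<bullet>c v)"
    by (rule cinner_commute[OF linop_carrier[OF linop_discriminant assms(2)] assms(1)])
  also have "\<dots> = (\<Sum>x<d. \<Sum>y<d.
    (complex_of_real (sqrt (P $$ (x, y))) * v $ x) * cnj (complex_of_real (sqrt (P $$ (y, x))) * w $ y))"
    unfolding cinner_discriminant[OF assms(2,1)] by (simp add: mult_ac)
  also have "\<dots> = discriminant d P v \<bullet>c w"
    unfolding cinner_discriminant[OF assms] by (subst sum.swap) (simp add: mult_ac)
  finally show ?thesis by simp
qed

text \<open>Dirichlet form as a sum of squares over edges. The two signs s bound the spectrum from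
  above and below, and equality at eigenvalue 1 forces every square to vanish.\<close>

lemma discriminant_form:
  assumes P: "stochastic d P" and v: "v \<in> carrier_vec d" and s: "s = 1 \<or> s = - 1"
  shows "complex_of_real (\<Sum>x<d. \<Sum>y<d.
      (cmod (sqrt (P $$ (x, y)) * v $ x - of_real s * (sqrt (P $$ (y, x)) * v $ y)))\<^sup>2)
    = 2 * (v \<bullet>c v) - 2 * of_real s * (discriminant d P v \<bullet>c v)"
proof -
  have P0: "0 \<le> P $$ (x, y)" if "x < d" "y < d" for x y using P that by (auto simp: stochastic_def)
  have P1: "(\<Sum>y<d. complex_of_real (P $$ (x, y))) = 1" if "x < d" for x
    using P that unfolding of_real_sum[symmetric] by (auto simp: stochastic_def)
  define q where "q x y = complex_of_real (sqrt (P $$ (x, y))) * v $ x" for x y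
  have qq: "(\<Sum>x<d. \<Sum>y<d. q x y * cnj (q x y)) = v \<bullet>c v"
  proof -
    have "(\<Sum>y<d. q x y * cnj (q x y)) = v $ x * cnj (v $ x)" if x: "x < d" for x
    proof -
      have "(\<Sum>y<d. q x y * cnj (q x y)) = (\<Sum>y<d. complex_of_real (P $$ (x, y)) * (v $ x * cnj (v $ x)))"
      proof (rule sum.cong[OF refl])
        fix y assume "y \<in> {..<d}"
        then have "complex_of_real (sqrt (P $$ (x, y))) * complex_of_real (sqrt (P $$ (x, y))) = complex_of_real (P $$ (x, y))"
          using P0[OF x] unfolding of_real_mult[symmetric] by simp
        then show "q x y * cnj (q x y) = complex_of_real (P $$ (x, y)) * (v $ x * cnj (v $ x))"
          unfolding q_def by (simp add: mult_ac)
      qed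
      then show ?thesis using P1[OF x] by (simp flip: sum_distrib_right)
    qed
    then show ?thesis using v by (simp add: cinner_carrier[of _ d])
  qed
  have s2: "of_real s * of_real s = (1 :: complex)" using s by auto
  have "complex_of_real (\<Sum>x<d. \<Sum>y<d. (cmod (q x y - of_real s * q y x))\<^sup>2)
      = (\<Sum>x<d. \<Sum>y<d. (q x y * cnj (q x y) + q y x * cnj (q y x))
          - of_real s * (q y x * cnj (q x y) + q x y * cnj (q y x)))"
    unfolding of_real_sum complex_norm_square
    using s by (intro sum.cong refl) (auto simp: algebra_simps)
  also have "\<dots> = (\<Sum>x<d. \<Sum>y<d. q x y * cnj (q x y)) + (\<Sum>x<d. \<Sum>y<d. q y x * cnj (q y x))
     - of_real s * ((\<Sum>x<d. \<Sum>y<d. q y x * cnj (q x y)) + (\<Sum>x<d. \<Sum>y<d. q x y * cnj (q y x)))"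
    by (simp add: sum.distrib sum_subtractf sum_distrib_left distrib_left)
  also have "(\<Sum>x<d. \<Sum>y<d. q y x * cnj (q y x)) = (\<Sum>x<d. \<Sum>y<d. q x y * cnj (q x y))"
    by (subst sum.swap) simp
  also have "(\<Sum>x<d. \<Sum>y<d. q x y * cnj (q y x)) = (\<Sum>x<d. \<Sum>y<d. q y x * cnj (q x y))"
    by (subst sum.swap) simp
  also have "(\<Sum>x<d. \<Sum>y<d. q y x * cnj (q x y)) = discriminant d P v \<bullet>c v"
    unfolding cinner_discriminant[OF v v] q_def ..
  finally show ?thesis unfolding qq by (simp add: q_def)
qed

lemma discriminant_eigenvalue_bounds:
  assumes P: "stochastic d P" and v: "v \<in> carrier_vec d" "v \<noteq> 0\<^sub>v d"
    and e: "discriminant d P v = complex_of_real l \<cdot>\<^sub>v v"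
  shows "- 1 \<le> l" "l \<le> 1"
proof -
  have pos: "0 < (vnorm v)\<^sup>2" using vnorm_eq_0[OF v(1)] v(2) by simp
  have *: "0 \<le> (1 - s * l) * (vnorm v)\<^sup>2" if "s = 1 \<or> s = - 1" for s :: real
  proof -
    have "complex_of_real (\<Sum>x<d. \<Sum>y<d.
      (cmod (sqrt (P $$ (x, y)) * v $ x - of_real s * (sqrt (P $$ (y, x)) * v $ y)))\<^sup>2)
      = complex_of_real (2 * ((1 - s * l) * (vnorm v)\<^sup>2))"
      unfolding discriminant_form[OF P v(1) that] e cinner_smult_left[OF v(1) v(1)] cinner_self
      by (simp add: algebra_simps)
    then have "2 * ((1 - s * l) * (vnorm v)\<^sup>2) = (\<Sum>x<d. \<Sum>y<d.
      (cmod (sqrt (P $$ (x, y)) * v $ x - of_real s * (sqrt (P $$ (y, x)) * v $ y)))\<^sup>2)"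
      unfolding of_real_eq_iff ..
    also have "\<dots> \<ge> 0" by (intro sum_nonneg) auto
    finally show ?thesis by simp
  qed
  show "- 1 \<le> l" "l \<le> 1" using *[of 1] *[of "-1"] pos by (simp_all add: zero_le_mult_iff)
qed

lemma discriminant_fixed_edge:
  assumes P: "stochastic d P" and v: "v \<in> carrier_vec d" and e: "discriminant d P v = v"
    and xy: "x < d" "y < d"
  shows "complex_of_real (sqrt (P $$ (x, y))) * v $ x = complex_of_real (sqrt (P $$ (y, x))) * v $ y"
proof -
  let ?h = "\<lambda>x y. (cmod (sqrt (P $$ (x, y)) * v $ x - sqrt (P $$ (y, x)) * v $ y))\<^sup>2"
  have "complex_of_real (\<Sum>x<d. \<Sum>y<d. ?h x y) = 0"
    using discriminant_form[OF P v, of 1] e by simp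
  then have "(\<Sum>x<d. \<Sum>y<d. ?h x y) = 0" unfolding of_real_eq_0_iff .
  then have "\<forall>x\<in>{..<d}. (\<Sum>y<d. ?h x y) = 0"
    by (subst (asm) sum_nonneg_eq_0_iff) (auto intro: sum_nonneg)
  then have "(\<Sum>y<d. ?h x y) = 0" using xy by simp
  then have "\<forall>y\<in>{..<d}. ?h x y = 0" by (subst (asm) sum_nonneg_eq_0_iff) auto
  then show ?thesis using xy by simp
qed

text \<open>For a fixed vector, the quotient of v by the square root of the weight takes equal
  values at the ends of every edge, so irreducibility makes it constant.\<close>

lemma discriminant_fixed_unique:
  assumes P: "reversible_ergodic_chain d \<pi> P" and \<pi>: "\<And>x. x < d \<Longrightarrow> 0 < \<pi> x"
    and v: "v \<in> carrier_vec d" and e: "discriminant d P v = v"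
  shows "\<exists>c. v = c \<cdot>\<^sub>v qsample d \<pi>"
proof (cases "d = 0")
  case True
  then show ?thesis using v by (intro exI[of _ 0] eq_vecI) (auto simp: qsample_def)
next
  case False
  have st: "stochastic d P" and rev: "reversible d \<pi> P" and irr: "irreducible_chain d P"
    using P by (auto simp: reversible_ergodic_chain_def)
  have Pc: "P \<in> carrier_mat d d" and P0: "\<And>x y. x < d \<Longrightarrow> y < d \<Longrightarrow> 0 \<le> P $$ (x, y)"
    using st by (auto simp: stochastic_def)
  define u where "u x = v $ x / complex_of_real (sqrt (\<pi> x))" for x
  have edge: "u x = u y" if xy: "x < d" "y < d" "0 < P $$ (x, y)" for x y
  proof -
    have "\<pi> x * P $$ (x, y) = \<pi> y * P $$ (y, x)" using rev xy by (auto simp: reversible_def)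
    then have "sqrt (\<pi> x) * sqrt (P $$ (x, y)) = sqrt (\<pi> y) * sqrt (P $$ (y, x))"
      by (metis real_sqrt_mult)
    then have r: "complex_of_real (sqrt (\<pi> x)) * complex_of_real (sqrt (P $$ (x, y)))
        = complex_of_real (sqrt (\<pi> y)) * complex_of_real (sqrt (P $$ (y, x)))"
      unfolding of_real_mult[symmetric] by simp
    have ed: "complex_of_real (sqrt (P $$ (x, y))) * v $ x = complex_of_real (sqrt (P $$ (y, x))) * v $ y"
      by (rule discriminant_fixed_edge[OF st v e xy(1,2)])
    have nz: "complex_of_real (sqrt (\<pi> x)) \<noteq> 0" "complex_of_real (sqrt (\<pi> y)) \<noteq> 0" 
       "complex_of_real (sqrt (P $$ (x, y))) \<noteq> 0"
      using \<pi>[OF xy(1)] \<pi>[OF xy(2)] xy(3) by auto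
    have "complex_of_real (sqrt (P $$ (x, y))) * (v $ x * complex_of_real (sqrt (\<pi> y)))
      = (complex_of_real (sqrt (P $$ (x, y))) * v $ x) * complex_of_real (sqrt (\<pi> y))" by simp
    also have "\<dots> = (complex_of_real (sqrt (\<pi> y)) * complex_of_real (sqrt (P $$ (y, x)))) * v $ y"
      unfolding ed by simp
    also have "\<dots> = complex_of_real (sqrt (P $$ (x, y))) * (v $ y * complex_of_real (sqrt (\<pi> x)))"
      unfolding r[symmetric] by simp
    finally have "complex_of_real (sqrt (P $$ (x, y))) * (v $ x * complex_of_real (sqrt (\<pi> y)))
      = complex_of_real (sqrt (P $$ (x, y))) * (v $ y * complex_of_real (sqrt (\<pi> x)))" .
    then have "v $ x * complex_of_real (sqrt (\<pi> y)) = v $ y * complex_of_real (sqrt (\<pi> x))"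
      using nz by simp
    then show ?thesis using nz by (simp add: u_def frac_eq_eq)
  qed
  \<comment> \<open>Induction on the power of P: a positive entry of a product of nonnegative
    matrices has a positive summand, which is the last edge of a path.\<close>
  have path: "x < d \<Longrightarrow> y < d \<Longrightarrow> 0 < (P ^\<^sub>m k) $$ (x, y) \<Longrightarrow> u x = u y" for k x y
  proof (induction k arbitrary: y)
    case 0
    then show ?case using Pc by (simp split: if_splits)
  next
    case (Suc k)
    have "(P ^\<^sub>m Suc k) $$ (x, y) = (\<Sum>z<d. (P ^\<^sub>m k) $$ (x, z) * P $$ (z, y))"
      using Suc.prems Pc pow_carrier_mat[OF Pc, of k]
      by (auto simp: scalar_prod_def atLeast0LessThan intro!: sum.cong)
    then have pos: "0 < (\<Sum>z<d. (P ^\<^sub>m k) $$ (x, z) * P $$ (z, y))" using Suc.prems(3) by simp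
    have "\<exists>z<d. 0 < (P ^\<^sub>m k) $$ (x, z) * P $$ (z, y)"
    proof (rule ccontr)
      assume "\<not> ?thesis"
      then have "(\<Sum>z<d. (P ^\<^sub>m k) $$ (x, z) * P $$ (z, y)) \<le> 0"
        by (intro sum_nonpos) (meson lessThan_iff not_less)
      then show False using pos by simp
    qed
    then obtain z where z: "z < d" "0 < (P ^\<^sub>m k) $$ (x, z) * P $$ (z, y)" by blast
    then have "0 < (P ^\<^sub>m k) $$ (x, z)" "0 < P $$ (z, y)"
      using P0[OF z(1) Suc.prems(2)] by (auto simp: zero_less_mult_iff)
    then show ?case using Suc.IH[OF Suc.prems(1) z(1)] edge[OF z(1) Suc.prems(2)] by simp
  qed
  have u0: "u x = u 0" if "x < d" for x
    using irr path[OF that, of 0] that False unfolding irreducible_chain_def by blast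
  have "v $ x = u 0 * complex_of_real (sqrt (\<pi> x))" if "x < d" for x
  proof -
    have "v $ x = u x * complex_of_real (sqrt (\<pi> x))" using \<pi>[OF that] by (simp add: u_def)
    then show ?thesis using u0[OF that] by simp
  qed
  then have "v = u 0 \<cdot>\<^sub>v qsample d \<pi>" using v by (intro eq_vecI) (auto simp: qsample_def)
  then show ?thesis by blast
qed

text \<open>Detailed balance turns sqrt (P (y, x) pi y) into sqrt (P (x, y) pi x), so only the row
  sum of P is left.\<close>

lemma discriminant_qsample:
  assumes P: "reversible_ergodic_chain d \<pi> P" and \<pi>: "\<And>x. x < d \<Longrightarrow> 0 \<le> \<pi> x"
  shows "discriminant d P (qsample d \<pi>) = qsample d \<pi>"
proof (rule eq_vecI)
  have st: "stochastic d P" and rev: "reversible d \<pi> P"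
    using P by (auto simp: reversible_ergodic_chain_def)
  fix x assume "x < dim_vec (qsample d \<pi>)"
  then have x: "x < d" by (simp add: qsample_def)
  have "discriminant d P (qsample d \<pi>) $ x
      = (\<Sum>y<d. complex_of_real (sqrt (P $$ (x, y)) * sqrt (P $$ (y, x)) * sqrt (\<pi> y)))"
    using x by (simp add: discriminant_def qsample_def)
  also have "\<dots> = (\<Sum>y<d. complex_of_real (P $$ (x, y) * sqrt (\<pi> x)))"
  proof (intro sum.cong refl arg_cong[where f = complex_of_real])
    fix y assume "y \<in> {..<d}"
    then have y: "y < d" by simp
    have "\<pi> x * P $$ (x, y) = \<pi> y * P $$ (y, x)" using rev x y by (auto simp: reversible_def)
    then have "sqrt (P $$ (y, x)) * sqrt (\<pi> y) = sqrt (P $$ (x, y)) * sqrt (\<pi> x)"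
      by (metis mult.commute real_sqrt_mult)
    moreover have "0 \<le> P $$ (x, y)" using st x y by (auto simp: stochastic_def)
    ultimately show "sqrt (P $$ (x, y)) * sqrt (P $$ (y, x)) * sqrt (\<pi> y) = P $$ (x, y) * sqrt (\<pi> x)"
      by (simp add: mult.assoc flip: mult.assoc[of "sqrt (P $$ (x, y))" "sqrt (P $$ (x, y))"])
  qed
  also have "\<dots> = complex_of_real ((\<Sum>y<d. P $$ (x, y)) * sqrt (\<pi> x))"
    by (simp add: sum_distrib_right)
  also have "\<dots> = qsample d \<pi> $ x" using st x by (simp add: stochastic_def qsample_def)
  finally show "discriminant d P (qsample d \<pi>) $ x = qsample d \<pi> $ x" .
qed (simp add: discriminant_def qsample_def)

lemma qsample_carrier [simp]: "qsample d \<mu> \<in> carrier_vec d"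
  by (simp add: qsample_def)

lemma vnorm_qsample:
  assumes "\<And>x. x < d \<Longrightarrow> 0 \<le> \<mu> x" "(\<Sum>x<d. \<mu> x) = 1"
  shows "vnorm (qsample d \<mu>) = 1"
  using assms by (simp add: vnorm_def L2_set_def qsample_def)

lemma discriminant_eigenbasis:
  assumes P: "reversible_ergodic_chain d \<pi> P" and \<pi>: "\<And>x. x < d \<Longrightarrow> 0 < \<pi> x" "(\<Sum>x<d. \<pi> x) = 1"
    and d: "0 < d"
  shows "\<exists>t l. orthonormal d d t \<and> t 0 = qsample d \<pi> \<and>
    (\<forall>j<d. discriminant d P (t j) = complex_of_real (l j) \<cdot>\<^sub>v t j) \<and> l 0 = 1 \<and>
    (\<forall>j<d. j \<noteq> 0 \<longrightarrow> - 1 \<le> l j \<and> l j < 1)"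
proof -
  have st: "stochastic d P" using P by (simp add: reversible_ergodic_chain_def)
  define q where "q = qsample d \<pi>"
  have q: "q \<in> carrier_vec d" "vnorm q = 1" "discriminant d P q = q"
    using \<pi> vnorm_qsample[of d \<pi>] discriminant_qsample[OF P] by (auto simp: q_def less_imp_le)
  obtain t l where t: "orthonormal d d t" "\<forall>j<d. discriminant d P (t j) = complex_of_real (l j) \<cdot>\<^sub>v t j"
      "\<forall>j<1. t j = q"
  proof -
    have "\<exists>t l. orthonormal d d t \<and> (\<forall>j<d. discriminant d P (t j) = complex_of_real (l j) \<cdot>\<^sub>v t j) \<and>
        (\<forall>j<1. t j = q)"
      by (rule orthonormal_eigenbasis[OF linop_discriminant discriminant_hermitian
            orthonormal_single[OF q(1,2)], where l = "\<lambda>_. 1"]) (use d q in auto)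
    then show ?thesis using that by blast
  qed
  have tc: "t j \<in> carrier_vec d" "t j \<noteq> 0\<^sub>v d" if "j < d" for j
    using orthonormalD[OF t(1)] that vnorm_eq_0[of "t j" d] by fastforce+
  have bounds: "- 1 \<le> l j" "l j \<le> 1" if "j < d" for j
    using discriminant_eigenvalue_bounds[OF st tc[OF that]] t(2) that by auto
  have ne: "l j \<noteq> 1" if j: "j < d" "j \<noteq> 0" for j
  proof
    assume "l j = 1"
    then have "discriminant d P (t j) = t j" using t(2) j by simp
    then obtain c where c: "t j = c \<cdot>\<^sub>v q"
      using discriminant_fixed_unique[OF P \<pi>(1) tc(1)[OF j(1)]] unfolding q_def by blast
    have "t j \<bullet>c t 0 = 0" using orthonormalD(2)[OF t(1) j(1) d] j(2) by simp
    then have "c * (q \<bullet>c q) = 0" using t(3) q(1) unfolding c by simp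
    then have "c = 0" using q(2) by (simp add: cinner_self)
    then have "t j = 0\<^sub>v d" using q(1) unfolding c by (intro eq_vecI) auto
    then show False using tc[OF j(1)] by simp
  qed
  have t0: "t 0 = qsample d \<pi>" using t(3) by (simp add: q_def)
  \<comment> \<open>\<open>orthonormal_eigenbasis\<close> keeps the vectors it was given but does
    not report their eigenvalues, so \<open>l 0\<close> is recovered here.\<close>
  have "complex_of_real (l 0) * (q \<bullet>c q) = q \<bullet>c q"
    using arg_cong[OF t(2)[rule_format, OF d], of "\<lambda>w. w \<bullet>c q"] t(3) q by simp
  then have "l 0 = 1" using q(2) by (simp add: cinner_self)
  moreover have "l j < 1" if "j < d" "j \<noteq> 0" for j
    using bounds(2)[OF that(1)] ne[OF that] by (rule order.not_eq_order_implies_strict[rotated])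
  ultimately show ?thesis
    using t(1,2) t0 bounds(1) by blast
qed

section \<open>Eigenvalues of the discriminant as phases of the walk\<close>

lemma step_isometry_vec:
  assumes "v \<in> carrier_vec d" "r < d * d"
  shows "(step_isometry d P *\<^sub>v v) $ r = complex_of_real (sqrt (P $$ (r div d, r mod d))) * v $ (r div d)"
proof -
  have "(step_isometry d P *\<^sub>v v) $ r = (\<Sum>x<d. step_isometry d P $$ (r, x) * v $ x)"
    using assms by (intro mat_vec_index) (auto simp: step_isometry_def)
  also have "\<dots> = (\<Sum>x<d. if r div d = x then complex_of_real (sqrt (P $$ (x, r mod d))) * v $ x else 0)"
    using assms by (intro sum.cong) (auto simp: step_isometry_def)
  also have "\<dots> = complex_of_real (sqrt (P $$ (r div d, r mod d))) * v $ (r div d)"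
    using assms(2) by (simp add: less_mult_imp_div_less)
  finally show ?thesis .
qed

lemma step_isometry_adjoint_vec:
  assumes u: "u \<in> carrier_vec (d * d)" and x: "x < d"
  shows "(mat_adjoint (step_isometry d P) *\<^sub>v u) $ x
    = (\<Sum>y<d. complex_of_real (sqrt (P $$ (x, y))) * u $ (x * d + y))"
proof -
  have T: "step_isometry d P \<in> carrier_mat (d * d) d" by (simp add: step_isometry_def)
  have "(mat_adjoint (step_isometry d P) *\<^sub>v u) $ x
      = (\<Sum>r<d * d. mat_adjoint (step_isometry d P) $$ (x, r) * u $ r)"
    by (rule mat_vec_index[OF mat_adjoint_carrier[OF T] u x])
  also have "\<dots> = (\<Sum>r<d * d. if r div d = x then complex_of_real (sqrt (P $$ (x, r mod d))) * u $ r else 0)"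
  proof (intro sum.cong refl)
    fix r assume "r \<in> {..<d * d}"
    then have "mat_adjoint (step_isometry d P) $$ (x, r) = cnj (step_isometry d P $$ (r, x))"
      using x by (intro mat_adjoint_index[OF T]) auto
    then show "mat_adjoint (step_isometry d P) $$ (x, r) * u $ r
        = (if r div d = x then complex_of_real (sqrt (P $$ (x, r mod d))) * u $ r else 0)"
      using x \<open>r \<in> {..<d * d}\<close> by (simp add: step_isometry_def)
  qed
  also have "\<dots> = (\<Sum>x'<d. \<Sum>y<d. if x' = x then complex_of_real (sqrt (P $$ (x, y))) * u $ (x * d + y) else 0)"
    unfolding sum_mult_split by (intro sum.cong refl) auto
  also have "\<dots> = (\<Sum>y<d. complex_of_real (sqrt (P $$ (x, y))) * u $ (x * d + y))"
    using x by (simp add: sum.swap[of _ "{..<d}" "{..<d}"] cong: if_cong)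
  finally show ?thesis .
qed

lemma swap_mat_vec:
  assumes u: "u \<in> carrier_vec (d * d)" and xy: "x < d" "y < d"
  shows "(swap_mat d *\<^sub>v u) $ (x * d + y) = u $ (y * d + x)"
proof -
  have "(swap_mat d *\<^sub>v u) $ (x * d + y) = (\<Sum>r<d * d. swap_mat d $$ (x * d + y, r) * u $ r)"
    using u pair_index_less[OF xy] by (intro mat_vec_index) (auto simp: swap_mat_def)
  also have "\<dots> = (\<Sum>r<d * d. if r = y * d + x then u $ r else 0)"
  proof (intro sum.cong refl)
    fix r assume "r \<in> {..<d * d}"
    moreover have "(x = r mod d \<and> y = r div d) \<longleftrightarrow> r = y * d + x"
      using xy by (auto simp: mult.commute)
    ultimately show "swap_mat d $$ (x * d + y, r) * u $ r = (if r = y * d + x then u $ r else 0)"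
      using xy pair_index_less[OF xy] by (auto simp: swap_mat_def)
  qed
  also have "\<dots> = u $ (y * d + x)" using pair_index_less[OF xy(2,1)] by simp
  finally show ?thesis .
qed

lemma pair_vec_eqI:
  assumes "u \<in> carrier_vec (m * n)" "v \<in> carrier_vec (m * n)"
    "\<And>x y. x < m \<Longrightarrow> y < n \<Longrightarrow> u $ (x * n + y) = v $ (x * n + y)"
  shows "u = v"
proof (rule eq_vecI)
  fix r assume "r < dim_vec v"
  then have r: "r < m * n" using assms(2) by simp
  then have "0 < n" by (cases n) auto
  then have "r div n < m" "r mod n < n" using r by (auto simp: less_mult_imp_div_less)
  from assms(3)[OF this] show "u $ r = v $ r" by simp
qed (use assms in auto)

lemma szegedy_walk_carrier: "szegedy_walk d P \<in> carrier_mat (d * d) (d * d)"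
proof -
  let ?T = "step_isometry d P"
  have T: "?T \<in> carrier_mat (d * d) d" and S: "swap_mat d \<in> carrier_mat (d * d) (d * d)"
    by (simp_all add: step_isometry_def swap_mat_def)
  have "2 \<cdot>\<^sub>m (?T * mat_adjoint ?T) - 1\<^sub>m (d * d) \<in> carrier_mat (d * d) (d * d)"
    by (intro minus_carrier_mat one_carrier_mat)
  then show ?thesis unfolding szegedy_walk_def by (rule mult_carrier_mat[OF _ S])
qed

text \<open>The span of a = T v and b = S T v is invariant: W a = 2 l a - b and W b = a. With w +
  cnj w = 2 l, the vector a - cnj w b is multiplied by w.\<close>

lemma szegedy_walk_eigenvalue:
  assumes P: "stochastic d P" and v: "v \<in> carrier_vec d" "v \<noteq> 0\<^sub>v d"
    and e: "discriminant d P v = complex_of_real l \<cdot>\<^sub>v v" and l: "- 1 \<le> l" "l < 1"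
  shows "cis (arccos l) \<in> spectrum (szegedy_walk d P)"
proof -
  let ?T = "step_isometry d P" and ?S = "swap_mat d" and ?W = "szegedy_walk d P"
  have T: "?T \<in> carrier_mat (d * d) d" and S: "?S \<in> carrier_mat (d * d) (d * d)"
    by (simp_all add: step_isometry_def swap_mat_def)
  note T' = mat_adjoint_carrier[OF T]
  note W = szegedy_walk_carrier[of d P]
  define a where "a = ?T *\<^sub>v v"
  define b where "b = ?S *\<^sub>v a"
  have a: "a \<in> carrier_vec (d * d)" unfolding a_def using T by (rule mult_mat_vec_carrier) (rule v)
  have b: "b \<in> carrier_vec (d * d)" unfolding b_def using S by (rule mult_mat_vec_carrier) (rule a)
  have a_idx: "a $ (x * d + y) = complex_of_real (sqrt (P $$ (x, y))) * v $ x" if "x < d" "y < d" for x y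
    unfolding a_def using step_isometry_vec[OF v(1) pair_index_less[OF that]] that by simp
  have b_idx: "b $ (x * d + y) = complex_of_real (sqrt (P $$ (y, x))) * v $ y" if "x < d" "y < d" for x y
    unfolding b_def swap_mat_vec[OF a that] a_idx[OF that(2,1)] ..
  have Sb: "?S *\<^sub>v b = a"
    by (rule pair_vec_eqI[where m = d and n = d])
      (use a b S in \<open>auto simp: swap_mat_vec a_idx b_idx mult_mat_vec_carrier\<close>)
  have T'a: "mat_adjoint ?T *\<^sub>v a = v"
  proof (rule eq_vecI)
    fix x assume "x < dim_vec v"
    then have x: "x < d" using v by simp
    have "(\<Sum>y<d. complex_of_real (sqrt (P $$ (x, y))) * (complex_of_real (sqrt (P $$ (x, y))) * v $ x))
        = (\<Sum>y<d. complex_of_real (P $$ (x, y)) * v $ x)"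
      using P x by (intro sum.cong refl)
        (auto simp: stochastic_def mult.assoc[symmetric] simp flip: of_real_mult)
    also have "\<dots> = complex_of_real (\<Sum>y<d. P $$ (x, y)) * v $ x" unfolding of_real_sum sum_distrib_right ..
    also have "\<dots> = v $ x" using P x by (simp add: stochastic_def del: of_real_sum)
    finally show "(mat_adjoint ?T *\<^sub>v a) $ x = v $ x"
      using x by (simp add: step_isometry_adjoint_vec[OF a x] a_idx del: index_mult_mat_vec)
  qed (use v T' in auto)
  have T'b: "mat_adjoint ?T *\<^sub>v b = complex_of_real l \<cdot>\<^sub>v v"
  proof (rule eq_vecI)
    fix x assume "x < dim_vec (complex_of_real l \<cdot>\<^sub>v v)"
    then have x: "x < d" using v by simp
    have "(mat_adjoint ?T *\<^sub>v b) $ x = discriminant d P v $ x"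
      using x by (simp add: step_isometry_adjoint_vec[OF b x] b_idx discriminant_def mult.assoc
        del: index_mult_mat_vec)
    then show "(mat_adjoint ?T *\<^sub>v b) $ x = (complex_of_real l \<cdot>\<^sub>v v) $ x" unfolding e .
  qed (use v T' in auto)
  have Wu: "?W *\<^sub>v u = 2 \<cdot>\<^sub>v (?T *\<^sub>v (mat_adjoint ?T *\<^sub>v (?S *\<^sub>v u))) - ?S *\<^sub>v u"
    if u: "u \<in> carrier_vec (d * d)" for u
  proof -
    have Su: "?S *\<^sub>v u \<in> carrier_vec (d * d)" using S by (rule mult_mat_vec_carrier) (rule u)
    have TT: "?T * mat_adjoint ?T \<in> carrier_mat (d * d) (d * d)" using T T' by simp
    have "?W *\<^sub>v u = (2 \<cdot>\<^sub>m (?T * mat_adjoint ?T) - 1\<^sub>m (d * d)) *\<^sub>v (?S *\<^sub>v u)"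
      unfolding szegedy_walk_def using TT S u by (intro assoc_mult_mat_vec) auto
    also have "\<dots> = (2 \<cdot>\<^sub>m (?T * mat_adjoint ?T)) *\<^sub>v (?S *\<^sub>v u) - 1\<^sub>m (d * d) *\<^sub>v (?S *\<^sub>v u)"
      by (rule minus_mult_distrib_mat_vec) (use TT Su in auto)
    also have "(2 \<cdot>\<^sub>m (?T * mat_adjoint ?T)) *\<^sub>v (?S *\<^sub>v u) = 2 \<cdot>\<^sub>v ((?T * mat_adjoint ?T) *\<^sub>v (?S *\<^sub>v u))"
    proof (rule eq_vecI)
      fix i assume "i < dim_vec (2 \<cdot>\<^sub>v ((?T * mat_adjoint ?T) *\<^sub>v (?S *\<^sub>v u)))"
      then have i: "i < d * d" using T by simp
      then have "row (?T * mat_adjoint ?T) i \<in> carrier_vec (d * d)" using TT by (intro row_carrier_vec) auto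
      then show "((2 \<cdot>\<^sub>m (?T * mat_adjoint ?T)) *\<^sub>v (?S *\<^sub>v u)) $ i
          = (2 \<cdot>\<^sub>v ((?T * mat_adjoint ?T) *\<^sub>v (?S *\<^sub>v u))) $ i"
        using smult_scalar_prod_distrib[OF _ Su, of "row (?T * mat_adjoint ?T) i" 2] i TT T T'
        by (simp del: smult_scalar_prod_distrib)
    qed (use TT in auto)
    also have "(?T * mat_adjoint ?T) *\<^sub>v (?S *\<^sub>v u) = ?T *\<^sub>v (mat_adjoint ?T *\<^sub>v (?S *\<^sub>v u))"
      by (rule assoc_mult_mat_vec[OF T T' Su])
    finally show ?thesis using Su by simp
  qed
  have Tl: "?T *\<^sub>v (complex_of_real l \<cdot>\<^sub>v v) = complex_of_real l \<cdot>\<^sub>v a"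
    unfolding a_def by (rule mult_mat_vec[OF T v(1)])
  have Wa: "?W *\<^sub>v a = 2 \<cdot>\<^sub>v (complex_of_real l \<cdot>\<^sub>v a) - b"
    unfolding Wu[OF a] b_def[symmetric] T'b Tl ..
  have Wb: "?W *\<^sub>v b = a"
    unfolding Wu[OF b] Sb T'a a_def[symmetric] using a by (intro eq_vecI) auto
  define w where "w = cis (arccos l)"
  have wz: "w * cnj w = 1" by (simp add: w_def cis_cnj cis_mult)
  have wl: "w + cnj w = 2 * complex_of_real l"
    using l by (simp add: w_def complex_eq_iff)
  define u where "u = a - cnj w \<cdot>\<^sub>v b"
  have u: "u \<in> carrier_vec (d * d)" using a b by (simp add: u_def)
  have Wlin: "?W *\<^sub>v u = ?W *\<^sub>v a - cnj w \<cdot>\<^sub>v (?W *\<^sub>v b)"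
    using linop_diff[OF linop_mat[OF W] a, of "cnj w \<cdot>\<^sub>v b"] linop_smult[OF linop_mat[OF W] b] b
    by (simp add: u_def)
  have Wu_eq: "?W *\<^sub>v u = w \<cdot>\<^sub>v u"
    unfolding Wlin Wa Wb
  proof (rule eq_vecI)
    fix i assume "i < dim_vec (w \<cdot>\<^sub>v u)"
    then have i: "i < d * d" using u by simp
    have "2 * (complex_of_real l * a $ i) - b $ i - cnj w * a $ i = w * a $ i - (w * cnj w) * b $ i"
      unfolding wz mult.assoc[of 2, symmetric] wl[symmetric] by (simp add: algebra_simps)
    then show "(2 \<cdot>\<^sub>v (complex_of_real l \<cdot>\<^sub>v a) - b - cnj w \<cdot>\<^sub>v a) $ i = (w \<cdot>\<^sub>v u) $ i"
      using i a b unfolding u_def by (simp add: algebra_simps)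
  qed (use a b u in auto)
  have a0: "a \<noteq> 0\<^sub>v (d * d)"
  proof
    assume "a = 0\<^sub>v (d * d)"
    then have "v = mat_adjoint ?T *\<^sub>v 0\<^sub>v (d * d)" using T'a by simp
    also have "\<dots> = 0\<^sub>v d" using T' by (intro eq_vecI) auto
    finally have "v = 0\<^sub>v d" .
    then show False using v by simp
  qed
  have "\<exists>u. eigenvector ?W u w"
  proof (cases "u = 0\<^sub>v (d * d)")
    case False
    then show ?thesis using u Wu_eq W by (auto simp: eigenvector_def)
  next
    case True
    \<comment> \<open>If a and b are parallel, the candidate vanishes. Then w = l is real, so l =
      -1, and a itself is an eigenvector for -1.\<close>
    then have "a = cnj w \<cdot>\<^sub>v b" using vec_diff_eq_0[of a "d * d" "cnj w \<cdot>\<^sub>v b"] a b by (simp add: u_def)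
    then have "b = w \<cdot>\<^sub>v a" using b wz by (simp add: smult_smult_assoc)
    then have "mat_adjoint ?T *\<^sub>v b = w \<cdot>\<^sub>v v" using mult_mat_vec[OF T' a] T'a by simp
    then have "complex_of_real l \<cdot>\<^sub>v v = w \<cdot>\<^sub>v v" using T'b by simp
    moreover obtain i where "i < d" "v $ i \<noteq> 0" using v by (auto simp: vec_eq_iff)
    ultimately have "complex_of_real l = w" using v(1) by (auto simp: vec_eq_iff)
    then have "complex_of_real (l * l) = 1" using wz unfolding \<open>complex_of_real l = w\<close>[symmetric] by simp
    then have "l * l = 1" unfolding of_real_eq_1_iff .
    then have l1: "l = - 1" using l by (simp add: square_eq_1_iff)
    then have w1: "w = - 1" by (simp add: w_def)
    have "?W *\<^sub>v a = w \<cdot>\<^sub>v a" unfolding Wa \<open>b = w \<cdot>\<^sub>v a\<close> l1 w1 using a by (intro eq_vecI) auto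
    then show ?thesis using a a0 W by (auto simp: eigenvector_def)
  qed
  then show ?thesis by (simp add: spectrum_def eigenvalue_def w_def)
qed

text \<open>\<open>Min\<close> has its meaning only on a finite nonempty set: the spectrum is finite
  and \<open>cis\<close> is injective on the half-open interval, and an eigenvalue l < 1 contributes
  the nonzero phase \<open>arccos l\<close>.\<close>

lemma phase_gap_bounds:
  assumes P: "stochastic d P" and v: "v \<in> carrier_vec d" "v \<noteq> 0\<^sub>v d"
    and e: "discriminant d P v = complex_of_real l \<cdot>\<^sub>v v" and l: "- 1 \<le> l" "l < 1"
  shows "0 < phase_gap (szegedy_walk d P)" "phase_gap (szegedy_walk d P) \<le> arccos l"
proof -
  let ?W = "szegedy_walk d P"
  let ?A = "{\<theta>. \<theta> \<noteq> 0 \<and> cis \<theta> \<in> spectrum ?W \<and> \<theta> \<in> {-pi<..pi}}"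
  have W: "?W \<in> carrier_mat (d * d) (d * d)"
    by (rule szegedy_walk_carrier)
  have "inj_on cis {-pi<..pi}"
  proof (rule inj_onI)
    fix x y assume "x \<in> {-pi<..pi}" "y \<in> {-pi<..pi}" "cis x = cis y"
    then show "x = y" using cis_Arg_unique[of "cis x" x] cis_Arg_unique[of "cis x" y] by (simp add: sgn_cis)
  qed
  then have "finite ({-pi<..pi} \<inter> {\<theta>. cis \<theta> \<in> spectrum ?W})"
    using finite_vimage_IntI[OF card_finite_spectrum(1)[OF W], of cis "{-pi<..pi}"]
    by (simp add: vimage_def Int_commute)
  then have fin: "finite ?A" by (rule finite_subset[rotated]) auto
  have eq: "{\<bar>\<theta>\<bar> | \<theta>. \<theta> \<noteq> 0 \<and> cis \<theta> \<in> spectrum ?W \<and> \<theta> \<in> {-pi<..pi}} = abs ` ?A" by auto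
  have "arccos l \<noteq> 0"
  proof
    assume "arccos l = 0"
    then have "cos (arccos l) = 1" by simp
    then show False using l by simp
  qed
  then have mem: "arccos l \<in> ?A"
    using szegedy_walk_eigenvalue[OF assms] arccos_bounded[of l] l pi_gt_zero by (auto simp: )
  have abs: "\<bar>arccos l\<bar> = arccos l" using arccos_lbound[of l] l by simp
  show "phase_gap ?W \<le> arccos l"
    unfolding phase_gap_def eq using fin mem abs by (intro Min_le) (auto intro!: rev_image_eqI)
  show "0 < phase_gap ?W"
    unfolding phase_gap_def eq using fin mem by (subst Min_gr_iff) auto
qed

section \<open>Registers\<close>

text \<open>Places amplitude c p at coordinate g p, for the embedded states as well as for the
  oracle outputs. Summing over preimages makes linearity in c hold for every g; injectivity enters
  only when entries are read back.\<close>

definition scatter :: "nat \<Rightarrow> ('a \<Rightarrow> nat) \<Rightarrow> 'a set \<Rightarrow> ('a \<Rightarrow> complex) \<Rightarrow> complex vec" where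
  "scatter n g A c = vec n (\<lambda>r. \<Sum>p\<in>A. if r = g p then c p else 0)"

lemma pair_div_mod: "j < n \<Longrightarrow> (i * n + j) div n = (i :: nat)" "j < n \<Longrightarrow> (i * n + j) mod n = (j :: nat)"
  by simp_all

lemma scatter_carrier [simp]: "scatter n g A c \<in> carrier_vec n"
  by (simp add: scatter_def)

lemma scatter_index:
  assumes "finite A" "inj_on g A" "p \<in> A" "g p < n"
  shows "scatter n g A c $ g p = c p"
proof -
  have "(\<Sum>q\<in>A. if g p = g q then c q else 0) = (\<Sum>q\<in>A. if q = p then c q else 0)"
    using assms by (intro sum.cong) (auto dest: inj_onD)
  then show ?thesis using assms by (simp add: scatter_def)
qed

lemma cinner_scatter:
  assumes A: "\<And>p. p \<in> A \<Longrightarrow> g p < n" and w: "w \<in> carrier_vec n"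
  shows "w \<bullet>c scatter n g A c = (\<Sum>p\<in>A. w $ g p * cnj (c p))"
proof -
  have "w \<bullet>c scatter n g A c = (\<Sum>r<n. \<Sum>p\<in>A. if r = g p then w $ g p * cnj (c p) else 0)"
    using w by (simp add: cinner_carrier[of _ n])
      (auto simp: scatter_def sum_distrib_left intro!: sum.cong)
  also have "\<dots> = (\<Sum>p\<in>A. \<Sum>r<n. if r = g p then w $ g p * cnj (c p) else 0)"
    by (rule sum.swap)
  also have "\<dots> = (\<Sum>p\<in>A. w $ g p * cnj (c p))"
    using A by (intro sum.cong refl) simp
  finally show ?thesis .
qed

lemma scatter_add: "scatter n g A (\<lambda>p. c p + c' p) = scatter n g A c + scatter n g A c'"
proof (rule eq_vecI)
  fix r assume "r < dim_vec (scatter n g A c + scatter n g A c')"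
  then have r: "r < n" by (simp add: scatter_def)
  have "(\<Sum>p\<in>A. if r = g p then c p + c' p else 0)
      = (\<Sum>p\<in>A. (if r = g p then c p else 0) + (if r = g p then c' p else 0))"
    by (intro sum.cong refl) auto
  then show "scatter n g A (\<lambda>p. c p + c' p) $ r = (scatter n g A c + scatter n g A c') $ r"
    using r by (simp add: scatter_def sum.distrib)
qed (simp add: scatter_def)

lemma scatter_smult: "scatter n g A (\<lambda>p. k * c p) = k \<cdot>\<^sub>v scatter n g A c"
  by (intro eq_vecI) (auto simp: scatter_def sum_distrib_left intro!: sum.cong)

lemma scatter_cong: "(\<And>p. p \<in> A \<Longrightarrow> c p = c' p) \<Longrightarrow> scatter n g A c = scatter n g A c'"
  unfolding scatter_def by (intro arg_cong[where f = "vec n"] ext sum.cong) auto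

subsection \<open>Oracles next to idle qubits\<close>

text \<open>The component of u at value s of the idle qubits; operators of the form 1 tensor Q act
  on each block separately.\<close>

definition block :: "nat \<Rightarrow> nat \<Rightarrow> complex vec \<Rightarrow> complex vec" where
  "block n s u = vec n (\<lambda>c. u $ (s * n + c))"

lemma block_carrier [simp]: "block n s u \<in> carrier_vec n"
  by (simp add: block_def)

lemma cinner_block:
  assumes "u \<in> carrier_vec (m * n)" "v \<in> carrier_vec (m * n)"
  shows "u \<bullet>c v = (\<Sum>s<m. block n s u \<bullet>c block n s v)"
  using assms by (simp add: cinner_carrier[of _ "m * n"] sum_mult_split cinner_carrier[of _ n])
    (simp add: block_def)

lemma block_eqI:
  assumes "u \<in> carrier_vec (m * n)" "v \<in> carrier_vec (m * n)" "\<And>s. s < m \<Longrightarrow> block n s u = block n s v"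
  shows "u = v"
proof (rule pair_vec_eqI[OF assms(1,2)])
  fix x y assume "x < m" "y < n"
  then show "u $ (x * n + y) = v $ (x * n + y)"
    using arg_cong[OF assms(3), of x "\<lambda>w. w $ y"] by (simp add: block_def)
qed

lemma kron_one_carrier: "Q \<in> carrier_mat n n \<Longrightarrow> kron_mat (1\<^sub>m m) Q \<in> carrier_mat (m * n) (m * n)"
  by (simp add: kron_mat_def)

lemma block_kron_one:
  assumes Q: "Q \<in> carrier_mat n n" and u: "u \<in> carrier_vec (m * n)" and s: "s < m"
  shows "block n s (kron_mat (1\<^sub>m m) Q *\<^sub>v u) = Q *\<^sub>v block n s u"
proof (rule eq_vecI)
  fix r assume "r < dim_vec (Q *\<^sub>v block n s u)"
  then have r: "r < n" using Q by simp
  have "block n s (kron_mat (1\<^sub>m m) Q *\<^sub>v u) $ r = (\<Sum>k<m * n. kron_mat (1\<^sub>m m) Q $$ (s * n + r, k) * u $ k)"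
    using r mat_vec_index[OF kron_one_carrier[OF Q] u pair_index_less[OF s r]] by (simp add: block_def)
  also have "\<dots> = (\<Sum>s'<m. \<Sum>c<n. if s' = s then Q $$ (r, c) * u $ (s * n + c) else 0)"
    unfolding sum_mult_split
  proof (intro sum.cong refl)
    fix s' c assume "s' \<in> {..<m}" "c \<in> {..<n}"
    then have "kron_mat (1\<^sub>m m) Q $$ (s * n + r, s' * n + c) = (if s = s' then Q $$ (r, c) else 0)"
      using Q s r pair_index_less[of s m r n] pair_index_less[of s' m c n] by (simp add: kron_mat_def)
    then show "kron_mat (1\<^sub>m m) Q $$ (s * n + r, s' * n + c) * u $ (s' * n + c)
      = (if s' = s then Q $$ (r, c) * u $ (s * n + c) else 0)" by simp
  qed
  also have "\<dots> = (\<Sum>s'<m. if s' = s then \<Sum>c<n. Q $$ (r, c) * u $ (s * n + c) else 0)"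
    by (intro sum.cong refl) auto
  also have "\<dots> = (Q *\<^sub>v block n s u) $ r"
    using s mat_vec_index[OF Q block_carrier r] by (simp add: block_def)
  finally show "block n s (kron_mat (1\<^sub>m m) Q *\<^sub>v u) $ r = (Q *\<^sub>v block n s u) $ r" .
qed (use Q in \<open>auto simp: block_def\<close>)

lemma unipair_kron_one:
  assumes Q: "unitary_mat n Q"
  shows "unipair (m * n) (\<lambda>v. kron_mat (1\<^sub>m m) Q *\<^sub>v v) (\<lambda>v. kron_mat (1\<^sub>m m) (mat_adjoint Q) *\<^sub>v v)"
proof -
  have Qc: "Q \<in> carrier_mat n n" using Q by (simp add: unitary_mat_def)
  note Qc' = mat_adjoint_carrier[OF Qc]
  note L = linop_mat[OF kron_one_carrier[OF Qc, of m]] and L' = linop_mat[OF kron_one_carrier[OF Qc', of m]]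
  note q = unipairD[OF unipair_unitary_mat[OF Q]]
  show ?thesis unfolding unipair_def
  proof (intro conjI ballI L L')
    fix v w :: "complex vec" assume v: "v \<in> carrier_vec (m * n)" and w: "w \<in> carrier_vec (m * n)"
    note c = linop_carrier[OF L v] linop_carrier[OF L' v] linop_carrier[OF L' w]
    show "kron_mat (1\<^sub>m m) (mat_adjoint Q) *\<^sub>v (kron_mat (1\<^sub>m m) Q *\<^sub>v v) = v"
    proof (rule block_eqI[OF linop_carrier[OF L' c(1)] v])
      fix s assume s: "s < m"
      show "block n s (kron_mat (1\<^sub>m m) (mat_adjoint Q) *\<^sub>v (kron_mat (1\<^sub>m m) Q *\<^sub>v v)) = block n s v"
        unfolding block_kron_one[OF Qc' c(1) s] block_kron_one[OF Qc v s] by (rule q(3)) simp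
    qed
    show "kron_mat (1\<^sub>m m) Q *\<^sub>v (kron_mat (1\<^sub>m m) (mat_adjoint Q) *\<^sub>v v) = v"
    proof (rule block_eqI[OF linop_carrier[OF L c(2)] v])
      fix s assume s: "s < m"
      show "block n s (kron_mat (1\<^sub>m m) Q *\<^sub>v (kron_mat (1\<^sub>m m) (mat_adjoint Q) *\<^sub>v v)) = block n s v"
        unfolding block_kron_one[OF Qc c(2) s] block_kron_one[OF Qc' v s] by (rule q(4)) simp
    qed
    show "(kron_mat (1\<^sub>m m) Q *\<^sub>v v) \<bullet>c w = v \<bullet>c (kron_mat (1\<^sub>m m) (mat_adjoint Q) *\<^sub>v w)"
      unfolding cinner_block[OF c(1) w] cinner_block[OF v c(3)]
    proof (intro sum.cong refl)
      fix s assume "s \<in> {..<m}"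
      then have s: "s < m" by simp
      show "block n s (kron_mat (1\<^sub>m m) Q *\<^sub>v v) \<bullet>c block n s w
          = block n s v \<bullet>c block n s (kron_mat (1\<^sub>m m) (mat_adjoint Q) *\<^sub>v w)"
        unfolding block_kron_one[OF Qc v s] block_kron_one[OF Qc' w s] by (rule q(5)) auto
    qed
  qed
qed

subsection \<open>Swapping the two registers\<close>

text \<open>The quotient of r by M * M is the value of the idle factor, and q = a * M + b holds the
  two register values. All M register states are exchanged, not only codewords, so this is unitary
  on the whole space.\<close>

definition reg_swap :: "nat \<Rightarrow> nat \<Rightarrow> complex vec \<Rightarrow> complex vec" where
  "reg_swap m M u = vec (m * (M * M)) (\<lambda>r. let q = r mod (M * M)
     in u $ (r div (M * M) * (M * M) + (q mod M * M + q div M)))"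

lemma reg_swap_carrier [simp]: "reg_swap m M u \<in> carrier_vec (m * (M * M))"
  by (simp add: reg_swap_def)

lemma dim_reg_swap [simp]: "dim_vec (reg_swap m M u) = m * (M * M)"
  by (simp add: reg_swap_def)

lemma triple_index_less: "s < m \<Longrightarrow> a < M \<Longrightarrow> b < M \<Longrightarrow> s * (M * M) + (a * M + b) < m * (M * M :: nat)"
  by (intro pair_index_less)

lemma reg_swap_index:
  assumes "s < m" "a < M" "b < M"
  shows "reg_swap m M u $ (s * (M * M) + (a * M + b)) = u $ (s * (M * M) + (b * M + a))"
  using triple_index_less[OF assms] pair_index_less[OF assms(2,3)] assms
  by (simp add: reg_swap_def Let_def)

lemma triple_vec_eqI:
  fixes u v :: "complex vec"
  assumes "u \<in> carrier_vec (m * (M * M))" "v \<in> carrier_vec (m * (M * M))"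
    "\<And>s a b. s < m \<Longrightarrow> a < M \<Longrightarrow> b < M \<Longrightarrow> u $ (s * (M * M) + (a * M + b)) = v $ (s * (M * M) + (a * M + b))"
  shows "u = v"
proof (rule block_eqI[OF assms(1,2)])
  fix s assume s: "s < m"
  show "block (M * M) s u = block (M * M) s v"
    by (rule pair_vec_eqI[where m = M and n = M]) (use assms(3)[OF s] pair_index_less in \<open>auto simp: block_def\<close>)
qed

lemma linop_reg_swap: "linop (m * (M * M)) (reg_swap m M)"
  unfolding linop_def
proof (intro conjI ballI allI reg_swap_carrier)
  fix v w :: "complex vec" and c :: complex
  assume v: "v \<in> carrier_vec (m * (M * M))" "w \<in> carrier_vec (m * (M * M))"
  show "reg_swap m M (v + w) = reg_swap m M v + reg_swap m M w"
    by (rule triple_vec_eqI[where m = m and M = M]) (use v triple_index_less in \<open>auto simp: reg_swap_index\<close>)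
  show "reg_swap m M (c \<cdot>\<^sub>v v) = c \<cdot>\<^sub>v reg_swap m M v"
    by (rule triple_vec_eqI[where m = m and M = M]) (use v triple_index_less in \<open>auto simp: reg_swap_index\<close>)
qed

lemma reg_swap_swap: "u \<in> carrier_vec (m * (M * M)) \<Longrightarrow> reg_swap m M (reg_swap m M u) = u"
  by (rule triple_vec_eqI[where m = m and M = M]) (auto simp: reg_swap_index)

lemma cinner_triple:
  assumes "u \<in> carrier_vec (m * (M * M))" "v \<in> carrier_vec (m * (M * M))"
  shows "u \<bullet>c v = (\<Sum>s<m. \<Sum>a<M. \<Sum>b<M. u $ (s * (M * M) + (a * M + b)) * cnj (v $ (s * (M * M) + (a * M + b))))"
  using assms by (simp add: cinner_carrier[of _ "m * (M * M)"] sum_mult_split)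

lemma cinner_reg_swap:
  assumes "u \<in> carrier_vec (m * (M * M))" "v \<in> carrier_vec (m * (M * M))"
  shows "reg_swap m M u \<bullet>c v = u \<bullet>c reg_swap m M v"
proof -
  have "reg_swap m M u \<bullet>c v
      = (\<Sum>s<m. \<Sum>a<M. \<Sum>b<M. u $ (s * (M * M) + (b * M + a)) * cnj (v $ (s * (M * M) + (a * M + b))))"
    unfolding cinner_triple[OF reg_swap_carrier assms(2)]
    by (intro sum.cong refl) (simp add: reg_swap_index)
  also have "\<dots> = (\<Sum>s<m. \<Sum>a<M. \<Sum>b<M. u $ (s * (M * M) + (a * M + b)) * cnj (v $ (s * (M * M) + (b * M + a))))"
    by (rule sum.cong[OF refl], subst sum.swap) simp
  also have "\<dots> = u \<bullet>c reg_swap m M v"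
    unfolding cinner_triple[OF assms(1) reg_swap_carrier]
    by (intro sum.cong refl) (simp add: reg_swap_index)
  finally show ?thesis .
qed

text \<open>This is (1 - S) / 2, used as the projector whose complement is to be amplified: the
  complement (1 + S) / 2 compresses to (1 + D) / 2.\<close>

definition antisym_proj :: "nat \<Rightarrow> nat \<Rightarrow> complex vec \<Rightarrow> complex vec" where
  "antisym_proj m M u = (1 / 2) \<cdot>\<^sub>v (u - reg_swap m M u)"

lemma orthproj_antisym: "orthproj (m * (M * M)) (antisym_proj m M)"
  unfolding orthproj_def linop_def
proof (intro conjI ballI allI)
  let ?S = "reg_swap m M"
  fix v w :: "complex vec" and c :: complex
  assume v: "v \<in> carrier_vec (m * (M * M))" and w: "w \<in> carrier_vec (m * (M * M))"
  note L = linop_reg_swap[of m M]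
  note cs = reg_swap_carrier[of m M v] reg_swap_carrier[of m M w]
  show "antisym_proj m M v \<in> carrier_vec (m * (M * M))" using v by (simp add: antisym_proj_def)
  show "antisym_proj m M (v + w) = antisym_proj m M v + antisym_proj m M w"
    unfolding antisym_proj_def linop_add[OF L v w] using v w cs
    by (intro eq_vecI) (auto simp: algebra_simps)
  show "antisym_proj m M (c \<cdot>\<^sub>v v) = c \<cdot>\<^sub>v antisym_proj m M v"
    unfolding antisym_proj_def linop_smult[OF L v] using v cs
    by (intro eq_vecI) (auto simp: algebra_simps)
  have "?S (antisym_proj m M v) = (1 / 2) \<cdot>\<^sub>v (?S v - v)"
    unfolding antisym_proj_def using linop_smult[OF L, of "v - ?S v" "1 / 2"] linop_diff[OF L v cs(1)]
      reg_swap_swap[OF v] v cs by simp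
  then show "antisym_proj m M (antisym_proj m M v) = antisym_proj m M v"
    unfolding antisym_proj_def[of m M "antisym_proj m M v"] unfolding antisym_proj_def using v cs
    by (intro eq_vecI) (auto simp: algebra_simps)
  show "antisym_proj m M v \<bullet>c w = v \<bullet>c antisym_proj m M w"
    unfolding antisym_proj_def cinner_smult_left[OF minus_carrier_vec[OF v cs(1)] w]
      cinner_smult_right[OF minus_carrier_vec[OF w cs(2)] v] cinner_diff_left[OF v cs(1) w]
      cinner_diff_right[OF w cs(2) v] cinner_reg_swap[OF v w] by simp
qed

subsection \<open>The embedding\<close>

locale register_encoding =
  fixes d :: nat and enc :: "nat \<Rightarrow> nat"
  assumes enc: "encoding d enc"
begin

definition M :: nat where "M = (2 :: nat) ^ reg_qubits d"
definition N :: nat where "N = 2 * (M * M)"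

text \<open>Indices of the basis states with signal qubit 0 and registers x, 0
  (\<open>slot1\<close>) or x, y (\<open>slot2\<close>); a zero signal qubit adds no offset.\<close>

abbreviation slot1 :: "nat \<Rightarrow> nat" where "slot1 x \<equiv> enc x * M"
abbreviation slot2 :: "nat \<times> nat \<Rightarrow> nat" where "slot2 p \<equiv> enc (fst p) * M + enc (snd p)"

lemma M_pos: "0 < M" by (simp add: M_def)

lemma enc_less: "x < d \<Longrightarrow> enc x < M"
  using enc by (auto simp: encoding_def M_def)

lemma enc_inj: "x < d \<Longrightarrow> y < d \<Longrightarrow> enc x = enc y \<longleftrightarrow> x = y"
  using enc by (auto simp: encoding_def dest: inj_onD)

lemma slot1_less: "x < d \<Longrightarrow> slot1 x < N"
  using pair_index_less[OF enc_less M_pos, of x] by (simp add: N_def)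

lemma slot1_less': "x < d \<Longrightarrow> slot1 x < M * M"
  using pair_index_less[OF enc_less M_pos, of x] by simp

lemma slot2_less: "p \<in> {..<d} \<times> {..<d} \<Longrightarrow> slot2 p < M * M"
  using pair_index_less[OF enc_less enc_less, of "fst p" "snd p"] by auto

lemma slot1_inj: "inj_on slot1 {..<d}"
  using M_pos enc_inj by (auto intro!: inj_onI)

lemma slot2_inj: "inj_on slot2 ({..<d} \<times> {..<d})"
proof (rule inj_onI)
  fix p q assume pq: "p \<in> {..<d} \<times> {..<d}" "q \<in> {..<d} \<times> {..<d}" "slot2 p = slot2 q"
  have "slot2 p div M = enc (fst p)" "slot2 p mod M = enc (snd p)"
    "slot2 q div M = enc (fst q)" "slot2 q mod M = enc (snd q)"
    using enc_less[of "snd p"] enc_less[of "snd q"] pq(1,2) by (simp_all add: pair_div_mod mem_Times_iff)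
  then have "enc (fst p) = enc (fst q)" "enc (snd p) = enc (snd q)" using pq(3) by metis+
  then show "p = q" using pq enc_inj by (auto simp: prod_eq_iff)
qed

lemma enc_isometry_vec:
  assumes "v \<in> carrier_vec d" "a < M"
  shows "(enc_isometry d enc *\<^sub>v v) $ a = (\<Sum>x<d. if a = enc x then v $ x else 0)"
proof -
  have "(enc_isometry d enc *\<^sub>v v) $ a = (\<Sum>x<d. enc_isometry d enc $$ (a, x) * v $ x)"
    using assms by (intro mat_vec_index) (auto simp: enc_isometry_def M_def)
  then show ?thesis using assms by (auto simp: enc_isometry_def M_def intro!: sum.cong)
qed

lemma J_embed_scatter:
  assumes v: "v \<in> carrier_vec d"
  shows "J_embed d enc v = scatter N slot1 {..<d} (($) v)"
proof (rule triple_vec_eqI[where m = 2 and M = M])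
  show "J_embed d enc v \<in> carrier_vec (2 * (M * M))"
  proof (rule carrier_vecI)
    have dim: "dim_vec (kron_vec u w) = dim_vec u * dim_vec w" for u w by (simp add: kron_vec_def)
    show "dim_vec (J_embed d enc v) = 2 * (M * M)"
      unfolding J_embed_def dim M_def by (simp add: enc_isometry_def)
  qed
  show "scatter N slot1 {..<d} (($) v) \<in> carrier_vec (2 * (M * M))" by (simp add: N_def)
  fix s a b assume sab: "s < (2 :: nat)" "a < M" "b < M"
  have less: "s * (M * M) + (a * M + b) < 2 * (M * M)" "a * M + b < M * M"
    using triple_index_less[OF sab] pair_index_less[OF sab(2,3)] by auto
  have "J_embed d enc v $ (s * (M * M) + (a * M + b))
      = (if s = 0 then 1 else 0) * ((enc_isometry d enc *\<^sub>v v) $ a * (if b = 0 then 1 else 0))"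
    using less sab unfolding J_embed_def kron_vec_def M_def[symmetric]
    by (simp add: enc_isometry_def M_def[symmetric] unit_vec_def)
  also have "\<dots> = (if s = 0 \<and> b = 0 then \<Sum>x<d. if a = enc x then v $ x else 0 else 0)"
    using enc_isometry_vec[OF v sab(2)] by simp
  also have "\<dots> = (\<Sum>x<d. if s * (M * M) + (a * M + b) = slot1 x then v $ x else 0)"
  proof (cases "s = 0 \<and> b = 0")
    case True
    then show ?thesis using M_pos by simp
  next
    case False
    \<comment> \<open>A nonzero signal qubit or a nonzero register B matches no slot, so both sides
      vanish.\<close>
    have "s * (M * M) + (a * M + b) \<noteq> slot1 x" if "x < d" for x
    proof
      assume eq: "s * (M * M) + (a * M + b) = slot1 x"
      have "slot1 x div (M * M) = 0" using slot1_less'[OF that] by simp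
      then have "s = 0" using pair_div_mod(1)[OF less(2), of s] unfolding eq[symmetric] by linarith
      moreover from this have "b = slot1 x mod M" using sab unfolding eq[symmetric] by simp
      ultimately show False using False by simp
    qed
    then have "(\<Sum>x<d. if s * (M * M) + (a * M + b) = slot1 x then v $ x else 0) = 0"
      by (intro sum.neutral) auto
    then show ?thesis unfolding if_not_P[OF False] by simp
  qed
  finally show "J_embed d enc v $ (s * (M * M) + (a * M + b))
      = scatter N slot1 {..<d} (($) v) $ (s * (M * M) + (a * M + b))"
    using less by (simp add: scatter_def N_def)
qed

abbreviation J :: "complex vec \<Rightarrow> complex vec" where "J \<equiv> J_embed d enc"

lemma J_carrier: "v \<in> carrier_vec d \<Longrightarrow> J v \<in> carrier_vec N"
  by (simp add: J_embed_scatter)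

lemma J_index: "v \<in> carrier_vec d \<Longrightarrow> x < d \<Longrightarrow> J v $ slot1 x = v $ x"
  using scatter_index[OF _ slot1_inj, of x N "($) v"] slot1_less by (simp add: J_embed_scatter)

lemma cinner_J: "w \<in> carrier_vec N \<Longrightarrow> v \<in> carrier_vec d \<Longrightarrow> w \<bullet>c J v = (\<Sum>x<d. w $ slot1 x * cnj (v $ x))"
  unfolding J_embed_scatter by (subst cinner_scatter) (auto simp: slot1_less)

lemma J_cinner: "v \<in> carrier_vec d \<Longrightarrow> w \<in> carrier_vec d \<Longrightarrow> J v \<bullet>c J w = v \<bullet>c w"
  by (simp add: cinner_J J_carrier J_index cinner_carrier[of _ d])

lemma J_smult: "v \<in> carrier_vec d \<Longrightarrow> J (c \<cdot>\<^sub>v v) = c \<cdot>\<^sub>v J v"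
  by (simp add: J_embed_scatter scatter_smult[symmetric]) (intro scatter_cong, simp)

lemma J_add: "v \<in> carrier_vec d \<Longrightarrow> w \<in> carrier_vec d \<Longrightarrow> J (v + w) = J v + J w"
  by (simp add: J_embed_scatter scatter_add[symmetric]) (intro scatter_cong, simp)

text \<open>J followed after its adjoint: the amplitudes in the slots are read off and embedded
  again. It depends on the encoding alone, so phases about it are fixed gates.\<close>

definition J_proj :: "complex vec \<Rightarrow> complex vec" where
  "J_proj w = J (vec d (\<lambda>x. w $ slot1 x))"

lemma J_proj_J: "v \<in> carrier_vec d \<Longrightarrow> J_proj (J v) = J v"
  unfolding J_proj_def by (rule arg_cong[where f = J]) (auto simp: J_index)

lemma orthproj_J_proj: "orthproj N J_proj"
  unfolding orthproj_def linop_def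
proof (intro conjI ballI allI)
  fix v w :: "complex vec" and c :: complex
  assume v: "v \<in> carrier_vec N" and w: "w \<in> carrier_vec N"
  show Jv: "J_proj v \<in> carrier_vec N" by (simp add: J_proj_def J_carrier)
  show "J_proj (v + w) = J_proj v + J_proj w"
    unfolding J_proj_def using v w slot1_less
    by (subst J_add[symmetric]) (auto intro!: arg_cong[where f = J])
  show "J_proj (c \<cdot>\<^sub>v v) = c \<cdot>\<^sub>v J_proj v"
    unfolding J_proj_def using v slot1_less
    by (subst J_smult[symmetric]) (auto intro!: arg_cong[where f = J])
  show "J_proj (J_proj v) = J_proj v"
    unfolding J_proj_def[of v] by (rule J_proj_J) simp
  have *: "J_proj u \<bullet>c J_proj u' = u \<bullet>c J_proj u'" if "u \<in> carrier_vec N" for u u'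
    unfolding J_proj_def using that by (simp add: cinner_J J_carrier J_index)
  have Jw: "J_proj w \<in> carrier_vec N" by (simp add: J_proj_def J_carrier)
  have "J_proj v \<bullet>c w = cnj (w \<bullet>c J_proj v)" by (rule cinner_commute[OF w Jv])
  also have "\<dots> = cnj (J_proj w \<bullet>c J_proj v)" using *[OF w] by simp
  also have "\<dots> = J_proj v \<bullet>c J_proj w" using cinner_commute[OF Jw Jv] by simp
  finally show "J_proj v \<bullet>c w = v \<bullet>c J_proj w" using *[OF v] by simp
qed

lemma J_proj_kernel:
  assumes t: "orthonormal d d t" and v: "v \<in> carrier_vec N" and orth: "\<And>j. j < d \<Longrightarrow> v \<bullet>c J (t j) = 0"
  shows "J_proj v = 0\<^sub>v N"
proof -
  let ?u = "vec d (\<lambda>x. v $ slot1 x)"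
  have "?u \<bullet>c t j = 0" if "j < d" for j
    using orth[OF that] orthonormalD(1)[OF t that] v by (simp add: cinner_J cinner_carrier[of _ d])
  then have "?u = 0\<^sub>v d" by (intro orthonormal_complete[OF t]) auto
  then have "J_proj v = J (0\<^sub>v d)" by (simp add: J_proj_def)
  also have "\<dots> = 0\<^sub>v N"
    by (simp add: J_embed_scatter, intro eq_vecI) (auto simp: scatter_def intro!: sum.neutral)
  finally show ?thesis .
qed

lemma kron_enc_vec:
  assumes w: "w \<in> carrier_vec (d * d)" and r: "r < M * M"
  shows "(kron_mat (enc_isometry d enc) (enc_isometry d enc) *\<^sub>v w) $ r
    = (\<Sum>x<d. \<Sum>y<d. if r = slot2 (x, y) then w $ (x * d + y) else 0)"
proof -
  let ?E = "enc_isometry d enc"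
  have E: "kron_mat ?E ?E \<in> carrier_mat (M * M) (d * d)"
    by (simp add: kron_mat_def enc_isometry_def M_def)
  have "(kron_mat ?E ?E *\<^sub>v w) $ r = (\<Sum>x<d. \<Sum>y<d. kron_mat ?E ?E $$ (r, x * d + y) * w $ (x * d + y))"
    unfolding mat_vec_index[OF E w r] sum_mult_split ..
  also have "\<dots> = (\<Sum>x<d. \<Sum>y<d. if r = slot2 (x, y) then w $ (x * d + y) else 0)"
  proof (intro sum.cong refl)
    fix x y assume xy: "x \<in> {..<d}" "y \<in> {..<d}"
    have rM: "r div M < M" "r mod M < M" using r M_pos by (auto simp: less_mult_imp_div_less)
    have "kron_mat ?E ?E $$ (r, x * d + y) = ?E $$ (r div M, x) * ?E $$ (r mod M, y)"
      using xy r pair_index_less[of x d y d] by (simp add: kron_mat_def enc_isometry_def M_def)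
    also have "\<dots> = (if r div M = enc x \<and> r mod M = enc y then 1 else 0)"
      using xy rM by (simp add: enc_isometry_def M_def)
    also have "(r div M = enc x \<and> r mod M = enc y) \<longleftrightarrow> r = slot2 (x, y)"
    proof
      assume h: "r div M = enc x \<and> r mod M = enc y"
      have "r = r div M * M + r mod M" by simp
      then show "r = slot2 (x, y)" using h by simp
    next
      assume "r = slot2 (x, y)"
      then show "r div M = enc x \<and> r mod M = enc y"
        using enc_less[of y] xy pair_div_mod[of "enc y" M "enc x"] by simp
    qed
    finally show "kron_mat ?E ?E $$ (r, x * d + y) * w $ (x * d + y)
      = (if r = slot2 (x, y) then w $ (x * d + y) else 0)" by simp
  qed
  finally show ?thesis .
qed

lemma kron_vec_unit_enc:
  assumes "x < d"
  shows "kron_vec (unit_vec M (enc x)) (unit_vec M 0) = unit_vec (M * M) (slot1 x)"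
proof (rule pair_vec_eqI[where m = M and n = M])
  fix a b assume ab: "a < M" "b < M"
  have "a * M + b = slot1 x \<longleftrightarrow> a = enc x \<and> b = 0"
  proof
    assume eq: "a * M + b = slot1 x"
    have "(a * M + b) div M = a" "(a * M + b) mod M = b" using ab by auto
    then show "a = enc x \<and> b = 0" using ab unfolding eq by auto
  qed simp
  then show "kron_vec (unit_vec M (enc x)) (unit_vec M 0) $ (a * M + b) = unit_vec (M * M) (slot1 x) $ (a * M + b)"
    using ab pair_index_less[OF ab] by (simp add: kron_vec_def unit_vec_def)
qed (auto simp: kron_vec_def)

definition query :: "complex mat \<Rightarrow> complex vec \<Rightarrow> complex vec" where
  "query Q u = kron_mat (1\<^sub>m 2) Q *\<^sub>v u"

definition query_adj :: "complex mat \<Rightarrow> complex vec \<Rightarrow> complex vec" where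
  "query_adj Q u = kron_mat (1\<^sub>m 2) (mat_adjoint Q) *\<^sub>v u"

context
  fixes P Q assumes Q: "chain_oracle d enc P Q"
begin

lemma Q_unitary: "unitary_mat (M * M) Q"
  using Q by (simp add: chain_oracle_def Let_def M_def)

lemma unipair_query: "unipair N (query Q) (query_adj Q)"
  unfolding query_def[abs_def] query_adj_def[abs_def] N_def by (rule unipair_kron_one[OF Q_unitary])

text \<open>These are the only columns of Q that the oracle condition determines; the others are
  constrained by unitarity alone.\<close>

lemma Q_column:
  assumes x: "x < d" and r: "r < M * M"
  shows "Q $$ (r, slot1 x) = (\<Sum>y<d. if r = slot2 (x, y) then complex_of_real (sqrt (P $$ (x, y))) else 0)"
proof -
  have Qc: "Q \<in> carrier_mat (M * M) (M * M)" using Q_unitary by (simp add: unitary_mat_def)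
  let ?w = "step_isometry d P *\<^sub>v unit_vec d x"
  have w: "?w \<in> carrier_vec (d * d)"
    by (rule mult_mat_vec_carrier[of _ _ d]) (simp_all add: step_isometry_def)
  have w_idx: "?w $ (x' * d + y) = (if x' = x then complex_of_real (sqrt (P $$ (x, y))) else 0)"
    if "x' < d" "y < d" for x' y
    using step_isometry_vec[OF unit_vec_carrier pair_index_less[OF that]] that x by auto
  have "Q $$ (r, slot1 x) = (Q *\<^sub>v unit_vec (M * M) (slot1 x)) $ r"
    using Qc r slot1_less'[OF x] by simp
  also have "\<dots> = (kron_mat (enc_isometry d enc) (enc_isometry d enc) *\<^sub>v ?w) $ r"
  proof -
    have "Q *\<^sub>v kron_vec (unit_vec M (enc x)) (unit_vec M 0)
        = kron_mat (enc_isometry d enc) (enc_isometry d enc) *\<^sub>v ?w"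
      using Q x unfolding chain_oracle_def Let_def M_def by blast
    then show ?thesis unfolding kron_vec_unit_enc[OF x] by (rule arg_cong)
  qed
  also have "\<dots> = (\<Sum>x'<d. \<Sum>y<d. if r = slot2 (x', y) then ?w $ (x' * d + y) else 0)"
    by (rule kron_enc_vec[OF w r])
  also have "\<dots> = (\<Sum>x'<d. if x' = x then \<Sum>y<d. if r = slot2 (x, y) then complex_of_real (sqrt (P $$ (x, y))) else 0 else 0)"
  proof (intro sum.cong refl)
    fix x' assume x': "x' \<in> {..<d}"
    show "(\<Sum>y<d. if r = slot2 (x', y) then ?w $ (x' * d + y) else 0)
      = (if x' = x then \<Sum>y<d. if r = slot2 (x, y) then complex_of_real (sqrt (P $$ (x, y))) else 0 else 0)"
      using x' by (cases "x' = x") (auto simp: w_idx simp del: index_mult_mat_vec intro!: sum.cong sum.neutral)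
  qed
  also have "\<dots> = (\<Sum>y<d. if r = slot2 (x, y) then complex_of_real (sqrt (P $$ (x, y))) else 0)"
    using x by simp
  finally show ?thesis .
qed

text \<open>An embedded vector is supported on the determined columns, so one query yields the
  encoded vector T v next to a zero signal qubit.\<close>

lemma query_J:
  assumes v: "v \<in> carrier_vec d"
  shows "query Q (J v) = scatter N slot2 ({..<d} \<times> {..<d})
    (\<lambda>p. complex_of_real (sqrt (P $$ p)) * v $ fst p)"
proof -
  let ?c = "\<lambda>p. complex_of_real (sqrt (P $$ p)) * v $ fst p"
  have Qc: "Q \<in> carrier_mat (M * M) (M * M)" using Q_unitary by (simp add: unitary_mat_def)
  have Jv: "J v \<in> carrier_vec (2 * (M * M))" using J_carrier[OF v] by (simp add: N_def)
  show ?thesis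
  proof (rule pair_vec_eqI[where m = 2 and n = "M * M"])
    show "query Q (J v) \<in> carrier_vec (2 * (M * M))"
      using linop_carrier[OF unipairD(1)[OF unipair_query] J_carrier[OF v]] by (simp add: N_def)
    show "scatter N slot2 ({..<d} \<times> {..<d}) ?c \<in> carrier_vec (2 * (M * M))"
      using scatter_carrier[of N] by (simp add: N_def)
    fix s r assume sr: "s < (2 :: nat)" "r < M * M"
    have slot_eq: "s * (M * M) + k = q \<longleftrightarrow> s = 0 \<and> k = q" if "q < M * M" "k < M * M" for k q
    proof
      assume eq: "s * (M * M) + k = q"
      have "(s * (M * M) + k) div (M * M) = s" by (rule pair_div_mod(1)[OF that(2)])
      then show "s = 0 \<and> k = q" using that eq by (auto simp: eq)
    qed simp
    have blk: "block (M * M) s (J v) $ k = (\<Sum>x<d. if s = 0 \<and> k = slot1 x then v $ x else 0)" if k: "k < M * M" for k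
    proof -
      have "block (M * M) s (J v) $ k = J v $ (s * (M * M) + k)" using k by (simp add: block_def)
      also have "\<dots> = (\<Sum>x<d. if s * (M * M) + k = slot1 x then v $ x else 0)"
        unfolding J_embed_scatter[OF v] using pair_index_less[OF sr(1) k] by (simp add: scatter_def N_def)
      also have "\<dots> = (\<Sum>x<d. if s = 0 \<and> k = slot1 x then v $ x else 0)"
        using slot_eq[OF slot1_less' k] by (intro sum.cong) auto
      finally show ?thesis .
    qed
    have "query Q (J v) $ (s * (M * M) + r) = (Q *\<^sub>v block (M * M) s (J v)) $ r"
      unfolding query_def block_kron_one[OF Qc Jv sr(1), symmetric] using sr by (simp add: block_def)
    also have "\<dots> = (\<Sum>k<M * M. Q $$ (r, k) * (\<Sum>x<d. if s = 0 \<and> k = slot1 x then v $ x else 0))"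
      unfolding mat_vec_index[OF Qc block_carrier sr(2)] by (intro sum.cong refl) (simp add: blk)
    also have "\<dots> = (\<Sum>k<M * M. \<Sum>x<d. if k = slot1 x then (if s = 0 then Q $$ (r, slot1 x) * v $ x else 0) else 0)"
      unfolding sum_distrib_left by (intro sum.cong refl) auto
    also have "\<dots> = (\<Sum>x<d. \<Sum>k<M * M. if k = slot1 x then (if s = 0 then Q $$ (r, slot1 x) * v $ x else 0) else 0)"
      by (rule sum.swap)
    also have "\<dots> = (\<Sum>x<d. if s = 0 then Q $$ (r, slot1 x) * v $ x else 0)"
      using slot1_less' by (intro sum.cong refl) simp
    also have "\<dots> = (\<Sum>x<d. \<Sum>y<d. if s * (M * M) + r = slot2 (x, y) then ?c (x, y) else 0)"
    proof (intro sum.cong refl)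
      fix x assume "x \<in> {..<d}"
      then have x: "x < d" by simp
      have "(\<Sum>y<d. if s * (M * M) + r = slot2 (x, y) then ?c (x, y) else 0)
          = (\<Sum>y<d. if s = 0 \<and> r = slot2 (x, y) then ?c (x, y) else 0)"
      proof (intro sum.cong refl)
        fix y assume "y \<in> {..<d}"
        then have "s * (M * M) + r = slot2 (x, y) \<longleftrightarrow> s = 0 \<and> r = slot2 (x, y)"
          using slot_eq[OF slot2_less[of "(x, y)"] sr(2)] x by blast
        then show "(if s * (M * M) + r = slot2 (x, y) then ?c (x, y) else 0)
          = (if s = 0 \<and> r = slot2 (x, y) then ?c (x, y) else 0)" by presburger
      qed
      then show "(if s = 0 then Q $$ (r, slot1 x) * v $ x else 0)
          = (\<Sum>y<d. if s * (M * M) + r = slot2 (x, y) then ?c (x, y) else 0)"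
        using Q_column[OF x sr(2)] by (auto simp: sum_distrib_right intro!: sum.cong)
    qed
    also have "\<dots> = scatter N slot2 ({..<d} \<times> {..<d}) ?c $ (s * (M * M) + r)"
      using pair_index_less[OF sr] unfolding sum.cartesian_product
      by (simp add: scatter_def N_def) (auto intro!: sum.cong)
    finally show "query Q (J v) $ (s * (M * M) + r) = scatter N slot2 ({..<d} \<times> {..<d}) ?c $ (s * (M * M) + r)" .
  qed
qed

text \<open>The identity T' S T = D, carried out on registers and oracle.\<close>

lemma cinner_swap_query_J:
  assumes v: "v \<in> carrier_vec d" and w: "w \<in> carrier_vec d"
  shows "reg_swap 2 M (query Q (J v)) \<bullet>c query Q (J w) = discriminant d P v \<bullet>c w"
proof -
  let ?A = "{..<d} \<times> {..<d}"
  let ?c = "\<lambda>v p. complex_of_real (sqrt (P $$ p)) * v $ fst p"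
  have less: "slot2 p < N" if "p \<in> ?A" for p using slot2_less[OF that] by (simp add: N_def)
  have "reg_swap 2 M (query Q (J v)) \<bullet>c query Q (J w)
      = (\<Sum>p\<in>?A. reg_swap 2 M (query Q (J v)) $ slot2 p * cnj (?c w p))"
    unfolding query_J[OF w] using less reg_swap_carrier[of 2 M] by (intro cinner_scatter) (auto simp: N_def)
  also have "\<dots> = (\<Sum>(x, y)\<in>?A. ?c v (y, x) * cnj (?c w (x, y)))"
  proof (intro sum.cong refl)
    fix p assume p: "p \<in> ?A"
    obtain x y where xy: "p = (x, y)" by force
    have "reg_swap 2 M (query Q (J v)) $ slot2 p = query Q (J v) $ slot2 (y, x)"
      using reg_swap_index[of 0 2 "enc x" M "enc y"] enc_less p xy by simp
    also have "\<dots> = ?c v (y, x)"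
      unfolding query_J[OF v] using p xy less by (intro scatter_index slot2_inj) auto
    finally show "reg_swap 2 M (query Q (J v)) $ slot2 p * cnj (?c w p)
        = (case p of (x, y) \<Rightarrow> ?c v (y, x) * cnj (?c w (x, y)))" using xy by simp
  qed
  also have "\<dots> = discriminant d P v \<bullet>c w"
    unfolding cinner_discriminant[OF v w] sum.cartesian_product by simp
  finally show ?thesis .
qed

text \<open>Source of the singular values: the symmetric projector, conjugated by the oracle,
  compresses to (1 + D) / 2 on the range of J.\<close>

lemma gram_walk:
  assumes v: "v \<in> carrier_vec d" and w: "w \<in> carrier_vec d"
  shows "(J v - query_adj Q (antisym_proj 2 M (query Q (J v)))) \<bullet>c J w
    = (v \<bullet>c w + discriminant d P v \<bullet>c w) / 2"
proof -
  let ?K = "query Q" and ?K' = "query_adj Q"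
  note U = unipair_query
  note Jv = J_carrier[OF v] and Jw = J_carrier[OF w]
  note Kv = linop_carrier[OF unipairD(1)[OF U] Jv] and Kw = linop_carrier[OF unipairD(1)[OF U] Jw]
  have S: "reg_swap 2 M (?K (J v)) \<in> carrier_vec N" unfolding N_def by (rule reg_swap_carrier)
  have Ac: "antisym_proj 2 M (?K (J v)) \<in> carrier_vec N" unfolding antisym_proj_def using S Kv by simp
  have "?K' (antisym_proj 2 M (?K (J v))) \<bullet>c J w = antisym_proj 2 M (?K (J v)) \<bullet>c ?K (J w)"
    by (rule unipairD(5)[OF unipair_sym[OF U] Ac Jw])
  also have "\<dots> = (?K (J v) \<bullet>c ?K (J w) - reg_swap 2 M (?K (J v)) \<bullet>c ?K (J w)) / 2"
    unfolding antisym_proj_def cinner_smult_left[OF minus_carrier_vec[OF Kv S] Kw]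
      cinner_diff_left[OF Kv S Kw] by simp
  also have "?K (J v) \<bullet>c ?K (J w) = v \<bullet>c w"
    unfolding unipair_cinner[OF U Jv Jw] by (rule J_cinner[OF v w])
  also have "reg_swap 2 M (?K (J v)) \<bullet>c ?K (J w) = discriminant d P v \<bullet>c w"
    by (rule cinner_swap_query_J[OF v w])
  finally have "?K' (antisym_proj 2 M (?K (J v))) \<bullet>c J w = (v \<bullet>c w - discriminant d P v \<bullet>c w) / 2" .
  then show ?thesis
    using Jv Jw linop_carrier[OF unipairD(2)[OF U] Ac] J_cinner[OF v w] by (simp add: field_simps)
qed

end

end

section \<open>Circuits\<close>

definition run_gates :: "(nat \<Rightarrow> complex mat) \<Rightarrow> circuit \<Rightarrow> complex vec \<Rightarrow> complex vec" where
  "run_gates Q c = fold (\<lambda>g v. gate_mat 1 Q g *\<^sub>v v) c"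

lemma run_gates_append: "run_gates Q (c @ c') v = run_gates Q c' (run_gates Q c v)"
  and run_gates_Cons: "run_gates Q (g # c) v = run_gates Q c (gate_mat 1 Q g *\<^sub>v v)"
  and run_gates_Nil: "run_gates Q [] v = v"
  by (simp_all add: run_gates_def)

lemma query_count_append: "query_count (c @ c') = query_count c + query_count c'"
  by (simp add: query_count_def)

lemma query_count_gate: "query_count [] = 0" "query_count (Fixed U # c) = query_count c"
  "query_count (Query i # c) = Suc (query_count c)" "query_count (Query_Adj i # c) = Suc (query_count c)"
  by (simp_all add: query_count_def)

lemma circuit_ok_append: "circuit_ok w d l (c @ c') \<longleftrightarrow> circuit_ok w d l c \<and> circuit_ok w d l c'"
  by (auto simp: circuit_ok_def)

text \<open>Letters are exchanged one at a time. The actual letters that follow are unitary and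
  transport each error unchanged; the ideal letters before keep the state in R, so the error bound
  is required on R only.\<close>

lemma hybrid_bound:
  fixes \<eta> :: real
  assumes A: "\<And>s. s \<in> set W \<Longrightarrow> \<exists>g. unipair n (A s) g"
    and I: "\<And>s v. s \<in> set W \<Longrightarrow> v \<in> R \<Longrightarrow> I s v \<in> R" and R: "R \<subseteq> carrier_vec n"
    and err: "\<And>s v. s \<in> set W \<Longrightarrow> v \<in> R \<Longrightarrow> vnorm (A s v - I s v) \<le> \<eta>"
    and v: "v \<in> R"
  shows "vnorm (fold A W v - fold I W v) \<le> length W * \<eta>"
  using A I err v
proof (induction W arbitrary: v)
  case Nil
  have "v - v = 0\<^sub>v n" using Nil(4) R by auto
  then show ?case using vnorm_eq_0[of "0\<^sub>v n" n] by simp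
next
  case (Cons s W)
  have "\<exists>g. unipair n (fold A W) g" using Cons.prems(1)
  proof (induction W)
    case Nil
    show ?case using unipair_id by (auto simp: id_def)
  next
    case (Cons s' W)
    obtain f where f: "unipair n (fold A W) f" using Cons by auto
    obtain g where g: "unipair n (A s') g" using Cons(2)[of s'] by auto
    show ?case using unipair_compose[OF g f] by (auto simp: comp_def)
  qed
  then obtain g where g: "unipair n (fold A W) g" by blast
  obtain h where h: "unipair n (A s) h" using Cons.prems(1)[of s] by auto
  note L = unipairD(1)[OF g]
  have Iv: "I s v \<in> R" using Cons.prems(2)[of s v] Cons.prems(4) by simp
  have c: "v \<in> carrier_vec n" "I s v \<in> carrier_vec n" using Iv Cons.prems(4) R by auto
  have Av: "A s v \<in> carrier_vec n" by (rule linop_carrier[OF unipairD(1)[OF h] c(1)])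
  have "fold I W' u \<in> R" if "u \<in> R" "set W' \<subseteq> set (s # W)" for W' u
    using that Cons.prems(2) by (induction W' arbitrary: u) auto
  from this[OF Iv, of W] R have fI: "fold I W (I s v) \<in> carrier_vec n" by auto
  have "vnorm (fold A W (A s v) - fold I W (I s v))
      \<le> vnorm (fold A W (A s v) - fold A W (I s v)) + vnorm (fold A W (I s v) - fold I W (I s v))"
    by (rule vnorm_triangle_diff[OF linop_carrier[OF L Av] linop_carrier[OF L c(2)] fI])
  also have "fold A W (A s v) - fold A W (I s v) = fold A W (A s v - I s v)"
    by (rule linop_diff[OF L Av c(2), symmetric])
  also have "vnorm (fold A W (A s v - I s v)) = vnorm (A s v - I s v)"
    using Av c by (intro unipair_vnorm[OF g]) auto
  also have "\<dots> \<le> \<eta>" using Cons.prems(3)[of s v] Cons.prems(4) by simp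
  also have "vnorm (fold A W (I s v) - fold I W (I s v)) \<le> length W * \<eta>"
    using Cons.prems Iv by (intro Cons.IH) auto
  finally show ?case by (simp add: algebra_simps)
qed

section \<open>Construction of the annealing circuit and its query count\<close>

context register_encoding
begin

text \<open>A letter \<open>True\<close> costs a query and an adjoint query; a letter
  \<open>False\<close> is a fixed gate.\<close>

definition phase_gates :: "nat \<Rightarrow> bool \<times> real \<Rightarrow> circuit" where
  "phase_gates i s = (if fst s
     then [Query i, Fixed (opmat N (phase (antisym_proj 2 M) (snd s))), Query_Adj i]
     else [Fixed (opmat N (phase J_proj (snd s)))])"

definition word_gates :: "nat \<Rightarrow> (bool \<times> real) list \<Rightarrow> circuit" where
  "word_gates i W = concat (map (phase_gates i) W)"

text \<open>The word, a phase about the symmetric subspace as seen through the oracle, and the word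
  undone: the operator analysed in \<open>approximate_reflection\<close>.\<close>

definition reflection_gates :: "nat \<Rightarrow> (bool \<times> real) list \<Rightarrow> real \<Rightarrow> circuit" where
  "reflection_gates i W \<phi> = word_gates i W @
     [Query i, Fixed (opmat N (phase (\<lambda>u. u - antisym_proj 2 M u) \<phi>)), Query_Adj i] @
     word_gates i (inv_word W)"

text \<open>In the outer word, \<open>True\<close> stands for the next Gibbs state and
  \<open>False\<close> for the current one; every letter becomes an approximate phase built from the
  inner word W.\<close>

definition stage_gates :: "nat \<Rightarrow> (bool \<times> real) list \<Rightarrow> (bool \<times> real) list \<Rightarrow> circuit" where
  "stage_gates i W V = concat (map (\<lambda>s. reflection_gates (if fst s then Suc i else i) W (snd s)) V)"

definition initial_state :: "complex vec" where
  "initial_state = J (qsample d (\<lambda>_. 1 / real d))"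

text \<open>At inverse temperature 0 the Gibbs state is uniform, so its preparation depends on d and
  the encoding only and costs no query.\<close>

definition initial_gate :: gate where
  "initial_gate = Fixed (SOME U. unitary_mat N U \<and> U *\<^sub>v unit_vec N 0 = initial_state)"

definition anneal_circuit :: "nat \<Rightarrow> (bool \<times> real) list \<Rightarrow> (bool \<times> real) list \<Rightarrow> circuit" where
  "anneal_circuit l W V = initial_gate # concat (map (\<lambda>i. stage_gates i W V) [0..<l])"

lemma N_eq: "2 ^ 1 * (2 ^ reg_qubits d * 2 ^ reg_qubits d) = N"
  by (simp add: N_def M_def)

lemma N_pos: "0 < N" using M_pos by (simp add: N_def)

lemma orthproj_antisym_N: "orthproj N (antisym_proj 2 M)"
  unfolding N_def by (rule orthproj_antisym)

lemma initial_gate: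
  assumes "0 < d"
  shows "\<exists>U. initial_gate = Fixed U \<and> unitary_mat N U \<and> U *\<^sub>v unit_vec N 0 = initial_state"
proof -
  have q: "vnorm (qsample d (\<lambda>_. 1 / real d)) = 1" using assms by (intro vnorm_qsample) auto
  have "vnorm initial_state = 1"
    unfolding initial_state_def using vnorm_eqI[OF J_cinner[OF qsample_carrier qsample_carrier]] q by simp
  then have "\<exists>U. unitary_mat N U \<and> U *\<^sub>v unit_vec N 0 = initial_state"
    using N_pos by (intro exists_unitary_first_column) (auto simp: initial_state_def J_carrier)
  from someI_ex[OF this] show ?thesis unfolding initial_gate_def by blast
qed

lemma query_count_word: "query_count (word_gates i W) = 2 * length (filter fst W)"
  by (induction W) (auto simp: word_gates_def phase_gates_def query_count_append query_count_gate)

text \<open>The word and its inverse contribute 2 queries per letter \<open>True\<close>, the phase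
  between them 2 more.\<close>

lemma query_count_reflection:
  "query_count (reflection_gates i (ampl_word \<phi>s) \<phi>) = 2 * 3 ^ length \<phi>s"
  unfolding filter_ampl_word[symmetric]
  by (simp add: reflection_gates_def query_count_append query_count_gate query_count_word filter_inv_word)

lemma query_count_stage:
  "query_count (stage_gates i (ampl_word \<phi>s) V) = length V * (2 * 3 ^ length \<phi>s)"
  by (induction V) (auto simp: stage_gates_def query_count_append query_count_gate query_count_reflection)

lemma query_count_anneal:
  "query_count (anneal_circuit l (ampl_word \<phi>s) V) = l * (length V * (2 * 3 ^ length \<phi>s))"
proof -
  have "query_count (concat (map (\<lambda>i. stage_gates i (ampl_word \<phi>s) V) [0..<l])) = l * (length V * (2 * 3 ^ length \<phi>s))"
    by (induction l) (auto simp: query_count_append query_count_stage query_count_gate)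
  then show ?thesis by (simp add: anneal_circuit_def initial_gate_def query_count_gate)
qed

lemma gate_ok_phase: "orthproj N P \<Longrightarrow> gate_ok 1 d l (Fixed (opmat N (phase P \<phi>)))"
  unfolding gate_ok.simps N_eq by (rule unitary_opmat[OF unipair_phase])

lemma circuit_ok_word: "i \<le> l \<Longrightarrow> circuit_ok 1 d l (word_gates i W)"
  using gate_ok_phase[OF orthproj_antisym_N] gate_ok_phase[OF orthproj_J_proj]
  by (auto simp: circuit_ok_def word_gates_def phase_gates_def simp del: gate_ok.simps(1))

lemma circuit_ok_reflection: "i \<le> l \<Longrightarrow> circuit_ok 1 d l (reflection_gates i W \<phi>)"
  using gate_ok_phase[OF orthproj_compl[OF orthproj_antisym_N], of l \<phi>] circuit_ok_word[of i l]
  unfolding reflection_gates_def circuit_ok_append by (auto simp: circuit_ok_def simp del: gate_ok.simps(1))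

lemma circuit_ok_stage: "i < l \<Longrightarrow> circuit_ok 1 d l (stage_gates i W V)"
  using circuit_ok_reflection[of i l W] circuit_ok_reflection[of "Suc i" l W]
  by (auto simp: circuit_ok_def stage_gates_def)

lemma circuit_ok_anneal:
  assumes "0 < d" shows "circuit_ok 1 d l (anneal_circuit l W V)"
proof -
  obtain U where U: "initial_gate = Fixed U" "unitary_mat N U" using initial_gate[OF assms] by blast
  then have "gate_ok 1 d l initial_gate" unfolding U(1) gate_ok.simps N_eq by simp
  then show ?thesis using circuit_ok_stage[of _ l W V] by (auto simp: circuit_ok_def anneal_circuit_def)
qed

section \<open>Action of the gate sequences on states\<close>

lemma gate_fixed_phase:
  "orthproj N P \<Longrightarrow> v \<in> carrier_vec N \<Longrightarrow> gate_mat 1 Q (Fixed (opmat N (phase P \<phi>))) *\<^sub>v v = phase P \<phi> v"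
  by (simp add: opmat_vec linop_phase orthprojD)

lemma gate_query: "gate_mat 1 Q (Query i) *\<^sub>v v = query (Q i) v"
  "gate_mat 1 Q (Query_Adj i) *\<^sub>v v = query_adj (Q i) v"
  by (simp_all add: query_def query_adj_def)

text \<open>The pair of projectors for \<open>nested_amplification\<close>: \<open>False\<close> is
  the range of J, \<open>True\<close> the antisymmetric subspace pulled back through the
  oracle.\<close>

definition walk_proj :: "complex mat \<Rightarrow> bool \<Rightarrow> complex vec \<Rightarrow> complex vec" where
  "walk_proj Q b = (if b then (\<lambda>v. query_adj Q (antisym_proj 2 M (query Q v))) else J_proj)"

context
  fixes P and Q :: "nat \<Rightarrow> complex mat" and l i :: nat
  assumes oracles: "\<And>i. i \<le> l \<Longrightarrow> chain_oracle d enc (P i) (Q i)"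
begin

lemma unipair_gates:
  assumes "circuit_ok 1 d l c"
  shows "\<exists>g. unipair N (run_gates Q c) g"
  using assms
proof (induction c)
  case Nil
  show ?case using unipair_id by (auto simp: run_gates_def id_def)
next
  case (Cons g c)
  then obtain h where h: "unipair N (run_gates Q c) h" by (auto simp: circuit_ok_def)
  have "gate_ok 1 d l g" using Cons.prems by (simp add: circuit_ok_def)
  then have "\<exists>f. unipair N (\<lambda>v. gate_mat 1 Q g *\<^sub>v v) f"
  proof (cases g)
    case (Fixed U)
    then have "unitary_mat N U" using \<open>gate_ok 1 d l g\<close> unfolding Fixed gate_ok.simps N_eq by simp
    then show ?thesis using unipair_unitary_mat Fixed by auto
  next
    case (Query j)
    then have "j \<le> l" using \<open>gate_ok 1 d l g\<close> by simp
    from unipair_query[OF oracles[OF this]] show ?thesis unfolding Query gate_query by blast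
  next
    case (Query_Adj j)
    then have "j \<le> l" using \<open>gate_ok 1 d l g\<close> by simp
    from unipair_sym[OF unipair_query[OF oracles[OF this]]] show ?thesis unfolding Query_Adj gate_query by blast
  qed
  then obtain f where "unipair N (\<lambda>v. gate_mat 1 Q g *\<^sub>v v) f" by blast
  from unipair_compose[OF this h] show ?case unfolding run_gates_Cons[abs_def] by blast
qed

context
  assumes i: "i \<le> l"
begin

lemma orthproj_walk_proj: "orthproj N (walk_proj (Q i) b)"
  using orthproj_conjugate[OF orthproj_antisym_N unipair_query[OF oracles[OF i]]] orthproj_J_proj
  by (simp add: walk_proj_def)

lemma run_phase_gates:
  assumes v: "v \<in> carrier_vec N"
  shows "run_gates Q (phase_gates i s) v = phase (walk_proj (Q i) (fst s)) (snd s) v"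
proof (cases "fst s")
  case True
  note U = unipair_query[OF oracles[OF i]]
  have Kv: "query (Q i) v \<in> carrier_vec N" by (rule linop_carrier[OF unipairD(1)[OF U] v])
  show ?thesis
    using True phase_conjugate[OF orthprojD(1)[OF orthproj_antisym_N] U v]
    unfolding phase_gates_def if_P[OF True] run_gates_Cons run_gates_Nil gate_query
        gate_fixed_phase[OF orthproj_antisym_N Kv] by (simp add: walk_proj_def)
next
  case False
  then show ?thesis
    unfolding phase_gates_def if_not_P[OF False] run_gates_Cons run_gates_Nil
        gate_fixed_phase[OF orthproj_J_proj v] by (simp add: walk_proj_def)
qed

lemma run_word_gates:
  "v \<in> carrier_vec N \<Longrightarrow> run_gates Q (word_gates i W) v = run_word (walk_proj (Q i)) W v"
proof (induction W arbitrary: v)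
  case Nil
  then show ?case by (simp add: word_gates_def run_gates_Nil run_word_Nil)
next
  case (Cons s W)
  have "phase (walk_proj (Q i) (fst s)) (snd s) v \<in> carrier_vec N"
    by (rule linop_carrier[OF linop_phase[OF orthprojD(1)[OF orthproj_walk_proj]] Cons.prems])
  from Cons.IH[OF this] show ?case
    using run_phase_gates[OF Cons.prems] by (simp add: word_gates_def run_gates_append run_word_Cons)
qed

lemma run_reflection_gates:
  assumes v: "v \<in> carrier_vec N"
  shows "run_gates Q (reflection_gates i W \<phi>) v = run_word (walk_proj (Q i)) (inv_word W)
    (phase (\<lambda>v. v - walk_proj (Q i) True v) \<phi> (run_word (walk_proj (Q i)) W v))"
proof -
  note U = unipair_query[OF oracles[OF i]]
  note C = orthproj_compl[OF orthproj_antisym_N]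
  define u where "u = run_word (walk_proj (Q i)) W v"
  have u: "u \<in> carrier_vec N" unfolding u_def
    by (rule linop_carrier[OF unipairD(1)[OF unipair_run_word[OF orthproj_walk_proj]] v])
  have Ku: "query (Q i) u \<in> carrier_vec N" by (rule linop_carrier[OF unipairD(1)[OF U] u])
  have au: "antisym_proj 2 M (query (Q i) u) \<in> carrier_vec N"
    by (rule linop_carrier[OF orthprojD(1)[OF orthproj_antisym_N] Ku])
  have "query_adj (Q i) (query (Q i) u - antisym_proj 2 M (query (Q i) u)) = u - walk_proj (Q i) True u"
    using linop_diff[OF unipairD(2)[OF U] Ku au] unipairD(3)[OF U u] by (simp add: walk_proj_def)
  then have eq: "query_adj (Q i) (phase (\<lambda>u. u - antisym_proj 2 M u) \<phi> (query (Q i) u))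
      = phase (\<lambda>v. v - walk_proj (Q i) True v) \<phi> u"
    unfolding phase_conjugate[OF orthprojD(1)[OF C] U u] by (simp add: phase_def)
  have "phase (\<lambda>v. v - walk_proj (Q i) True v) \<phi> u \<in> carrier_vec N"
    by (rule linop_carrier[OF linop_phase[OF orthprojD(1)[OF orthproj_compl[OF orthproj_walk_proj]]] u])
  note w = run_word_gates[OF this]
  show ?thesis
    unfolding reflection_gates_def run_gates_append run_word_gates[OF v] u_def[symmetric]
      run_gates_Cons run_gates_Nil gate_query gate_fixed_phase[OF C Ku] eq w ..
qed

text \<open>The walk phases of the excited eigenvectors are at least \<open>\<Delta>\<close>, so their singular values are at
  most \<open>cos (\<Delta> / 2)\<close>.\<close>

lemma reflection_error:
  assumes chain: "reversible_ergodic_chain d \<pi> (P i)"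
    and \<pi>: "\<And>x. x < d \<Longrightarrow> 0 < \<pi> x" "(\<Sum>x<d. \<pi> x) = 1" and d: "0 < d"
    and \<Delta>: "0 < \<Delta>" "\<Delta> \<le> pi" "\<Delta> \<le> phase_gap (szegedy_walk d (P i))"
    and g: "1 \<le> g" "g * cos (\<Delta> / 2) \<le> 1"
    and v: "v \<in> carrier_vec N" "J_proj v = v"
  defines "\<tau> \<equiv> J (qsample d \<pi>)"
  shows "vnorm (run_gates Q (reflection_gates i (ampl_word (chebyshev_angles g m)) \<phi>) v
      - phase (\<lambda>v. (v \<bullet>c \<tau>) \<cdot>\<^sub>v \<tau>) \<phi> v) \<le> 2 / chebyshev3 m g * vnorm v"
proof -
  have st: "stochastic d (P i)" using chain by (simp add: reversible_ergodic_chain_def)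
  obtain t l' where t: "orthonormal d d t" "t 0 = qsample d \<pi>"
      "\<forall>j<d. discriminant d (P i) (t j) = complex_of_real (l' j) \<cdot>\<^sub>v t j" "l' 0 = 1"
      "\<forall>j<d. j \<noteq> 0 \<longrightarrow> - 1 \<le> l' j \<and> l' j < 1"
    using discriminant_eigenbasis[OF chain \<pi> d] by blast
  note tc = orthonormalD(1)[OF t(1)]
  have l1: "- 1 \<le> l' j" if "j < d" for j using t(4,5) that by (cases "j = 0") auto
  \<comment> \<open>For l' j = cos theta this is cos (theta / 2), the singular value belonging to t
    j.\<close>
  define x where "x j = sqrt ((1 + l' j) / 2)" for j
  have x2: "(x j)\<^sup>2 = (1 + l' j) / 2" if "j < d" for j
    using l1[OF that] by (simp add: x_def)
  interpret nested_amplification N d "walk_proj (Q i)" "\<lambda>j. J (t j)" x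
  proof
    show "orthproj N (walk_proj (Q i) b)" for b by (rule orthproj_walk_proj)
    show "orthonormal N d (\<lambda>j. J (t j))"
      using orthonormalD(2)[OF t(1)] tc by (auto simp: orthonormal_def J_carrier J_cinner)
    show "walk_proj (Q i) False (J (t j)) = J (t j)" if "j < d" for j
      using J_proj_J[OF tc[OF that]] by (simp add: walk_proj_def)
    show "walk_proj (Q i) False v = 0\<^sub>v N" if "v \<in> carrier_vec N" "\<And>j. j < d \<Longrightarrow> v \<bullet>c J (t j) = 0" for v
      using J_proj_kernel[OF t(1) that] by (simp add: walk_proj_def)
    show "(J (t a) - walk_proj (Q i) True (J (t a))) \<bullet>c J (t b) = (if a = b then complex_of_real ((x a)\<^sup>2) else 0)"
      if ab: "a < d" "b < d" for a b
    proof -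
      have "(J (t a) - walk_proj (Q i) True (J (t a))) \<bullet>c J (t b)
          = (t a \<bullet>c t b + complex_of_real (l' a) * (t a \<bullet>c t b)) / 2"
        using gram_walk[OF oracles[OF i] tc[OF ab(1)] tc[OF ab(2)]] t(3) ab
          cinner_smult_left[OF tc[OF ab(1)] tc[OF ab(2)]] by (simp add: walk_proj_def)
      then show ?thesis unfolding orthonormalD(2)[OF t(1) ab] x2[OF ab(1)]
        by (cases "a = b") simp_all
    qed
  qed
  have small: "\<bar>ampl_factor (chebyshev_angles g m) (x j) * x j\<bar> \<le> 1 / chebyshev3 m g" if j: "j < d" "j \<noteq> 0" for j
  proof (rule ampl_factor_chebyshev_le[OF g(1)])
    have lj: "- 1 \<le> l' j" "l' j < 1" using t(5) j by auto
    have "t j \<noteq> 0\<^sub>v d" using orthonormalD(3)[OF t(1) j(1)] vnorm_eq_0[OF tc[OF j(1)]] by auto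
    then have "phase_gap (szegedy_walk d (P i)) \<le> arccos (l' j)"
      using phase_gap_bounds(2)[OF st tc[OF j(1)] _ _ lj] t(3) j by blast
    then have "cos (arccos (l' j)) \<le> cos \<Delta>"
      using \<Delta> arccos_ubound[of "l' j"] lj by (intro cos_monotone_0_pi_le) auto
    then have "l' j \<le> cos \<Delta>" using lj by simp
    moreover have "cos \<Delta> = 2 * (cos (\<Delta> / 2))\<^sup>2 - 1" using cos_double_cos[of "\<Delta> / 2"] by simp
    ultimately have "(x j)\<^sup>2 \<le> (cos (\<Delta> / 2))\<^sup>2" unfolding x2[OF j(1)] by simp
    moreover have c0: "0 \<le> cos (\<Delta> / 2)" using \<Delta> by (intro cos_ge_zero) auto
    ultimately have "x j \<le> cos (\<Delta> / 2)" by (rule power2_le_imp_le)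
    moreover have "0 \<le> x j" using lj by (simp add: x_def)
    ultimately have "g * x j \<le> g * cos (\<Delta> / 2)" "0 \<le> g * x j" using g by (auto intro: mult_left_mono)
    then show "\<bar>g * x j\<bar> \<le> 1" using g(2) by linarith
  qed
  \<comment> \<open>The Gibbs state has singular value 1, so the rescaled Chebyshev polynomial
    leaves it untouched.\<close>
  have "x 0 = 1" using t(4) by (simp add: x_def)
  from approximate_reflection[OF d this ampl_factor_chebyshev_1[OF g(1)] _ small v(1), of \<phi>] v(2)
  show ?thesis
    unfolding run_reflection_gates[OF v(1)] \<tau>_def t(2)
    using chebyshev3_ge_1[OF g(1), of m] by (simp add: walk_proj_def)
qed

end

end

end

section \<open>The annealing circuit\<close>

lemma run_gates_concat: "run_gates Q (concat (map f V)) v = fold (\<lambda>s. run_gates Q (f s)) V v"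
  by (induction V arbitrary: v) (simp_all add: run_gates_Nil run_gates_append)

context register_encoding
begin

lemma vnorm_J: "v \<in> carrier_vec d \<Longrightarrow> vnorm (J v) = vnorm v"
  by (intro vnorm_eqI J_cinner)

text \<open>Two errors add up. The outer word has fewer than \<open>3 ^ a\<close> letters, each off
  by at most 2 / T (g). With exact phases the residue would be x to the power \<open>3 ^ a\<close>,
  where x^2 = 1 - |overlap|^2 \<le> 14 / 15.\<close>

lemma stage_error:
  fixes a m :: nat
  assumes oracles: "\<And>i. i \<le> l \<Longrightarrow> chain_oracle d enc (P i) (Q i)"
    and chain: "\<And>i. i \<le> l \<Longrightarrow> reversible_ergodic_chain d (\<mu> i) (P i)"
    and \<mu>: "\<And>i x. x < d \<Longrightarrow> 0 < \<mu> i x" "\<And>i. (\<Sum>x<d. \<mu> i x) = (1 :: real)" and d: "0 < d"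
    and \<Delta>: "0 < \<Delta>" "\<Delta> \<le> pi" "\<And>i. i \<le> l \<Longrightarrow> \<Delta> \<le> phase_gap (szegedy_walk d (P i))"
    and g: "1 \<le> g" "g * cos (\<Delta> / 2) \<le> 1"
    and i: "i < l"
    and overlap: "(cmod (qsample d (\<mu> i) \<bullet>c qsample d (\<mu> (Suc i))))\<^sup>2 \<ge> 1 / 15"
  defines "V \<equiv> ampl_word (replicate a (pi / 3))"
    and "\<tau> \<equiv> \<lambda>i. J (qsample d (\<mu> i))"
  shows "\<exists>c. cmod c \<le> 1 \<and> vnorm (run_gates Q (stage_gates i (ampl_word (chebyshev_angles g m)) V) (\<tau> i) - c \<cdot>\<^sub>v \<tau> (Suc i))
     \<le> 3 ^ a * (2 / chebyshev3 m g) + sqrt (14 / 15) ^ 3 ^ a"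
proof -
  define W where "W = ampl_word (chebyshev_angles g m)"
  define \<eta> where "\<eta> = 2 / chebyshev3 m g"
  have \<eta>: "0 \<le> \<eta>" using chebyshev3_ge_1[OF g(1), of m] by (simp add: \<eta>_def)
  have q1: "vnorm (qsample d (\<mu> j)) = 1" for j
    using \<mu> by (intro vnorm_qsample) (auto simp: less_imp_le)
  have \<tau>: "\<tau> j \<in> carrier_vec N" "vnorm (\<tau> j) = 1" "J_proj (\<tau> j) = \<tau> j" for j
    by (simp_all add: \<tau>_def J_carrier vnorm_J q1 J_proj_J)
  define I where "I b v = (if b then (v \<bullet>c \<tau> (Suc i)) \<cdot>\<^sub>v \<tau> (Suc i) else (v \<bullet>c \<tau> i) \<cdot>\<^sub>v \<tau> i)" for b v
  have I_eq: "I b = (\<lambda>v. (v \<bullet>c \<tau> (if b then Suc i else i)) \<cdot>\<^sub>v \<tau> (if b then Suc i else i))" for b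
    by (auto simp: I_def)
  have I_proj: "orthproj N (I b)" for b unfolding I_eq by (rule orthproj_rank_one[OF \<tau>(1,2)])
  define A where "A s = run_gates Q (reflection_gates (if fst s then Suc i else i) W (snd s))" for s :: "bool \<times> real"
  \<comment> \<open>Unit vectors in the range of J: here \<open>reflection_error\<close> applies,
    and phases about Gibbs states do not leave this set.\<close>
  define R where "R = {v \<in> carrier_vec N. J_proj v = v \<and> vnorm v = 1}"
  have "vnorm (fold A V (\<tau> i) - fold (\<lambda>s. phase (I (fst s)) (snd s)) V (\<tau> i)) \<le> length V * \<eta>"
  proof (rule hybrid_bound[where R = R and n = N and A = A and W = V and v = "\<tau> i"
        and I = "\<lambda>s. phase (I (fst s)) (snd s)" and \<eta> = \<eta>])
    show "\<exists>g. unipair N (A s) g" for s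
      unfolding A_def using i by (intro unipair_gates[OF oracles] circuit_ok_reflection) auto
    show "phase (I (fst s)) (snd s) v \<in> R" if "v \<in> R" for s v
    proof -
      have v: "v \<in> carrier_vec N" "J_proj v = v" "vnorm v = 1" using that by (auto simp: R_def)
      note LJ = orthprojD(1)[OF orthproj_J_proj]
      have "J_proj (I (fst s) v) = I (fst s) v"
        using linop_smult[OF LJ \<tau>(1)] \<tau>(3) by (simp add: I_eq)
      moreover have Iv: "I (fst s) v \<in> carrier_vec N" by (rule linop_carrier[OF orthprojD(1)[OF I_proj] v(1)])
      ultimately have "J_proj (phase (I (fst s)) (snd s) v) = phase (I (fst s)) (snd s) v"
        unfolding phase_def
        using linop_diff[OF LJ v(1), of "(1 - cis (snd s)) \<cdot>\<^sub>v I (fst s) v"] linop_smult[OF LJ Iv] v(2) by simp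
      moreover note U = unipair_phase[OF I_proj, of "fst s" "snd s"]
      moreover have "vnorm (phase (I (fst s)) (snd s) v) = 1" using unipair_vnorm[OF U v(1)] v(3) by simp
      ultimately show ?thesis using linop_carrier[OF unipairD(1)[OF U] v(1)] by (simp add: R_def)
    qed
    show "R \<subseteq> carrier_vec N" by (auto simp: R_def)
    show "\<tau> i \<in> R" using \<tau> by (simp add: R_def)
    fix s :: "bool \<times> real" and v assume "v \<in> R"
    then have v: "v \<in> carrier_vec N" "J_proj v = v" "vnorm v = 1" by (auto simp: R_def)
    let ?j = "if fst s then Suc i else i"
    have j: "?j \<le> l" using i by simp
    show "vnorm (A s v - phase (I (fst s)) (snd s) v) \<le> \<eta>"
      using reflection_error[where P = P and Q = Q and l = l and i = ?j, OF oracles j chain[OF j] \<mu>(1) \<mu>(2) d \<Delta>(1,2) \<Delta>(3)[OF j] g v(1,2),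
          where \<phi> = "snd s" and m = m]
      unfolding A_def I_eq W_def \<eta>_def \<tau>_def v(3) by simp
  qed
  moreover have "run_gates Q (stage_gates i W V) (\<tau> i) = fold A V (\<tau> i)"
    unfolding stage_gates_def run_gates_concat A_def ..
  moreover have "fold (\<lambda>s. phase (I (fst s)) (snd s)) V (\<tau> i) = run_word I V (\<tau> i)"
    by (simp add: run_word_def)
  ultimately have h1: "vnorm (run_gates Q (stage_gates i W V) (\<tau> i) - run_word I V (\<tau> i)) \<le> length V * \<eta>"
    by simp
  have "circuit_ok 1 d l (stage_gates i W V)" by (rule circuit_ok_stage[OF i])
  then obtain h where h: "unipair N (run_gates Q (stage_gates i W V)) h"
    using unipair_gates[where P = P and Q = Q and l = l, OF oracles] by blast
  note rc = linop_carrier[OF unipairD(1)[OF h] \<tau>(1)]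
  note U = unipair_run_word[where W = V and P = I, OF I_proj]
  define u where "u = run_word I V (\<tau> i)"
  have u: "u \<in> carrier_vec N" "vnorm u = 1"
    unfolding u_def using linop_carrier[OF unipairD(1)[OF U] \<tau>(1)] unipair_vnorm[OF U \<tau>(1)] \<tau>(2) by auto
  define b where "b = \<tau> i \<bullet>c \<tau> (Suc i)"
  define x where "x = sqrt (1 - (cmod b)\<^sup>2)"
  have b: "1 / 15 \<le> (cmod b)\<^sup>2" using overlap by (simp add: b_def \<tau>_def J_cinner)
  have rank_le: "cmod (v \<bullet>c \<tau> (Suc i)) \<le> 1" if "v \<in> carrier_vec N" "vnorm v = 1" for v
    using vnorm_orthproj_le[OF orthproj_rank_one[OF \<tau>(1,2)] that(1), of "Suc i"] that(2) \<tau>(2)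
    by (simp add: vnorm_smult)
  have "(cmod b)\<^sup>2 \<le> 1" using rank_le[OF \<tau>(1,2)] by (simp add: b_def power_le_one)
  then have x: "0 \<le> x" "1 - (cmod b)\<^sup>2 = x\<^sup>2" by (simp_all add: x_def)
  have x_le: "x \<le> sqrt (14 / 15)" unfolding x_def using b by (intro real_sqrt_le_mono) simp
  have "vnorm (u - (u \<bullet>c \<tau> (Suc i)) \<cdot>\<^sub>v \<tau> (Suc i)) = \<bar>ampl_factor (replicate a (pi / 3)) x * x\<bar>"
    unfolding u_def V_def
    by (rule fixed_point_amplification[OF \<tau>(1,2) \<tau>(1,2) _ x(1) x(2)[unfolded b_def]]) (auto simp: I_def fun_eq_iff)
  also have "\<dots> = x ^ 3 ^ a" unfolding ampl_factor_third using x(1) by simp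
  also have "\<dots> \<le> sqrt (14 / 15) ^ 3 ^ a" using x_le x(1) by (rule power_mono)
  finally have h2: "vnorm (u - (u \<bullet>c \<tau> (Suc i)) \<cdot>\<^sub>v \<tau> (Suc i)) \<le> sqrt (14 / 15) ^ 3 ^ a" .
  have "real (length V) \<le> 3 ^ a"
    using length_ampl_word[of "replicate a (pi / 3)"] unfolding V_def length_replicate
    by (metis le_add1 of_nat_le_iff of_nat_numeral of_nat_power)
  then have "length V * \<eta> \<le> 3 ^ a * \<eta>" using \<eta> by (rule mult_right_mono)
  moreover have "vnorm (run_gates Q (stage_gates i W V) (\<tau> i) - (u \<bullet>c \<tau> (Suc i)) \<cdot>\<^sub>v \<tau> (Suc i))
     \<le> vnorm (run_gates Q (stage_gates i W V) (\<tau> i) - u) + vnorm (u - (u \<bullet>c \<tau> (Suc i)) \<cdot>\<^sub>v \<tau> (Suc i))"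
    using rc u \<tau> by (intro vnorm_triangle_diff) auto
  ultimately have "vnorm (run_gates Q (stage_gates i W V) (\<tau> i) - (u \<bullet>c \<tau> (Suc i)) \<cdot>\<^sub>v \<tau> (Suc i))
     \<le> 3 ^ a * \<eta> + sqrt (14 / 15) ^ 3 ^ a" using h1 h2 unfolding u_def[symmetric] by linarith
  then show ?thesis using rank_le[OF u] unfolding W_def \<eta>_def by blast
qed

text \<open>After k stages the state is close to c times the k-th Gibbs state. Since |c| \<le> 1,
  the error of the next stage is not enlarged and the stage errors add;
  \<open>trace_distance_le\<close> accepts whatever c remains at the end.\<close>

lemma anneal_trace_distance:
  assumes oracles: "\<And>i. i \<le> l \<Longrightarrow> chain_oracle d enc (P i) (Q i)"
    and chain: "\<And>i. i \<le> l \<Longrightarrow> reversible_ergodic_chain d (\<mu> i) (P i)"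
    and \<mu>: "\<And>i x. x < d \<Longrightarrow> 0 < \<mu> i x" "\<And>i. (\<Sum>x<d. \<mu> i x) = (1 :: real)" and d: "0 < d"
    and \<mu>0: "\<And>x. x < d \<Longrightarrow> \<mu> 0 x = 1 / real d"
    and \<Delta>: "0 < \<Delta>" "\<Delta> \<le> pi" "\<And>i. i \<le> l \<Longrightarrow> \<Delta> \<le> phase_gap (szegedy_walk d (P i))"
    and g: "1 \<le> g" "g * cos (\<Delta> / 2) \<le> 1"
    and overlap: "\<And>i. i < l \<Longrightarrow> (cmod (qsample d (\<mu> i) \<bullet>c qsample d (\<mu> (Suc i))))\<^sup>2 \<ge> 1 / 15"
  shows "trace_distance (run_circuit 1 d Q (anneal_circuit l (ampl_word (chebyshev_angles g m))
      (ampl_word (replicate a (pi / 3))))) (J (qsample d (\<mu> l)))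
    \<le> l * (3 ^ a * (2 / chebyshev3 m g) + sqrt (14 / 15) ^ 3 ^ a)"
proof -
  define W where "W = ampl_word (chebyshev_angles g m)"
  define V where "V = ampl_word (replicate a (pi / 3))"
  define e where "e = 3 ^ a * (2 / chebyshev3 m g) + sqrt (14 / 15) ^ 3 ^ a"
  define \<tau> where "\<tau> i = J (qsample d (\<mu> i))" for i
  have q1: "vnorm (qsample d (\<mu> j)) = 1" for j
    using \<mu> by (intro vnorm_qsample) (auto simp: less_imp_le)
  have \<tau>: "\<tau> j \<in> carrier_vec N" "vnorm (\<tau> j) = 1" for j
    by (simp_all add: \<tau>_def J_carrier vnorm_J q1)
  define \<psi> where "\<psi> k = run_gates Q (concat (map (\<lambda>i. stage_gates i W V) [0..<k])) (\<tau> 0)" for k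
  have main: "\<psi> k \<in> carrier_vec N \<and> vnorm (\<psi> k) = 1 \<and>
      (\<exists>c. cmod c \<le> 1 \<and> vnorm (\<psi> k - c \<cdot>\<^sub>v \<tau> k) \<le> k * e)" if "k \<le> l" for k
    using that
  proof (induction k)
    case 0
    have "\<tau> 0 - 1 \<cdot>\<^sub>v \<tau> 0 = 0\<^sub>v N" using \<tau>(1)[of 0] by (intro eq_vecI) auto
    then have "vnorm (\<tau> 0 - 1 \<cdot>\<^sub>v \<tau> 0) = 0" using vnorm_eq_0[of "0\<^sub>v N" N] by simp
    then show ?case using \<tau>[of 0] by (auto simp: \<psi>_def run_gates_Nil intro!: exI[of _ 1])
  next
    case (Suc k)
    then have k: "k < l" by simp
    then obtain c where \<psi>: "\<psi> k \<in> carrier_vec N" "vnorm (\<psi> k) = 1"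
        and c: "cmod c \<le> 1" "vnorm (\<psi> k - c \<cdot>\<^sub>v \<tau> k) \<le> k * e"
      using Suc.IH by auto
    let ?S = "run_gates Q (stage_gates k W V)"
    obtain b where b: "cmod b \<le> 1" "vnorm (?S (\<tau> k) - b \<cdot>\<^sub>v \<tau> (Suc k)) \<le> e"
    proof -
      have "\<exists>b. cmod b \<le> 1 \<and> vnorm (?S (\<tau> k) - b \<cdot>\<^sub>v \<tau> (Suc k)) \<le> e"
        unfolding W_def V_def e_def \<tau>_def
        by (rule stage_error[where P = P and Q = Q and l = l and \<mu> = \<mu> and \<Delta> = \<Delta>])
          (fact assms k overlap[OF k])+
      then show ?thesis using that by blast
    qed
    obtain h where h: "unipair N ?S h"
      using unipair_gates[where P = P and Q = Q and l = l, OF oracles circuit_ok_stage[OF k]] by blast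
    note L = unipairD(1)[OF h]
    note Sc = linop_carrier[OF L \<psi>(1)] linop_carrier[OF L \<tau>(1)[of k]]
    have \<psi>_Suc: "\<psi> (Suc k) = ?S (\<psi> k)" by (simp add: \<psi>_def run_gates_append run_gates_Nil)
    \<comment> \<open>The intermediate vector separates the old error, transported by a unitary,
      from the new stage error, scaled by |c|.\<close>
    have "vnorm (?S (\<psi> k) - (c * b) \<cdot>\<^sub>v \<tau> (Suc k))
        \<le> vnorm (?S (\<psi> k) - c \<cdot>\<^sub>v ?S (\<tau> k)) + vnorm (c \<cdot>\<^sub>v ?S (\<tau> k) - (c * b) \<cdot>\<^sub>v \<tau> (Suc k))"
      using Sc \<tau> by (intro vnorm_triangle_diff) auto
    also have "?S (\<psi> k) - c \<cdot>\<^sub>v ?S (\<tau> k) = ?S (\<psi> k - c \<cdot>\<^sub>v \<tau> k)"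
      using linop_diff[OF L \<psi>(1), of "c \<cdot>\<^sub>v \<tau> k"] linop_smult[OF L \<tau>(1)[of k]] \<tau>(1)[of k] by simp
    also have "vnorm (?S (\<psi> k - c \<cdot>\<^sub>v \<tau> k)) = vnorm (\<psi> k - c \<cdot>\<^sub>v \<tau> k)"
      using \<psi> \<tau>(1)[of k] by (intro unipair_vnorm[OF h]) auto
    also have "c \<cdot>\<^sub>v ?S (\<tau> k) - (c * b) \<cdot>\<^sub>v \<tau> (Suc k) = c \<cdot>\<^sub>v (?S (\<tau> k) - b \<cdot>\<^sub>v \<tau> (Suc k))"
      using Sc \<tau>(1)[of "Suc k"] by (intro eq_vecI) (auto simp: algebra_simps)
    also have "vnorm (c \<cdot>\<^sub>v (?S (\<tau> k) - b \<cdot>\<^sub>v \<tau> (Suc k))) \<le> 1 * e"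
      unfolding vnorm_smult using c b by (intro mult_mono) auto
    finally have "vnorm (?S (\<psi> k) - (c * b) \<cdot>\<^sub>v \<tau> (Suc k)) \<le> Suc k * e"
      using c(2) by (simp add: algebra_simps)
    moreover have "cmod (c * b) \<le> 1" using c(1) b(1) by (simp add: norm_mult mult_le_one)
    ultimately show ?case using Sc(1) unipair_vnorm[OF h \<psi>(1)] \<psi>(2) unfolding \<psi>_Suc by auto
  qed
  then obtain c where c: "\<psi> l \<in> carrier_vec N" "vnorm (\<psi> l) = 1" "vnorm (\<psi> l - c \<cdot>\<^sub>v \<tau> l) \<le> l * e" by blast
  obtain U where U: "initial_gate = Fixed U" "U *\<^sub>v unit_vec N 0 = initial_state"
    using initial_gate[OF d] by blast
  have "qsample d (\<mu> 0) = qsample d (\<lambda>_. 1 / real d)"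
    using \<mu>0 by (intro eq_vecI) (auto simp: qsample_def)
  then have "\<tau> 0 = initial_state" by (simp add: \<tau>_def initial_state_def)
  then have "run_circuit 1 d Q (anneal_circuit l W V) = \<psi> l"
    unfolding run_circuit_def N_eq anneal_circuit_def U(1) \<psi>_def by (simp add: run_gates_def U(2))
  then show ?thesis
    using trace_distance_le[OF c(1,2) \<tau> c(3)] unfolding W_def V_def e_def \<tau>_def by simp
qed

end

subsection \<open>Parameters and the query bound\<close>

text \<open>Nesting only offers degrees that are powers of 3; for x \<ge> 1, rounding up costs at
  most a factor 3.\<close>

definition tripling :: "real \<Rightarrow> nat" where
  "tripling x = (LEAST m. x \<le> 3 ^ m)"

lemma tripling_ge: "x \<le> 3 ^ tripling x"
proof -
  obtain m :: nat where "x < 3 ^ m" using real_arch_pow[of 3 x] by auto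
  then show ?thesis unfolding tripling_def by (rule LeastI[where P = "\<lambda>m. x \<le> 3 ^ m", OF less_imp_le])
qed

lemma tripling_le: "1 \<le> x \<Longrightarrow> 3 ^ tripling x \<le> 3 * x"
proof (cases "tripling x")
  case (Suc m)
  then have "\<not> x \<le> 3 ^ m" unfolding tripling_def by (intro not_less_Least) simp
  then show ?thesis unfolding Suc by simp
qed simp

text \<open>Each stage may leave a fixed-point residue of \<epsilon> / (2 (l + 1)), so that l stages
  use half of \<epsilon>; l + 1 covers l = 0.\<close>

definition log_precision :: "nat \<Rightarrow> real \<Rightarrow> real" where
  "log_precision l \<epsilon> = ln (2 * (real l + 1) / \<epsilon>)"

text \<open>The factor 30 comes from sqrt (14 / 15) \<le> exp (- 1 / 30).\<close>

definition stage_depth :: "nat \<Rightarrow> real \<Rightarrow> nat" where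
  "stage_depth l \<epsilon> = tripling (30 * log_precision l \<epsilon>)"

text \<open>The other half of \<epsilon> goes to the reflections, so T (g) must reach 4 (l + 1)
  \<open>3 ^ a\<close> / \<epsilon>; the remaining factor 2 pays for cosh z \<ge> exp z / 2.\<close>

definition reflection_log :: "nat \<Rightarrow> real \<Rightarrow> real" where
  "reflection_log l \<epsilon> = ln (8 * (real l + 1) * 3 ^ stage_depth l \<epsilon> / \<epsilon>)"

text \<open>For g = cosh (\<Delta> / 4), T (g) is at least exp (\<open>3 ^ m\<close> \<Delta> / 4) /
  2, hence the factor 4 / \<Delta>.\<close>

definition reflection_depth :: "nat \<Rightarrow> real \<Rightarrow> real \<Rightarrow> nat" where
  "reflection_depth l \<Delta> \<epsilon> = tripling (4 / \<Delta> * reflection_log l \<epsilon>)"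

lemma ln_2_ge_half: "1 / 2 \<le> ln (2 :: real)"
  using ln_le_minus_one[of "1 / 2"] by (simp add: ln_div)

lemma log_precision_ge:
  assumes \<epsilon>: "0 < \<epsilon>" "\<epsilon> < 1" shows "1 / 2 \<le> log_precision l \<epsilon>"
proof -
  have "2 * \<epsilon> \<le> 2 * (real l + 1)" using \<epsilon> by (intro mult_left_mono) auto
  then have "2 \<le> 2 * (real l + 1) / \<epsilon>" using \<epsilon>(1) by (simp add: le_divide_eq)
  then have "ln 2 \<le> log_precision l \<epsilon>" unfolding log_precision_def by (intro ln_mono) auto
  then show ?thesis using ln_2_ge_half by linarith
qed

text \<open>At u = \<Delta> / 4 this says that the scale g = cosh (\<Delta> / 4) is admissible for
  singular values up to cos (\<Delta> / 2). It follows since cosh u cos u starts at 1 with slope 0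
  and has second derivative - 2 sinh u sin u.\<close>

lemma cosh_cos_le_1:
  assumes u: "0 \<le> u" "u \<le> pi / 4"
  shows "cosh u * cos (2 * u) \<le> 1"
proof -
  let ?f = "\<lambda>u :: real. cosh u * cos u" and ?f' = "\<lambda>u :: real. sinh u * cos u - cosh u * sin u"
  have d: "(?f has_real_derivative ?f' t) (at t)" for t
    by (auto intro!: derivative_eq_intros)
  have d': "(?f' has_real_derivative - 2 * (sinh t * sin t)) (at t)" for t
    by (auto intro!: derivative_eq_intros simp: algebra_simps)
  have f': "?f' t \<le> 0" if t: "0 \<le> t" "t \<le> u" for t
  proof -
    have "?f' t \<le> ?f' 0"
    proof (rule DERIV_nonpos_imp_nonincreasing[OF t(1)])
      fix s assume s: "0 \<le> s" "s \<le> t"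
      then have "0 \<le> sinh s * sin s" using u t sin_ge_zero[of s] by simp
      then show "\<exists>y. (?f' has_real_derivative y) (at s) \<and> y \<le> 0" using d'[of s] by fastforce
    qed
    then show ?thesis by simp
  qed
  have "?f u \<le> ?f 0"
  proof (rule DERIV_nonpos_imp_nonincreasing[OF u(1)])
    fix s assume "0 \<le> s" "s \<le> u"
    then show "\<exists>y. (?f has_real_derivative y) (at s) \<and> y \<le> 0" using d[of s] f'[of s] by blast
  qed
  moreover have "cos (2 * u) \<le> cos u" using u by (intro cos_monotone_0_pi_le) auto
  then have "cosh u * cos (2 * u) \<le> cosh u * cos u" by (intro mult_left_mono) auto
  ultimately show ?thesis unfolding cosh_0 cos_zero by linarith
qed

lemma anneal_error_le:
  fixes l :: nat
  assumes \<epsilon>: "0 < \<epsilon>" "\<epsilon> < 1" and \<Delta>: "0 < \<Delta>"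
  defines "a \<equiv> stage_depth l \<epsilon>"
  shows "l * (3 ^ a * (2 / chebyshev3 (reflection_depth l \<Delta> \<epsilon>) (cosh (\<Delta> / 4))) + sqrt (14 / 15) ^ 3 ^ a) \<le> \<epsilon>"
proof -
  define \<Lambda> where "\<Lambda> = log_precision l \<epsilon>"
  define B where "B = reflection_log l \<epsilon>"
  define m where "m = reflection_depth l \<Delta> \<epsilon>"
  define h where "h = chebyshev3 m (cosh (\<Delta> / 4))"
  define p where "p = real l + 1"
  have p: "0 < p" "real l \<le> p" by (simp_all add: p_def)
  have "4 / \<Delta> * B \<le> 3 ^ m" unfolding B_def m_def reflection_depth_def by (rule tripling_ge)
  then have "B \<le> 3 ^ m * (\<Delta> / 4)" using \<Delta> by (simp add: field_simps)
  then have "exp B \<le> exp (3 ^ m * (\<Delta> / 4))" by simp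
  also have "\<dots> \<le> 2 * h" unfolding h_def chebyshev3_cosh by (simp add: cosh_def)
  finally have "exp B \<le> 2 * h" .
  moreover have "exp B = 8 * p * 3 ^ a / \<epsilon>"
    unfolding B_def reflection_log_def a_def p_def using \<epsilon> by (subst exp_ln) auto
  ultimately have hB: "4 * p * 3 ^ a / \<epsilon> \<le> h" by simp
  then have "0 < h" using p \<epsilon> by (smt (verit) divide_pos_pos mult_pos_pos zero_less_power)
  then have e1: "3 ^ a * (2 / h) \<le> \<epsilon> / (2 * p)"
    using hB p \<epsilon> by (simp add: field_simps)
  have "30 * \<Lambda> \<le> 3 ^ a" unfolding \<Lambda>_def a_def stage_depth_def by (rule tripling_ge)
  \<comment> \<open>From 1 + z \<le> exp z at z = - 1 / 15; the square root halves the
    exponent.\<close>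
  have "14 / 15 \<le> exp (- (1 / 15) :: real)" using exp_ge_add_one_self[of "- (1 / 15) :: real"] by simp
  then have "sqrt (14 / 15) \<le> sqrt (exp (- (1 / 15) :: real))" by (rule real_sqrt_le_mono)
  also have "\<dots> = exp (- (1 / 30))"
    by (rule real_sqrt_unique) (simp_all add: power2_eq_square flip: exp_add)
  finally have "sqrt (14 / 15) ^ 3 ^ a \<le> exp (- (1 / 30) :: real) ^ 3 ^ a" by (intro power_mono) auto
  also have "\<dots> = exp (- (3 ^ a / 30))" by (simp flip: exp_of_nat_mult)
  also have "\<dots> \<le> exp (- \<Lambda>)" using \<open>30 * \<Lambda> \<le> 3 ^ a\<close> by simp
  also have "\<dots> = \<epsilon> / (2 * p)"
    unfolding \<Lambda>_def log_precision_def p_def exp_minus using \<epsilon> by (subst exp_ln) auto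
  finally have e2: "sqrt (14 / 15) ^ 3 ^ a \<le> \<epsilon> / (2 * p)" .
  have "real l * (3 ^ a * (2 / h) + sqrt (14 / 15) ^ 3 ^ a) \<le> real l * (\<epsilon> / (2 * p) + \<epsilon> / (2 * p))"
    using e1 e2 by (intro mult_left_mono add_mono) auto
  also have "\<dots> = real l / p * \<epsilon>" using p by (simp add: field_simps)
  also have "\<dots> \<le> 1 * \<epsilon>" using p \<epsilon> by (intro mult_right_mono) auto
  finally show ?thesis unfolding h_def m_def by simp
qed

text \<open>Cheap numerical bounds such as ln 360 \<le> 9 and ln 10 \<le> 4.\<close>

lemma ln_le_mult_ln2: "0 < x \<Longrightarrow> x \<le> 2 ^ k \<Longrightarrow> ln x \<le> real k"
proof -
  assume x: "0 < x" "x \<le> 2 ^ k"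
  then have "ln x \<le> ln (2 ^ k)" by (intro ln_mono) auto
  also have "\<dots> = k * ln 2" by (simp add: ln_realpow)
  also have "\<dots> \<le> real k * 1" using ln_2_less_1 by (intro mult_left_mono) auto
  finally show ?thesis by simp
qed

text \<open>Both \<open>3 ^ stage_depth\<close> and \<Delta> times
  \<open>3 ^ reflection_depth\<close> are linear in the logarithm \<Lambda>, which gives the
  exponent 2.\<close>

lemma anneal_query_bound:
  fixes l :: nat
  assumes \<epsilon>: "0 < \<epsilon>" "\<epsilon> < 1" and \<Delta>: "0 < \<Delta>" "\<Delta> \<le> pi" and L: "0 \<le> L" "real l \<le> 10 * L"
  shows "real l * (3 ^ stage_depth l \<epsilon> * (2 * 3 ^ reflection_depth l \<Delta> \<epsilon>))
    \<le> 10 ^ 8 * (L / \<Delta>) * ((1 + ln (1 + L)) * (1 + ln (1 / \<epsilon>)))\<^sup>2"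
proof -
  define \<Lambda> where "\<Lambda> = log_precision l \<epsilon>"
  define B where "B = reflection_log l \<epsilon>"
  define a where "a = stage_depth l \<epsilon>"
  define A where "A = (1 + ln (1 + L)) * (1 + ln (1 / \<epsilon>))"
  have \<Lambda>: "1 / 2 \<le> \<Lambda>" unfolding \<Lambda>_def by (rule log_precision_ge[OF \<epsilon>])
  have a: "3 ^ a \<le> 90 * \<Lambda>"
    using tripling_le[of "30 * \<Lambda>"] \<Lambda> by (simp add: a_def stage_depth_def \<Lambda>_def)
  have one: "1 \<le> (3 :: real) ^ a" by simp
  \<comment> \<open>The reflection precision involves \<open>3 ^ a\<close>, itself logarithmic, so
    it adds only an iterated logarithm to \<Lambda>, absorbed in \<open>B_le\<close>.\<close>
  have B_eq: "B = ln (4 * 3 ^ a) + \<Lambda>"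
  proof -
    have "8 * (real l + 1) * 3 ^ a / \<epsilon> = (4 * 3 ^ a) * (2 * (real l + 1) / \<epsilon>)" by simp
    then show ?thesis unfolding B_def reflection_log_def \<Lambda>_def log_precision_def a_def[symmetric]
      using \<epsilon> by (subst ln_mult_pos[symmetric]) auto
  qed
  have "ln (4 * 3 ^ a) \<le> ln (360 * \<Lambda>)" using a one by (intro ln_mono) auto
  also have "\<dots> = ln 360 + ln \<Lambda>" using \<Lambda> by (intro ln_mult_pos) auto
  also have "ln 360 \<le> (9 :: real)" using ln_le_mult_ln2[of 360 9] by simp
  also have "ln \<Lambda> \<le> \<Lambda>" using \<Lambda> ln_le_minus_one[of \<Lambda>] by simp
  finally have B_le: "B \<le> 20 * \<Lambda>" using \<Lambda> unfolding B_eq by linarith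
  have "ln 4 = 2 * ln (2 :: real)" using ln_realpow[of 2 2] by simp
  then have "1 \<le> ln (4 :: real)" using ln_2_ge_half by simp
  moreover have "ln 4 \<le> ln (4 * 3 ^ a :: real)" using one by (intro ln_mono) auto
  ultimately have B1: "1 \<le> B" unfolding B_eq using \<Lambda> by linarith
  \<comment> \<open>Makes the argument of \<open>tripling\<close> at least 1, as
    \<open>tripling_le\<close> demands; pi < 4 suffices because B \<ge> 1.\<close>
  have "\<Delta> \<le> 4 * B" using \<Delta>(2) pi_less_4 B1 by linarith
  then have "1 \<le> 4 / \<Delta> * B" using \<Delta>(1) by (simp add: field_simps)
  then have "3 ^ reflection_depth l \<Delta> \<epsilon> \<le> 3 * (4 / \<Delta> * B)"
    unfolding reflection_depth_def B_def by (rule tripling_le)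
  also have "\<dots> \<le> 3 * (4 / \<Delta> * (20 * \<Lambda>))" using B_le \<Delta>(1) by (intro mult_left_mono) auto
  finally have m: "3 ^ reflection_depth l \<Delta> \<epsilon> \<le> 240 * \<Lambda> / \<Delta>" by simp
  have lnL: "0 \<le> ln (1 + L)" and lne: "0 \<le> ln (1 / \<epsilon>)" using L(1) \<epsilon> by (simp_all add: ln_div)
  have "\<Lambda> = ln (real l + 1) + ln 2 + ln (1 / \<epsilon>)"
  proof -
    have "2 * (real l + 1) / \<epsilon> = (real l + 1) * 2 * (1 / \<epsilon>)" by simp
    then have "\<Lambda> = ln ((real l + 1) * 2 * (1 / \<epsilon>))" unfolding \<Lambda>_def log_precision_def by (rule arg_cong)
    also have "\<dots> = ln ((real l + 1) * 2) + ln (1 / \<epsilon>)" using \<epsilon> by (intro ln_mult_pos) auto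
    also have "ln ((real l + 1) * 2) = ln (real l + 1) + ln 2" by (intro ln_mult_pos) auto
    finally show ?thesis .
  qed
  also have "ln (real l + 1) \<le> ln (10 * (1 + L))" using L by (intro ln_mono) auto
  also have "ln (10 * (1 + L)) = ln 10 + ln (1 + L)" using L(1) by (intro ln_mult_pos) auto
  also have "ln 10 \<le> (4 :: real)" using ln_le_mult_ln2[of 10 4] by simp
  also have "ln 2 \<le> (1 :: real)" using ln_2_less_1 by simp
  finally have "\<Lambda> \<le> 5 + ln (1 + L) + ln (1 / \<epsilon>)" by simp
  also have "\<dots> \<le> 5 * A"
    using lnL lne mult_nonneg_nonneg[OF lnL lne] unfolding A_def by (simp add: algebra_simps)
  finally have \<Lambda>A: "\<Lambda> \<le> 5 * A" .
  \<comment> \<open>The factors 10, 90, 2 and 240 multiply to 432000; bounding \<Lambda> by 5 A adds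
    a factor 25.\<close>
  have "real l * (3 ^ a * (2 * 3 ^ reflection_depth l \<Delta> \<epsilon>)) \<le> (10 * L) * ((90 * \<Lambda>) * (2 * (240 * \<Lambda> / \<Delta>)))"
    using L a m \<Lambda> \<Delta>(1) by (intro mult_mono) auto
  also have "\<dots> = 432000 * (L / \<Delta>) * \<Lambda>\<^sup>2" by (simp add: power2_eq_square)
  also have "\<dots> \<le> 432000 * (L / \<Delta>) * (5 * A)\<^sup>2"
    using \<Lambda>A \<Lambda> L \<Delta> by (intro mult_left_mono power_mono) auto
  also have "\<dots> = 10800000 * ((L / \<Delta>) * A\<^sup>2)" by (simp add: power2_eq_square)
  also have "\<dots> \<le> 10 ^ 8 * ((L / \<Delta>) * A\<^sup>2)" using L \<Delta> by (intro mult_right_mono) auto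
  finally show ?thesis unfolding A_def a_def by (simp add: mult.assoc)
qed

section \<open>Cooling schedules\<close>

lemma partition_fun_pos: "0 < d \<Longrightarrow> 0 < partition_fun d H \<beta>"
  unfolding partition_fun_def by (intro sum_pos) auto

lemma gibbs_pos: "0 < d \<Longrightarrow> 0 < gibbs d H \<beta> x"
  by (simp add: gibbs_def partition_fun_pos)

lemma gibbs_sum: "0 < d \<Longrightarrow> (\<Sum>x<d. gibbs d H \<beta> x) = 1"
  using partition_fun_pos[of d H \<beta>]
  by (simp add: gibbs_def sum_divide_distrib[symmetric]) (simp add: partition_fun_def)

lemma gibbs_0: "gibbs d H 0 x = 1 / real d"
  by (simp add: gibbs_def partition_fun_def)

text \<open>Lets the minimum of the Hamiltonian be moved to 0, which
  \<open>midpoint_gap_cold\<close> relies on.\<close>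

lemma gibbs_shift:
  assumes "\<And>x. x < d \<Longrightarrow> H x = h x + c" "x < d"
  shows "gibbs d H \<beta> x = gibbs d h \<beta> x"
proof -
  have e: "exp (- \<beta> * real (H y)) = exp (- \<beta> * real c) * exp (- \<beta> * real (h y))" if "y < d" for y
    unfolding exp_add[symmetric] using assms(1)[OF that] by (simp add: algebra_simps)
  have "partition_fun d H \<beta> = exp (- \<beta> * real c) * partition_fun d h \<beta>"
    unfolding partition_fun_def sum_distrib_left using e by (intro sum.cong) auto
  then show ?thesis unfolding gibbs_def e[OF assms(2)] by simp
qed

section \<open>Convexity of ln Z and steps of bounded overlap\<close>

definition free_energy :: "nat \<Rightarrow> (nat \<Rightarrow> nat) \<Rightarrow> real \<Rightarrow> real" where
  "free_energy d h \<beta> = ln (partition_fun d h \<beta>)"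

definition mean_energy :: "nat \<Rightarrow> (nat \<Rightarrow> nat) \<Rightarrow> real \<Rightarrow> real" where
  "mean_energy d h \<beta> = (\<Sum>x<d. real (h x) * exp (- \<beta> * real (h x))) / partition_fun d h \<beta>"

text \<open>The convexity defect of ln Z at the midpoint. By \<open>overlap_gibbs\<close> it is
  minus the logarithm of the squared overlap.\<close>

definition midpoint_gap :: "nat \<Rightarrow> (nat \<Rightarrow> nat) \<Rightarrow> real \<Rightarrow> real \<Rightarrow> real" where
  "midpoint_gap d h a b = free_energy d h a + free_energy d h b - 2 * free_energy d h ((a + b) / 2)"

text \<open>The geometric mean of the Boltzmann weights at a and b is the weight at the midpoint, so
  the overlap is a quotient of partition functions.\<close>

lemma overlap_gibbs:
  assumes d: "0 < d"
  shows "(cmod (qsample d (gibbs d h a) \<bullet>c qsample d (gibbs d h b)))\<^sup>2 = exp (- midpoint_gap d h a b)"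
proof -
  let ?Z = "partition_fun d h" and ?m = "(a + b) / 2"
  have Z: "0 < ?Z \<beta>" for \<beta> using d by (rule partition_fun_pos)
  have "qsample d (gibbs d h a) \<bullet>c qsample d (gibbs d h b)
      = complex_of_real (\<Sum>x<d. sqrt (gibbs d h a x) * sqrt (gibbs d h b x))"
    by (simp add: cinner_carrier[of _ d]) (simp add: qsample_def)
  also have "(\<Sum>x<d. sqrt (gibbs d h a x) * sqrt (gibbs d h b x)) = ?Z ?m / sqrt (?Z a * ?Z b)"
  proof -
    have "sqrt (gibbs d h a x) * sqrt (gibbs d h b x) = exp (- ?m * real (h x)) / sqrt (?Z a * ?Z b)" for x
    proof -
      have "gibbs d h a x * gibbs d h b x = (exp (- ?m * real (h x)))\<^sup>2 / (?Z a * ?Z b)"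
        unfolding gibbs_def power2_eq_square
        by (simp add: exp_add[symmetric] field_simps flip: distrib_left)
      then show ?thesis unfolding real_sqrt_mult[symmetric] by (simp add: real_sqrt_divide)
    qed
    then show ?thesis by (simp add: sum_divide_distrib[symmetric]) (simp add: partition_fun_def)
  qed
  finally have "(cmod (qsample d (gibbs d h a) \<bullet>c qsample d (gibbs d h b)))\<^sup>2 = (?Z ?m)\<^sup>2 / (?Z a * ?Z b)"
    using Z[of a] Z[of b] by (simp add: power_divide norm_divide)
  also have "\<dots> = exp (- midpoint_gap d h a b)"
  proof -
    have "ln ((?Z ?m)\<^sup>2 / (?Z a * ?Z b)) = ln ((?Z ?m)\<^sup>2) - ln (?Z a * ?Z b)"
      using Z[of a] Z[of b] Z[of ?m] by (subst ln_div) auto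
    also have "ln ((?Z ?m)\<^sup>2) = 2 * ln (?Z ?m)" using ln_realpow[of "?Z ?m" 2] by simp
    also have "ln (?Z a * ?Z b) = ln (?Z a) + ln (?Z b)" by (rule ln_mult_pos[OF Z Z])
    finally have "ln ((?Z ?m)\<^sup>2 / (?Z a * ?Z b)) = - midpoint_gap d h a b"
      unfolding midpoint_gap_def free_energy_def by linarith
    then show ?thesis using Z[of a] Z[of b] Z[of ?m] exp_ln[of "(?Z ?m)\<^sup>2 / (?Z a * ?Z b)"] by simp
  qed
  finally show ?thesis .
qed

text \<open>Convexity of ln Z as a tangent inequality, proved without derivatives: 1 + z \<le> exp z
  in each summand, where the linear terms cancel because E is the mean energy.\<close>

lemma free_energy_tangent:
  assumes d: "0 < d"
  shows "free_energy d h a - (b - a) * mean_energy d h a \<le> free_energy d h b"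
proof -
  let ?Z = "partition_fun d h"
  define E where "E = mean_energy d h a"
  have Z: "0 < ?Z \<beta>" for \<beta> using d by (rule partition_fun_pos)
  have E: "(\<Sum>x<d. real (h x) * exp (- a * real (h x))) = E * ?Z a"
    using Z[of a] by (simp add: E_def mean_energy_def)
  have "(\<Sum>x<d. exp (- a * real (h x)) * (1 - (b - a) * (real (h x) - E)))
      = (\<Sum>x<d. exp (- a * real (h x)) - (b - a) * (real (h x) * exp (- a * real (h x)))
          + (b - a) * E * exp (- a * real (h x)))"
    by (intro sum.cong refl) (simp add: algebra_simps)
  also have "\<dots> = ?Z a - (b - a) * (E * ?Z a) + (b - a) * E * ?Z a"
    unfolding sum.distrib sum_subtractf sum_distrib_left[symmetric] E unfolding partition_fun_def ..
  finally have "?Z a * exp (- (b - a) * E)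
      = exp (- (b - a) * E) * (\<Sum>x<d. exp (- a * real (h x)) * (1 - (b - a) * (real (h x) - E)))" by simp
  also have "\<dots> = (\<Sum>x<d. exp (- (b - a) * E) * (exp (- a * real (h x)) * (1 - (b - a) * (real (h x) - E))))"
    by (rule sum_distrib_left)
  also have "\<dots> \<le> (\<Sum>x<d. exp (- b * real (h x)))"
  proof (rule sum_mono)
    fix x
    have "1 - (b - a) * (real (h x) - E) \<le> exp (- (b - a) * (real (h x) - E))"
      using exp_ge_add_one_self[of "- ((b - a) * (real (h x) - E))"] unfolding mult_minus_left by linarith
    then have "exp (- (b - a) * E) * (exp (- a * real (h x)) * (1 - (b - a) * (real (h x) - E)))
      \<le> exp (- (b - a) * E) * (exp (- a * real (h x)) * exp (- (b - a) * (real (h x) - E)))"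
      by (intro mult_left_mono) auto
    also have "\<dots> = exp (- b * real (h x))"
      unfolding exp_add[symmetric] by (simp add: algebra_simps)
    finally show "exp (- (b - a) * E) * (exp (- a * real (h x)) * (1 - (b - a) * (real (h x) - E)))
      \<le> exp (- b * real (h x))" .
  qed
  finally have "?Z a * exp (- (b - a) * E) \<le> ?Z b" by (simp add: partition_fun_def)
  then have "ln (?Z a * exp (- (b - a) * E)) \<le> ln (?Z b)" using Z by (intro ln_mono) auto
  then show ?thesis using Z[of a] ln_mult_pos[of "?Z a" "exp (- (b - a) * E)"]
    by (simp add: free_energy_def E_def left_diff_distrib)
qed

lemma midpoint_gap_attained:
  assumes d: "0 < d" and ab: "a < t" and gap: "1 < midpoint_gap d h a t"
  shows "\<exists>b. a < b \<and> b < t \<and> midpoint_gap d h a b = 1"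
proof -
  have nz: "(\<Sum>x<d. exp (- \<beta> * real (h x))) \<noteq> 0" for \<beta>
    using partition_fun_pos[OF d, of h \<beta>] unfolding partition_fun_def by linarith
  have "continuous_on {a..t} (midpoint_gap d h a)"
    unfolding midpoint_gap_def[abs_def] free_energy_def partition_fun_def
    by (intro continuous_intros ballI nz) auto
  moreover have g0: "midpoint_gap d h a a = 0" by (simp add: midpoint_gap_def)
  ultimately obtain b where b: "a \<le> b" "b \<le> t" "midpoint_gap d h a b = 1"
    using IVT'[of "midpoint_gap d h a" a 1 t] ab gap by auto
  then have "b \<noteq> a" "b \<noteq> t" using g0 gap by auto
  then show ?thesis using b by (intro exI[of _ b]) auto
qed

text \<open>Let A and B be the drops of ln Z over the two halves, so A = B + 1. The tangents at the
  ends bound A above and B below, so the mean energies have ratio at most B / A = 1 - 1 / A. Its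
  logarithm is thus at most - 1 / A, while the total drop of ln Z is at least A.\<close>

lemma energy_ratio:
  assumes d: "0 < d" and ab: "a < b" and gap: "midpoint_gap d h a b = 1" and gb: "0 < mean_energy d h b"
  shows "1 \<le> (free_energy d h a - free_energy d h b) * (ln (mean_energy d h a) - ln (mean_energy d h b))"
    and "0 \<le> free_energy d h a - free_energy d h b" and "0 < mean_energy d h a"
proof -
  define f where "f = free_energy d h"
  define g where "g = mean_energy d h"
  define m where "m = (a + b) / 2"
  define D where "D = (b - a) / 2"
  define A where "A = f a - f m"
  define B where "B = f m - f b"
  have D: "0 < D" using ab by (simp add: D_def)
  have "f a - (m - a) * g a \<le> f m" "f b - (m - b) * g b \<le> f m"
    unfolding f_def g_def by (rule free_energy_tangent[OF d])+
  moreover have "m - a = D" "m - b = - D" by (simp_all add: m_def D_def field_simps)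
  ultimately have AB: "A \<le> D * g a" "D * g b \<le> B" by (simp_all add: A_def B_def)
  have A_B: "A = B + 1" using gap unfolding midpoint_gap_def A_def B_def f_def m_def by simp
  have gb': "0 < g b" using gb by (simp add: g_def)
  then have B: "0 < B" using AB(2) D by (smt (verit) mult_pos_pos)
  then have A: "1 < A" using A_B by simp
  have ga: "0 < g a" using AB(1) A D by (smt (verit) zero_less_mult_pos)
  have "g b * A \<le> g b * (D * g a)" using AB gb' by (intro mult_left_mono) auto
  also have "\<dots> \<le> B * g a" using mult_right_mono[OF AB(2), of "g a"] ga by (simp add: mult_ac)
  finally have "g b / g a \<le> B / A" using ga A by (simp add: field_simps)
  then have "ln (g b / g a) \<le> ln (B / A)" using ga gb' A B by (intro ln_mono) auto
  also have "\<dots> \<le> B / A - 1" using A B by (intro ln_le_minus_one) auto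
  also have "\<dots> = - 1 / A" using A A_B by (simp add: field_simps)
  finally have l: "1 / A \<le> ln (g a) - ln (g b)" using ga gb' by (simp add: ln_div)
  have "1 = A * (1 / A)" using A by simp
  also have "\<dots> \<le> (A + B) * (ln (g a) - ln (g b))" using l A B by (intro mult_mono) auto
  finally show "1 \<le> (free_energy d h a - free_energy d h b) * (ln (mean_energy d h a) - ln (mean_energy d h b))"
    by (simp add: A_def B_def f_def g_def)
  show "0 \<le> free_energy d h a - free_energy d h b" using A B by (simp add: A_def B_def f_def)
  show "0 < mean_energy d h a" using ga by (simp add: g_def)
qed

text \<open>Energies are integers, so mean energy at most 1 / 2 puts at least half of Z on energy 0,
  a part that never decays. Hence Z at the midpoint is at least half of Z at a, and the gap is at
  most ln 2.\<close>

lemma midpoint_gap_cold: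
  assumes x0: "x0 < d" "h x0 = 0" and ab: "a < b" and cold: "mean_energy d h a \<le> 1 / 2"
  shows "midpoint_gap d h a b \<le> 1"
proof -
  let ?Z = "partition_fun d h"
  have d: "0 < d" using x0 by simp
  have Z: "0 < ?Z \<beta>" for \<beta> using d by (rule partition_fun_pos)
  define m where "m = (a + b) / 2"
  define c where "c = (\<Sum>x<d. if h x = 0 then 1 else 0 :: real)"
  have cm: "c \<le> ?Z m" unfolding c_def partition_fun_def by (intro sum_mono) auto
  have "?Z a - (\<Sum>x<d. real (h x) * exp (- a * real (h x))) \<le> c"
    unfolding partition_fun_def c_def sum_subtractf[symmetric]
  proof (rule sum_mono)
    fix x
    have "exp (- a * real (h x)) * 1 \<le> exp (- a * real (h x)) * real (h x)" if "h x \<noteq> 0"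
      using that by (intro mult_left_mono) auto
    then show "exp (- a * real (h x)) - real (h x) * exp (- a * real (h x)) \<le> (if h x = 0 then 1 else 0)"
      by (auto simp: mult.commute)
  qed
  moreover have "(\<Sum>x<d. real (h x) * exp (- a * real (h x))) \<le> ?Z a / 2"
    using cold Z[of a] unfolding mean_energy_def by (simp add: field_simps)
  ultimately have "?Z a / 2 \<le> ?Z m" using cm by linarith
  then have "ln (?Z a / 2) \<le> ln (?Z m)" using Z by (intro ln_mono) auto
  then have "free_energy d h a - ln 2 \<le> free_energy d h m"
    using Z[of a] by (simp add: free_energy_def ln_div)
  moreover have "?Z b \<le> ?Z m"
    unfolding partition_fun_def
  proof (rule sum_mono)
    fix x
    have "m \<le> b" using ab by (simp add: m_def)
    then have "m * real (h x) \<le> b * real (h x)" by (rule mult_right_mono) simp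
    then show "exp (- b * real (h x)) \<le> exp (- m * real (h x))" by simp
  qed
  then have "free_energy d h b \<le> free_energy d h m" using Z unfolding free_energy_def by (intro ln_mono) auto
  ultimately show ?thesis using ln_2_less_1 unfolding midpoint_gap_def m_def by linarith
qed

text \<open>Each step of gap 1 decreases \<open>c * free_energy + ln mean_energy / c\<close> by at least 2, by AM-GM.\<close>

lemma schedule_exists:
  assumes x0: "x0 < d" "h x0 = 0" and c: "0 < c" and a: "a < t"
    and budget: "1 / 2 < mean_energy d h a \<Longrightarrow>
      c * free_energy d h a + (ln (mean_energy d h a) + ln 2) / c \<le> 2 * real k"
  shows "\<exists>l \<beta>. \<beta> 0 = a \<and> \<beta> l = t \<and> (\<forall>i<l. \<beta> i < \<beta> (Suc i) \<and> midpoint_gap d h (\<beta> i) (\<beta> (Suc i)) \<le> 1) \<and> l \<le> k + 2"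
  using a budget
proof (induction k arbitrary: a rule: less_induct)
  fix k a
  assume IH: "\<And>k' a. k' < k \<Longrightarrow> a < t \<Longrightarrow> (1 / 2 < mean_energy d h a \<Longrightarrow>
      c * free_energy d h a + (ln (mean_energy d h a) + ln 2) / c \<le> 2 * real k') \<Longrightarrow>
    \<exists>l \<beta>. \<beta> 0 = a \<and> \<beta> l = t \<and> (\<forall>i<l. \<beta> i < \<beta> (Suc i) \<and> midpoint_gap d h (\<beta> i) (\<beta> (Suc i)) \<le> 1) \<and> l \<le> k' + 2"
    and at: "a < t" and budget: "1 / 2 < mean_energy d h a \<Longrightarrow>
      c * free_energy d h a + (ln (mean_energy d h a) + ln 2) / c \<le> 2 * real k"
  have d: "0 < d" using x0 by simp
  have direct: "\<exists>l \<beta>. \<beta> 0 = a \<and> \<beta> l = t \<and> (\<forall>i<l. \<beta> i < \<beta> (Suc i) \<and> midpoint_gap d h (\<beta> i) (\<beta> (Suc i)) \<le> 1) \<and> l \<le> 1"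
    if "a < t" "midpoint_gap d h a t \<le> 1" for a
    using that by (intro exI[of _ 1] exI[of _ "\<lambda>i. if i = 0 then a else t"]) auto
  show "\<exists>l \<beta>. \<beta> 0 = a \<and> \<beta> l = t \<and> (\<forall>i<l. \<beta> i < \<beta> (Suc i) \<and> midpoint_gap d h (\<beta> i) (\<beta> (Suc i)) \<le> 1) \<and> l \<le> k + 2"
  proof (cases "midpoint_gap d h a t \<le> 1")
    case True
    from direct[OF at this] show ?thesis by fastforce
  next
    case False
    then obtain b where b: "a < b" "b < t" "midpoint_gap d h a b = 1"
      using midpoint_gap_attained[OF d at, of h] by auto
    have hot: "1 / 2 < mean_energy d h a" using midpoint_gap_cold[where h = h, OF x0 at] False by linarith
    have "\<exists>l \<beta>. \<beta> 0 = b \<and> \<beta> l = t \<and> (\<forall>i<l. \<beta> i < \<beta> (Suc i) \<and> midpoint_gap d h (\<beta> i) (\<beta> (Suc i)) \<le> 1) \<and> l \<le> k + 1"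
    proof (cases "1 / 2 < mean_energy d h b")
      case False
      then have "midpoint_gap d h b t \<le> 1" using midpoint_gap_cold[where h = h, OF x0 b(2)] by simp
      from direct[OF b(2) this] show ?thesis by fastforce
    next
      case True
      define p where "p = free_energy d h a - free_energy d h b"
      define q where "q = ln (mean_energy d h a) - ln (mean_energy d h b)"
      have "0 < mean_energy d h b" using True by simp
      note r = energy_ratio[OF d b(1,3) this]
      have pq: "1 \<le> p * q" "0 \<le> p" using r by (simp_all add: p_def q_def)
      \<comment> \<open>AM-GM for c p and q / c, whose product is p q \<ge> 1.\<close>
      have "4 \<le> 4 * ((c * p) * (q / c))" using pq c by simp
      also have "\<dots> \<le> (c * p + q / c)\<^sup>2"
        using zero_le_power2[of "c * p - q / c"] by (simp add: power2_eq_square algebra_simps)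
      finally have "2\<^sup>2 \<le> (c * p + q / c)\<^sup>2" by simp
      moreover have "0 \<le> q" using pq by (smt (verit) mult_nonneg_nonpos)
      then have "0 \<le> c * p + q / c" using pq c by simp
      ultimately have two: "2 \<le> c * p + q / c" by (rule power2_le_imp_le)
      have eq: "c * free_energy d h a + (ln (mean_energy d h a) + ln 2) / c
          = c * free_energy d h b + (ln (mean_energy d h b) + ln 2) / c + (c * p + q / c)"
        using c by (simp add: p_def q_def field_simps)
      then have le: "c * free_energy d h b + (ln (mean_energy d h b) + ln 2) / c \<le> 2 * real k - 2"
        using budget[OF hot] two by linarith
      have "1 \<le> partition_fun d h b"
        unfolding partition_fun_def using x0 member_le_sum[of x0 "{..<d}" "\<lambda>x. exp (- b * real (h x))"] by simp
      then have "0 \<le> free_energy d h b" by (simp add: free_energy_def)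
      moreover have "ln (1 / 2) < ln (mean_energy d h b)" using True by (intro ln_strict_mono) auto
      then have "0 < (ln (mean_energy d h b) + ln 2) / c" using c by (simp add: ln_div)
      ultimately have "0 < c * free_energy d h b + (ln (mean_energy d h b) + ln 2) / c"
        using c by (intro add_nonneg_pos) auto
      \<comment> \<open>While the mean energy exceeds 1 / 2 the potential is positive, which is why
        ln 2 is added to it. The extra 2 in k + 2 are the step that enters the cold region and the
        one that leaves it for t.\<close>
      then have "k \<noteq> 0" using le by auto
      then have "k - 1 < k" "2 * real k - 2 = 2 * real (k - 1)" "k - 1 + 2 = k + 1" by auto
      then show ?thesis using IH[OF _ b(2), of "k - 1"] le by metis
    qed
    then obtain l \<beta> where \<beta>: "\<beta> 0 = b" "\<beta> l = t"
      "\<forall>i<l. \<beta> i < \<beta> (Suc i) \<and> midpoint_gap d h (\<beta> i) (\<beta> (Suc i)) \<le> 1" "l \<le> k + 1" by blast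
    show ?thesis
    proof (intro exI conjI)
      let ?\<beta> = "\<lambda>i. case i of 0 \<Rightarrow> a | Suc j \<Rightarrow> \<beta> j"
      show "?\<beta> 0 = a" "?\<beta> (Suc l) = t" "Suc l \<le> k + 2" using \<beta> by auto
      show "\<forall>i<Suc l. ?\<beta> i < ?\<beta> (Suc i) \<and> midpoint_gap d h (?\<beta> i) (?\<beta> (Suc i)) \<le> 1"
        using \<beta> b by (auto split: nat.split)
    qed
  qed
qed

text \<open>The potential of \<open>schedule_exists\<close> starts at no more than c ln d + ln (2 n)
  / c, so the best c makes both terms equal to sqrt (ln d ln (2 n)).\<close>

lemma cooling_schedule_exists:
  assumes d: "2 \<le> d" and n: "2 \<le> n" and H: "\<And>x. x < d \<Longrightarrow> H x \<le> n" and t: "0 \<le> t"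
  shows "\<exists>l \<beta>. cooling_schedule 10 d n H l \<beta> \<and> \<beta> l = t"
proof (cases "t = 0")
  case True
  \<comment> \<open>A schedule of length 0 already ends at inverse temperature 0.\<close>
  have "0 \<le> schedule_scale d n" using d n by (simp add: schedule_scale_def)
  then have "cooling_schedule 10 d n H 0 (\<lambda>_. 0)" by (simp add: cooling_schedule_def)
  then show ?thesis using True by blast
next
  case False
  then have t: "0 < t" using t by simp
  define m where "m = Min (H ` {..<d})"
  have fin: "finite (H ` {..<d})" "H ` {..<d} \<noteq> {}" using d by (auto simp: lessThan_empty_iff)
  have "m \<in> H ` {..<d}" unfolding m_def by (rule Min_in[OF fin])
  then obtain x0 where x0: "x0 < d" "H x0 = m" by auto
  define h where "h x = H x - m" for x
  have H_eq: "H x = h x + m" if "x < d" for x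
    using Min_le[OF fin(1), of "H x"] that by (simp add: h_def m_def)
  have hx0: "h x0 = 0" using x0 by (simp add: h_def)
  define D where "D = ln (real d)"
  define E where "E = ln (2 * real n)"
  define c where "c = sqrt (E / D)"
  have half: "1 / 2 \<le> ln (real k)" if "2 \<le> k" for k :: nat
  proof -
    have "ln 2 \<le> ln (real k)" using that by (intro ln_mono) auto
    then show ?thesis using ln_2_ge_half by linarith
  qed
  have D: "1 / 2 \<le> D" and E: "0 < E" using half[OF d] n by (simp_all add: D_def E_def)
  have c: "0 < c" using D E by (simp add: c_def)
  define R where "R = sqrt (D * E)"
  have cD: "c * D = R" and Ec: "E / c = R"
  proof -
    have c2: "c * c = E / D" using D E by (simp add: c_def)
    have "(c * D)\<^sup>2 = (c * c) * D * D" by (simp add: power2_eq_square)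
    also have "\<dots> = D * E" using D by (simp add: c2)
    finally show "c * D = R" unfolding R_def using c D by (intro real_sqrt_unique[symmetric]) auto
    then have "E / c = (c * c * D) / c" using D by (simp add: c2)
    then show "E / c = R" using c \<open>c * D = R\<close> by simp
  qed
  have budget: "c * free_energy d h 0 + (ln (mean_energy d h 0) + ln 2) / c \<le> 2 * real (nat \<lceil>R\<rceil>)"
    if hot: "1 / 2 < mean_energy d h 0"
  proof -
    have "(\<Sum>x<d. real (h x)) \<le> real d * real n"
      using H by (intro order_trans[OF sum_bounded_above[of _ _ "real n"]]) (auto simp: h_def le_diff_conv trans_le_add1)
    then have "mean_energy d h 0 \<le> real n"
      using d by (simp add: mean_energy_def partition_fun_def divide_le_eq mult.commute)
    then have "ln (mean_energy d h 0) \<le> ln (real n)" using hot by (intro ln_mono) auto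
    then have "ln (mean_energy d h 0) + ln 2 \<le> E"
      unfolding E_def using n ln_mult_pos[of 2 "real n"] by simp
    then have "(ln (mean_energy d h 0) + ln 2) / c \<le> R" unfolding Ec[symmetric] using c by (intro divide_right_mono) auto
    moreover have "c * free_energy d h 0 = R"
      unfolding cD[symmetric] by (simp add: free_energy_def partition_fun_def D_def)
    ultimately show ?thesis by linarith
  qed
  obtain l \<beta> where \<beta>: "\<beta> 0 = 0" "\<beta> l = t"
    "\<forall>i<l. \<beta> i < \<beta> (Suc i) \<and> midpoint_gap d h (\<beta> i) (\<beta> (Suc i)) \<le> 1" "l \<le> nat \<lceil>R\<rceil> + 2"
    using schedule_exists[OF x0(1) hx0 c t budget] by blast
  have "real l \<le> 10 * schedule_scale d n"
  proof -
    define S where "S = schedule_scale d n"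
    have L: "1 / 2 \<le> ln (real n)" by (rule half[OF n])
    have "sqrt ((1 / 2) * (1 / 2)) \<le> S"
      unfolding S_def schedule_scale_def using D L by (intro real_sqrt_le_mono mult_mono) (auto simp: D_def)
    \<comment> \<open>The sizes d and n are at least 2, so S is bounded below and absorbs the
      additive 3 from rounding and the last two steps; this makes 10 large enough.\<close>
    then have S: "1 / 2 \<le> S" unfolding real_sqrt_abs2 by simp
    have "E = ln 2 + ln (real n)" unfolding E_def using n by (intro ln_mult_pos) auto
    also have "ln 2 \<le> ln (real n)" using n by (intro ln_mono) auto
    finally have "E \<le> 4 * ln (real n)" using L by linarith
    then have "R \<le> sqrt (4 * (D * ln (real n)))"
      unfolding R_def using D mult_left_mono[of E "4 * ln (real n)" D] by (intro real_sqrt_le_mono) simp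
    also have "\<dots> = 2 * S" by (simp add: real_sqrt_mult S_def schedule_scale_def D_def)
    finally have "R \<le> 2 * S" .
    moreover have "real (nat \<lceil>R\<rceil>) \<le> R + 1" using D E by (simp add: R_def)
    moreover have "real l \<le> real (nat \<lceil>R\<rceil>) + 2" using \<beta>(4) by linarith
    ultimately have "real l \<le> 10 * S" using S by linarith
    then show ?thesis by (simp add: S_def)
  qed
  moreover have "1 / 15 \<le> (cmod (qsample d (gibbs d H (\<beta> i)) \<bullet>c qsample d (gibbs d H (\<beta> (Suc i)))))\<^sup>2" if "i < l" for i
  proof -
    have q: "qsample d (gibbs d H b) = qsample d (gibbs d h b)" for b
      using gibbs_shift[OF H_eq] by (intro eq_vecI) (auto simp: qsample_def)
    \<comment> \<open>A gap of at most 1 gives squared overlap at least 1 / e, well above the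
      required 1 / 15.\<close>
    have "exp 1 * (1 / 15) \<le> (1 :: real)" using exp_le by simp
    then have "1 / 15 \<le> exp (- 1 :: real)" by (simp add: exp_minus field_simps)
    also have "\<dots> \<le> exp (- midpoint_gap d h (\<beta> i) (\<beta> (Suc i)))" using \<beta>(3) that by simp
    finally show ?thesis unfolding q using overlap_gibbs[of d h] d by simp
  qed
  ultimately have "cooling_schedule 10 d n H l \<beta>" using \<beta> by (simp add: cooling_schedule_def)
  then show ?thesis using \<beta>(2) by blast
qed

section \<open>Assembly for a given chain and schedule\<close>

lemma phase_gap_chain:
  assumes P: "reversible_ergodic_chain d \<pi> P" and \<pi>: "\<And>x. x < d \<Longrightarrow> 0 < \<pi> x" "(\<Sum>x<d. \<pi> x) = 1"
    and d: "2 \<le> d"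
  shows "0 < phase_gap (szegedy_walk d P)" "phase_gap (szegedy_walk d P) \<le> pi"
proof -
  have st: "stochastic d P" using P by (simp add: reversible_ergodic_chain_def)
  obtain t l where t: "orthonormal d d t" "\<forall>j<d. discriminant d P (t j) = complex_of_real (l j) \<cdot>\<^sub>v t j"
      "\<forall>j<d. j \<noteq> 0 \<longrightarrow> - 1 \<le> l j \<and> l j < 1"
    using discriminant_eigenbasis[OF P \<pi>] d by auto
  \<comment> \<open>A second basis vector exists, and its eigenvalue below 1 provides a nonzero walk
    phase.\<close>
  have 1: "1 < d" using d by simp
  note t1 = orthonormalD(1)[OF t(1) 1]
  have "t 1 \<noteq> 0\<^sub>v d" using orthonormalD(3)[OF t(1) 1] vnorm_eq_0[OF t1] by auto
  moreover have l: "- 1 \<le> l 1" "l 1 < 1" using t(3) 1 by auto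
  ultimately have "0 < phase_gap (szegedy_walk d P)" "phase_gap (szegedy_walk d P) \<le> arccos (l 1)"
    using phase_gap_bounds[OF st t1 _ t(2)[rule_format, OF 1]] by auto
  then show "0 < phase_gap (szegedy_walk d P)" "phase_gap (szegedy_walk d P) \<le> pi"
    using arccos_ubound[of "l 1"] l by auto
qed

text \<open>Hamiltonian, chains and oracles do not enter: of the spectra only the minimum phase gap
  is used, to fix depth and angles.\<close>

definition annealer :: "nat \<Rightarrow> (nat \<Rightarrow> nat) \<Rightarrow> nat \<Rightarrow> nat \<Rightarrow> real \<Rightarrow> real \<Rightarrow> circuit" where
  "annealer d enc n l \<Delta> \<epsilon> = register_encoding.anneal_circuit d enc l
     (ampl_word (chebyshev_angles (cosh (\<Delta> / 4)) (reflection_depth l \<Delta> \<epsilon>)))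
     (ampl_word (replicate (stage_depth l \<epsilon>) (pi / 3)))"

lemma annealer_correct:
  assumes d: "2 \<le> d" and n: "2 \<le> n" and schedule: "cooling_schedule 10 d n H l \<beta>"
    and chain: "\<And>i. i \<le> l \<Longrightarrow> reversible_ergodic_chain d (gibbs d H (\<beta> i)) (P i)"
    and \<Delta>: "\<Delta> = Min ((\<lambda>i. phase_gap (szegedy_walk d (P i))) ` {..l})"
    and enc: "encoding d enc" and oracles: "\<And>i. i \<le> l \<Longrightarrow> chain_oracle d enc (P i) (Q i)"
    and \<epsilon>: "0 < \<epsilon>" "\<epsilon> < 1"
  defines "c \<equiv> annealer d enc n l \<Delta> \<epsilon>" and "L \<equiv> schedule_scale d n"
  shows "circuit_ok 1 d l c"
    and "trace_distance (run_circuit 1 d Q c) (J_embed d enc (qsample d (gibbs d H (\<beta> l)))) \<le> \<epsilon>"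
    and "real (query_count c) \<le> 10 ^ 8 * (L / \<Delta>) * ((1 + ln (1 + L)) * (1 + ln (1 / \<epsilon>)))\<^sup>2"
proof -
  interpret register_encoding d enc by unfold_locales (rule enc)
  have d0: "0 < d" using d by simp
  note gibbs = gibbs_pos[OF d0] gibbs_sum[OF d0]
  have fin: "finite ((\<lambda>i. phase_gap (szegedy_walk d (P i))) ` {..l})" by simp
  have \<Delta>_le: "\<Delta> \<le> phase_gap (szegedy_walk d (P i))" if "i \<le> l" for i
    unfolding \<Delta> using that by (intro Min_le[OF fin]) auto
  have "\<Delta> \<in> (\<lambda>i. phase_gap (szegedy_walk d (P i))) ` {..l}" unfolding \<Delta> by (intro Min_in[OF fin]) auto
  then obtain j where j: "j \<le> l" "\<Delta> = phase_gap (szegedy_walk d (P j))" by auto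
  have \<Delta>_pos: "0 < \<Delta>" "\<Delta> \<le> pi"
    using phase_gap_chain[OF chain[OF j(1)] gibbs d] unfolding j(2) by auto
  \<comment> \<open>The scale of the Chebyshev angles in \<open>annealer\<close> is exactly the one
    that this inequality admits.\<close>
  have "cosh (\<Delta> / 4) * cos (2 * (\<Delta> / 4)) \<le> 1" using \<Delta>_pos by (intro cosh_cos_le_1) auto
  then have g: "1 \<le> cosh (\<Delta> / 4)" "cosh (\<Delta> / 4) * cos (\<Delta> / 2) \<le> 1" by (simp_all add: cosh_real_ge_1)
  have s: "\<beta> 0 = 0" "real l \<le> 10 * L" "\<And>i. i < l \<Longrightarrow>
      1 / 15 \<le> (cmod (qsample d (gibbs d H (\<beta> i)) \<bullet>c qsample d (gibbs d H (\<beta> (Suc i)))))\<^sup>2"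
    using schedule by (auto simp: cooling_schedule_def L_def)
  show "circuit_ok 1 d l c" unfolding c_def annealer_def by (rule circuit_ok_anneal[OF d0])
  have "trace_distance (run_circuit 1 d Q c) (J (qsample d (gibbs d H (\<beta> l))))
      \<le> l * (3 ^ stage_depth l \<epsilon> * (2 / chebyshev3 (reflection_depth l \<Delta> \<epsilon>) (cosh (\<Delta> / 4)))
          + sqrt (14 / 15) ^ 3 ^ stage_depth l \<epsilon>)"
    unfolding c_def annealer_def
    by (rule anneal_trace_distance[where P = P and \<mu> = "\<lambda>i. gibbs d H (\<beta> i)" and \<Delta> = \<Delta>])
      (use s(3) in \<open>auto intro: oracles chain gibbs d0 \<Delta>_pos \<Delta>_le g simp: s(1) gibbs_0\<close>)
  also have "\<dots> \<le> \<epsilon>" by (rule anneal_error_le[OF \<epsilon> \<Delta>_pos(1)])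
  finally show "trace_distance (run_circuit 1 d Q c) (J (qsample d (gibbs d H (\<beta> l)))) \<le> \<epsilon>" .
  let ?V = "ampl_word (replicate (stage_depth l \<epsilon>) (pi / 3))"
  have "length ?V + 1 = 3 ^ stage_depth l \<epsilon>" by (simp only: length_ampl_word length_replicate)
  then have "length ?V \<le> 3 ^ stage_depth l \<epsilon>" by linarith
  then have "query_count c \<le> l * (3 ^ stage_depth l \<epsilon> * (2 * 3 ^ reflection_depth l \<Delta> \<epsilon>))"
    unfolding c_def annealer_def query_count_anneal length_chebyshev_angles
    by (intro mult_left_mono mult_right_mono) auto
  then have "real (query_count c) \<le> real (l * (3 ^ stage_depth l \<epsilon> * (2 * 3 ^ reflection_depth l \<Delta> \<epsilon>)))"
    by (rule of_nat_mono)
  also have "\<dots> = real l * (3 ^ stage_depth l \<epsilon> * (2 * 3 ^ reflection_depth l \<Delta> \<epsilon>))" by simp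
  also have "\<dots> \<le> 10 ^ 8 * (L / \<Delta>) * ((1 + ln (1 + L)) * (1 + ln (1 / \<epsilon>)))\<^sup>2"
    using d n s(2) by (intro anneal_query_bound \<epsilon> \<Delta>_pos) (auto simp: L_def schedule_scale_def)
  finally show "real (query_count c) \<le> 10 ^ 8 * (L / \<Delta>) * ((1 + ln (1 + L)) * (1 + ln (1 / \<epsilon>)))\<^sup>2" .
qed

text \<open>Constants, exponent and algorithm precede the instance, so the bound is uniform; the
  algorithm returns a circuit before the oracles are fixed and reaches them only through its query
  gates.\<close>

theorem mainTheorem2:
  shows "\<exists>C\<^sub>0 > 0. \<exists>C > 0. \<exists>k :: nat.
    \<exists>alg :: nat \<Rightarrow> (nat \<Rightarrow> nat) \<Rightarrow> nat \<Rightarrow> nat \<Rightarrow> real \<Rightarrow> real \<Rightarrow> circuit.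
    \<forall>(d :: nat) (n :: nat) (H :: nat \<Rightarrow> nat). 2 \<le> d \<longrightarrow> 2 \<le> n \<longrightarrow> (\<forall>x<d. H x \<le> n) \<longrightarrow>
      (\<forall>\<beta>_target \<ge> 0. \<exists>l \<beta>. cooling_schedule C\<^sub>0 d n H l \<beta> \<and> \<beta> l = \<beta>_target) \<and>
      (\<forall>(l :: nat) (\<beta> :: nat \<Rightarrow> real) (P :: nat \<Rightarrow> real mat) (enc :: nat \<Rightarrow> nat)
        (Q :: nat \<Rightarrow> complex mat) (\<delta>_min :: real) (\<Delta>_min :: real) (\<epsilon> :: real).
        cooling_schedule C\<^sub>0 d n H l \<beta> \<longrightarrow>
        (\<forall>i\<le>l. reversible_ergodic_chain d (gibbs d H (\<beta> i)) (P i)) \<longrightarrow>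
        \<delta>_min = Min ((\<lambda>i. spectral_gap (P i)) ` {..l}) \<longrightarrow>
        \<Delta>_min = Min ((\<lambda>i. phase_gap (szegedy_walk d (P i))) ` {..l}) \<longrightarrow>
        encoding d enc \<longrightarrow>
        (\<forall>i\<le>l. chain_oracle d enc (P i) (Q i)) \<longrightarrow>
        0 < \<epsilon> \<longrightarrow> \<epsilon> < 1 \<longrightarrow>
        (let L = schedule_scale d n; c = alg d enc n l \<Delta>_min \<epsilon> in
          circuit_ok 1 d l c \<and>
          trace_distance (run_circuit 1 d Q c) (J_embed d enc (qsample d (gibbs d H (\<beta> l)))) \<le> \<epsilon> \<and>
          real (query_count c)
            \<le> C * (L / \<Delta>_min) * ((1 + ln (1 + L)) * (1 + ln (1 / \<epsilon>))) ^ k))"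
\<comment> \<open>The schedule constant 10 comes from \<open>cooling_schedule_exists\<close>; 10 ^ 8
  and the exponent 2 come from \<open>anneal_query_bound\<close>.\<close>
proof (rule exI[of _ "10 :: real"], rule conjI, simp, rule exI[of _ "10 ^ 8 :: real"], rule conjI, simp,
    rule exI[of _ "2 :: nat"], rule exI[of _ annealer], intro allI impI conjI, goal_cases)
  case (1 d n H \<beta>_target)
  then show ?case by (intro cooling_schedule_exists) auto
next
  case (2 d n H l \<beta> P enc Q \<delta>_min \<Delta>_min \<epsilon>)
  then have "\<And>i. i \<le> l \<Longrightarrow> reversible_ergodic_chain d (gibbs d H (\<beta> i)) (P i)"
    "\<And>i. i \<le> l \<Longrightarrow> chain_oracle d enc (P i) (Q i)" by blast+
  from annealer_correct[OF 2(1,2,4) this(1) 2(7,8) this(2) 2(10,11)]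
  show ?case unfolding Let_def by blast
qed

end
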